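(* Let $\Phi:X\to Y$ be a map between metric spaces that preserves the length of rectifiable curves, i.e., $\ell_Y(\Phi\circ\gamma)=\ell_X(\gamma)$ for all rectifiable curves $\gamma:[a,b]\to X$. Let $f:\Omega\to X$ be a locally Lipschitz map defined on an open set $\Omega\subset\mathbb{R}^n$ for some $n$, and let $\tilde X=f(\Omega)$. Then for any Borel function $g:\tilde X\to[0,\infty]$ we have $$\int_{\tilde X}g(x)\,d\mathcal{H}^n(x)=\int_{\Phi(\tilde X)}\Big(\sum_{x\in\Phi^{-1}(y)\cap\tilde X}g(x)\Big)\,d\mathcal{H}^n(y).$$
   Context: $\Phi$ is not assumed to be continuous. A curve in $X$ is a continuous map $\gamma:[a,b]\to X$; the length $\ell_X(\gamma)$ (and likewise $\ell_Y(\Phi\circ\gamma)$) is the supremum over all partitions $a=t_0<\dots<t_N=b$ of $\sum_i d(\gamma(t_i),\gamma(t_{i+1}))$; a curve is rectifiable if its length is finite. $\mathcal{H}^n$ is the $n$-dimensional Hausdorff measure, $\mathcal{H}^n(E)=\lim_{\delta\to0^+}\inf\sum_i\frac{\omega_n}{2^n}(\operatorname{diam}A_i)^n$, the infimum over countable coverings $E\subset\bigcup_iA_i$ with $\operatorname{diam}A_i\le\delta$, where $\omega_n$ is the volume of the unit ball in $\mathbb{R}^n$. *)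

theory Defs
  imports "HOL-Analysis.Analysis"
begin

text \<open>
  Only the values of \<open>\<gamma>\<close> on \<open>{a..b}\<close> matter.  For \<open>a = b\<close> the only partition has \<open>N = 0\<close>,
  so the length is \<open>0\<close>.
\<close>

definition curve_length :: "real \<Rightarrow> real \<Rightarrow> (real \<Rightarrow> 'a::metric_space) \<Rightarrow> ennreal" where
  "curve_length a b \<gamma> =
     (SUP (N, t) \<in> {(N :: nat, t :: nat \<Rightarrow> real).
                      t 0 = a \<and> t N = b \<and> (\<forall>i<N. t i < t (Suc i))}.
        \<Sum>i<N. ennreal (dist (\<gamma> (t i)) (\<gamma> (t (Suc i)))))"

definition rectifiable_curve :: "real \<Rightarrow> real \<Rightarrow> (real \<Rightarrow> 'a::metric_space) \<Rightarrow> bool" where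
  "rectifiable_curve a b \<gamma> \<longleftrightarrow>
     a \<le> b \<and> continuous_on {a..b} \<gamma> \<and> curve_length a b \<gamma> < \<infinity>"

definition preserves_curve_length :: "('a::metric_space \<Rightarrow> 'b::metric_space) \<Rightarrow> bool" where
  "preserves_curve_length \<Phi> \<longleftrightarrow>
     (\<forall>a b \<gamma>. rectifiable_curve a b \<gamma> \<longrightarrow>
        curve_length a b (\<Phi> \<circ> \<gamma>) = curve_length a b \<gamma>)"

definition locally_lipschitz_on :: "'a::metric_space set \<Rightarrow> ('a \<Rightarrow> 'b::metric_space) \<Rightarrow> bool" where
  "locally_lipschitz_on S f \<longleftrightarrow>
     (\<forall>x\<in>S. \<exists>r>0. \<exists>L. L-lipschitz_on (ball x r \<inter> S) f)"

text \<open>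
  The empty set contributes \<open>0\<close> also when \<open>n = 0\<close> (where \<open>0 ^ 0 = 1\<close>), so that coverings by
  fewer than countably many sets can be padded with empty sets; nonempty sets of diameter \<open>0\<close>
  contribute \<open>1\<close> when \<open>n = 0\<close>.
\<close>

definition hausdorff_gauge :: "nat \<Rightarrow> 'a::metric_space set \<Rightarrow> ennreal" where
  "hausdorff_gauge n A =
     (if A = {} then 0 else ennreal (unit_ball_vol (real n) / 2 ^ n * diameter A ^ n))"

text \<open>
  Boundedness of the covering sets is part of \<open>diam A \<le> \<delta>\<close>; it has to be stated separately
  because \<^const>\<open>diameter\<close> is real-valued and unspecified on unbounded sets.
\<close>

definition hausdorff_pre :: "nat \<Rightarrow> real \<Rightarrow> 'a::metric_space set \<Rightarrow> ennreal" where
  "hausdorff_pre n \<delta> E =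
     (INF A \<in> {A :: nat \<Rightarrow> 'a set. E \<subseteq> (\<Union>i. A i) \<and> (\<forall>i. bounded (A i) \<and> diameter (A i) \<le> \<delta>)}.
        \<Sum>i. hausdorff_gauge n (A i))"

definition hausdorff_outer :: "nat \<Rightarrow> 'a::metric_space set \<Rightarrow> ennreal" where
  "hausdorff_outer n E = Lim (at_right 0) (\<lambda>\<delta>. hausdorff_pre n \<delta> E)"

text \<open>
  The Hausdorff measure as a measure space on the sigma-algebra of all Caratheodory-measurable
  sets (not just the Borel sets): images of Borel sets and sums over fibres are in general
  measurable only in this sense.
\<close>

definition hausdorff_measure :: "nat \<Rightarrow> 'a::metric_space measure" where
  "hausdorff_measure n =
     measure_of UNIV (lambda_system UNIV UNIV (hausdorff_outer n)) (hausdorff_outer n)"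

lemma hausdorff_pre_antimono: "\<delta> \<le> \<epsilon> \<Longrightarrow> hausdorff_pre n \<epsilon> E \<le> hausdorff_pre n \<delta> E"
  unfolding hausdorff_pre_def by (rule INF_superset_mono) (auto intro: order_trans)

lemma hausdorff_pre_tendsto:
  "((\<lambda>\<delta>. hausdorff_pre n \<delta> E) \<longlongrightarrow> (SUP \<delta>\<in>{0<..}. hausdorff_pre n \<delta> E)) (at_right 0)"
proof (rule order_tendstoI)
  fix a assume "a < (SUP \<delta>\<in>{0<..}. hausdorff_pre n \<delta> E)"
  then obtain \<delta> where d: "\<delta> > 0" "a < hausdorff_pre n \<delta> E"
    by (auto simp: less_SUP_iff)
  then have "\<forall>\<epsilon>>0. \<epsilon> < \<delta> \<longrightarrow> a < hausdorff_pre n \<epsilon> E"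
    by (meson hausdorff_pre_antimono less_imp_le less_le_trans)
  with d(1) show "\<forall>\<^sub>F \<epsilon> in at_right 0. a < hausdorff_pre n \<epsilon> E"
    by (auto simp: eventually_at_right_field)
next
  fix a assume a: "(SUP \<delta>\<in>{0<..}. hausdorff_pre n \<delta> E) < a"
  have "hausdorff_pre n \<epsilon> E < a" if "\<epsilon> > 0" for \<epsilon>
    using that by (intro le_less_trans[OF _ a] SUP_upper) auto
  then show "\<forall>\<^sub>F \<epsilon> in at_right 0. hausdorff_pre n \<epsilon> E < a"
    by (auto simp: eventually_at_right_field intro!: exI[of _ 1])
qed

lemma hausdorff_outer_eq_SUP: "hausdorff_outer n E = (SUP \<delta>\<in>{0<..}. hausdorff_pre n \<delta> E)"
  unfolding hausdorff_outer_def by (intro tendsto_Lim hausdorff_pre_tendsto) simp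

lemma hausdorff_pre_empty: "\<delta> \<ge> 0 \<Longrightarrow> hausdorff_pre n \<delta> {} = 0"
  unfolding hausdorff_pre_def
  by (rule antisym, rule INF_lower2[of "\<lambda>_. {}"]) (auto simp: hausdorff_gauge_def)

lemma hausdorff_pre_mono: "E \<subseteq> F \<Longrightarrow> hausdorff_pre n \<delta> E \<le> hausdorff_pre n \<delta> F"
  unfolding hausdorff_pre_def by (rule INF_superset_mono) auto

lemma hausdorff_pre_subadditive:
  fixes E :: "nat \<Rightarrow> 'a::metric_space set"
  shows "hausdorff_pre n \<delta> (\<Union>i. E i) \<le> (\<Sum>i. hausdorff_pre n \<delta> (E i))"
proof (rule ennreal_le_epsilon)
  fix e :: real
  assume e: "0 < e" and fin: "(\<Sum>i. hausdorff_pre n \<delta> (E i)) < top"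
  define cov where "cov = (\<lambda>F. {A :: nat \<Rightarrow> 'a set. F \<subseteq> (\<Union>i. A i) \<and>
      (\<forall>i. bounded (A i) \<and> diameter (A i) \<le> \<delta>)})"
  have "\<exists>A. A \<in> cov (E i) \<and>
      (\<Sum>j. hausdorff_gauge n (A j)) \<le> hausdorff_pre n \<delta> (E i) + ennreal (e * (1/2) ^ Suc i)" for i
  proof -
    have "hausdorff_pre n \<delta> (E i) < top"
      using fin ennreal_suminf_lessD by blast
    then have "hausdorff_pre n \<delta> (E i) < hausdorff_pre n \<delta> (E i) + ennreal (e * (1/2) ^ Suc i)"
      using e by (cases "hausdorff_pre n \<delta> (E i)")
        (simp_all flip: ennreal_plus add: ennreal_less_iff del: ennreal_plus)
    then show ?thesis
      unfolding hausdorff_pre_def INF_less_iff cov_def by (auto intro: less_imp_le)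
  qed
  then obtain A where A: "\<And>i. A i \<in> cov (E i)" and
    le: "\<And>i. (\<Sum>j. hausdorff_gauge n (A i j)) \<le>
              hausdorff_pre n \<delta> (E i) + ennreal (e * (1/2) ^ Suc i)"
    by metis
  define B where "B = (\<lambda>k. case prod_decode k of (i, j) \<Rightarrow> A i j)"
  have "(\<Union>i. E i) \<subseteq> (\<Union>k. B k)"
  proof
    fix x assume "x \<in> (\<Union>i. E i)"
    then obtain i j where "x \<in> A i j"
      using A by (fastforce simp: cov_def)
    then have "x \<in> B (prod_encode (i, j))" by (simp add: B_def)
    then show "x \<in> (\<Union>k. B k)" by blast
  qed
  then have "B \<in> cov (\<Union>i. E i)"
    using A by (auto simp: cov_def B_def split: prod.split)
  then have "hausdorff_pre n \<delta> (\<Union>i. E i) \<le> (\<Sum>k. hausdorff_gauge n (B k))"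
    unfolding hausdorff_pre_def cov_def by (rule INF_lower)
  also have "\<dots> = (\<Sum>i. \<Sum>j. hausdorff_gauge n (A i j))"
    using suminf_ennreal_2dimen[of "\<lambda>i. \<Sum>j. hausdorff_gauge n (A i j)"
        "\<lambda>(i, j). hausdorff_gauge n (A i j)"]
    by (simp add: B_def comp_def case_prod_beta)
  also have "\<dots> \<le> (\<Sum>i. hausdorff_pre n \<delta> (E i) + ennreal (e * (1/2) ^ Suc i))"
    by (intro suminf_le le) auto
  also have "\<dots> = (\<Sum>i. hausdorff_pre n \<delta> (E i)) + (\<Sum>i. ennreal (e * (1/2) ^ Suc i))"
    by (intro suminf_add[symmetric]) auto
  also have "(\<Sum>i. ennreal (e * (1/2) ^ Suc i)) = ennreal e"
    using e sums_mult[OF power_half_series, of e]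
    by (intro suminf_ennreal_eq) auto
  finally show "hausdorff_pre n \<delta> (\<Union>i. E i) \<le> (\<Sum>i. hausdorff_pre n \<delta> (E i)) + ennreal e" .
qed

lemma outer_measure_space_hausdorff_outer: "outer_measure_space UNIV (hausdorff_outer n :: 'a::metric_space set \<Rightarrow> ennreal)"
  unfolding outer_measure_space_def
proof (intro conjI)
  show "positive UNIV (hausdorff_outer n :: 'a set \<Rightarrow> ennreal)"
    by (auto simp: positive_def hausdorff_outer_eq_SUP hausdorff_pre_empty)
  show "increasing UNIV (hausdorff_outer n :: 'a set \<Rightarrow> ennreal)"
    by (auto simp: increasing_def hausdorff_outer_eq_SUP intro!: SUP_mono' hausdorff_pre_mono)
  show "countably_subadditive UNIV (hausdorff_outer n :: 'a set \<Rightarrow> ennreal)"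
    unfolding countably_subadditive_def
  proof (intro allI impI)
    fix E :: "nat \<Rightarrow> 'a set"
    show "hausdorff_outer n (\<Union>i. E i) \<le> (\<Sum>i. hausdorff_outer n (E i))"
      unfolding hausdorff_outer_eq_SUP[of n "\<Union>i. E i"]
    proof (rule SUP_least)
      fix \<delta> :: real assume "\<delta> \<in> {0<..}"
      then have "(\<Sum>i. hausdorff_pre n \<delta> (E i)) \<le> (\<Sum>i. hausdorff_outer n (E i))"
        by (intro suminf_le) (auto simp: hausdorff_outer_eq_SUP intro: SUP_upper)
      then show "hausdorff_pre n \<delta> (\<Union>i. E i) \<le> (\<Sum>i. hausdorff_outer n (E i))"
        using hausdorff_pre_subadditive order_trans by blast
    qed
  qed
qed

lemma measure_space_hausdorff_outer:
  "measure_space UNIV (lambda_system UNIV UNIV (hausdorff_outer n)) (hausdorff_outer n)"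
  by (rule sigma_algebra.caratheodory_lemma[OF sigma_algebra_Pow, of UNIV, unfolded Pow_UNIV])
     (rule outer_measure_space_hausdorff_outer)

lemma space_hausdorff_measure [simp]: "space (hausdorff_measure n) = UNIV"
  by (simp add: hausdorff_measure_def space_measure_of_conv)

lemma sets_hausdorff_measure:
  "sets (hausdorff_measure n) = lambda_system UNIV UNIV (hausdorff_outer n)"
  unfolding hausdorff_measure_def
  by (rule sigma_algebra.sets_measure_of_eq)
     (use measure_space_hausdorff_outer in \<open>auto simp: measure_space_def\<close>)

lemma emeasure_hausdorff_measure:
  "A \<in> sets (hausdorff_measure n) \<Longrightarrow> emeasure (hausdorff_measure n) A = hausdorff_outer n A"
  unfolding sets_hausdorff_measure unfolding hausdorff_measure_def
  by (rule emeasure_measure_of_sigma)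
     (use measure_space_hausdorff_outer in \<open>auto simp: measure_space_def\<close>)

end

theory Submission
  imports Defs
begin

text \<open>
  Write \<open>h = \<Phi> \<circ> f\<close>. On a ball where \<open>f\<close> is Lipschitz every segment is mapped to a rectifiable
  curve, so preservation of length makes \<open>h\<close> Lipschitz with the same constant, and the images of
  each segment under \<open>f\<close> and \<open>h\<close> have the same length. The proof shows that this determines the
  distances: \<open>dist (f x) (f z) - dist (h x) (h z) = o(\<bar>x - z\<bar>)\<close> at almost every \<open>x\<close>. The two
  integrals are then compared with each other directly; the Hausdorff measure is related to Lebesgue
  measure only through upper bounds, by which the images of exceptional sets are null.

  Along a line, the excess of arc length over distance is a superadditive function of intervals with
  arbitrarily small sums over fine partitions, so a Vitali covering argument shows that it is \<open>o(t)\<close>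
  on intervals of length \<open>t\<close> at almost every point (\<open>arc_length_excess_negligible\<close>). Hence \<open>f\<close> and
  \<open>h\<close>, which have the same arc length, have the same metric derivative in a given direction.
  Fubini's theorem and finite nets of directions turn this into the estimate above, and they also
  show that almost every \<open>x\<close> is of one of two kinds (\<open>ae_metric_dichotomy\<close>):

    \<^item> \<open>dist (f x) (f z) \<ge> c * \<bar>x - z\<bar>\<close> for some \<open>c > 0\<close> and all \<open>z\<close> near \<open>x\<close>. There an error
      \<open>o(\<bar>x - z\<bar>)\<close> is, for \<open>z\<close> near \<open>x\<close>, below any given positive multiple of \<open>dist (f x) (f z)\<close>.
      Given \<open>\<epsilon>\<close>, countably many compact sets \<open>K\<close> cover these points such that \<open>\<Phi>\<close> distorts distances
      on \<open>f ` K\<close> by factors between \<open>1 - \<epsilon>\<close> and \<open>1 + \<epsilon>\<close>.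

    \<^item> \<open>x\<close> is flat: for each \<open>a > 0\<close> there is a direction in which \<open>f\<close> moves with speed at most \<open>a\<close>
      on a short segment starting at \<open>x\<close>. A cube of side \<open>s\<close> is the union of about \<open>a powr (1 - n)\<close>
      tubes in such a direction, each with an image of diameter \<open>O(a * s)\<close>, so the image of the flat
      points in the cube has \<open>n\<close>-dimensional measure \<open>O(a * s ^ n)\<close>. With \<open>a \<rightarrow> 0\<close> the image is a
      null set (\<open>hausdorff_outer_flat_points_null\<close>).

  So both \<open>f ` \<Omega>\<close> and its image under \<open>\<Phi>\<close> are, up to null sets, covered by pieces on which \<open>\<Phi>\<close> is
  nearly isometric (\<open>lipschitz_image_decomposition\<close>). On each piece \<open>\<Phi>\<close> is injective and changes the
  Hausdorff measure, and with it integrals, by a factor close to \<open>1\<close> (\<open>near_isometry_integral\<close>).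
  Once the pieces of \<open>f ` \<Omega>\<close> are made disjoint, the sum over the fibre of \<open>y\<close> becomes a sum over the
  pieces, which can be integrated term by term (\<open>integral_comparison\<close>). Finally \<open>\<epsilon> \<rightarrow> 0\<close>.
\<close>

section \<open>Superadditive interval functions\<close>

definition superadditive_on :: "real \<Rightarrow> real \<Rightarrow> (real \<Rightarrow> real \<Rightarrow> real) \<Rightarrow> bool" where
  "superadditive_on p q e \<longleftrightarrow>
     (\<forall>s t. p \<le> s \<and> s \<le> t \<and> t \<le> q \<longrightarrow> 0 \<le> e s t) \<and>
     (\<forall>s t u. p \<le> s \<and> s \<le> t \<and> t \<le> u \<and> u \<le> q \<longrightarrow> e s t + e t u \<le> e s u)"

lemma superadditive_on_subinterval:
  "superadditive_on p q e \<Longrightarrow> p \<le> p' \<Longrightarrow> q' \<le> q \<Longrightarrow> superadditive_on p' q' e"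
  unfolding superadditive_on_def by fastforce

text \<open>
  Induction on the intervals in the order of their left endpoints: all the others lie to the left of
  the last one, and the gaps contribute nonnegative amounts.
\<close>

lemma superadditive_on_disjoint_sum:
  assumes "finite F" and "superadditive_on p q e" and "p \<le> q"
    and "\<And>s t. (s, t) \<in> F \<Longrightarrow> p \<le> s \<and> s < t \<and> t \<le> q"
    and "pairwise (\<lambda>i j. {fst i..snd i} \<inter> {fst j..snd j} = {}) F"
  shows "(\<Sum>(s, t)\<in>F. e s t) \<le> e p q"
  using assms
proof (induction F arbitrary: q rule: finite_ranking_induct[where f = fst])
  case empty
  then show ?case by (auto simp: superadditive_on_def)
next
  case (insert x F)
  show ?case
  proof (cases "x \<in> F")
    case True
    then show ?thesis using insert by (auto simp: insert_absorb)
  next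
    case False
    obtain s t where x: "x = (s, t)" by (cases x)
    have st: "p \<le> s" "s < t" "t \<le> q" using insert.prems(3)[of s t] x by auto
    have "t' \<le> s" if F: "(s', t') \<in> F" for s' t'
    proof (rule ccontr)
      assume "\<not> t' \<le> s"
      then have "s \<in> {s'..t'}" using insert.hyps(2)[OF F] x by auto
      moreover have "{s'..t'} \<inter> {s..t} = {}"
        using insert.prems(4) F x False by (auto simp: pairwise_def)
      ultimately show False using st by auto
    qed
    then have "(\<Sum>(s, t)\<in>F. e s t) \<le> e p s"
      using st insert.prems
      by (intro insert.IH superadditive_on_subinterval[OF insert.prems(1)])
         (auto simp: pairwise_insert)
    moreover have "e p s + e s t \<le> e p t" "e p t + e t q \<le> e p q" "0 \<le> e t q"
      using insert.prems(1) st unfolding superadditive_on_def by auto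
    ultimately show ?thesis using insert.hyps(1) False x by auto
  qed
qed

text \<open>
  The intervals covering a point need not be centred at it, so one-sided difference quotients can be
  handled by intervals with left endpoint \<open>x\<close>.
\<close>

lemma vitali_covering_intervals:
  fixes K :: "(real \<times> real) set"
  assumes "\<And>s t. (s, t) \<in> K \<Longrightarrow> s < t"
    and "\<And>x d. x \<in> S \<Longrightarrow> 0 < d \<Longrightarrow> \<exists>s t. (s, t) \<in> K \<and> x \<in> {s..t} \<and> t - s < d"
  obtains C where "countable C" "C \<subseteq> K"
    "pairwise (\<lambda>i j. {fst i..snd i} \<inter> {fst j..snd j} = {}) C"
    "negligible (S - (\<Union>(s, t)\<in>C. {s..t}))"
proof -
  define a r where "a = (\<lambda>i :: real \<times> real. (fst i + snd i) / 2)"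
    and "r = (\<lambda>i :: real \<times> real. (snd i - fst i) / 2)"
  have cb: "cball (a i) (r i) = {fst i..snd i}" for i
    by (simp add: cball_eq_atLeastAtMost a_def r_def field_simps)
  have small: "\<exists>i. i \<in> K \<and> x \<in> cball (a i) (r i) \<and> r i < d" if xd: "x \<in> S" "0 < d" for x d
  proof -
    obtain s t where "(s, t) \<in> K" "x \<in> {s..t}" "t - s < d" using assms(2)[OF xd] by blast
    then show ?thesis by (intro exI[of _ "(s, t)"]) (auto simp: cb, auto simp: r_def)
  qed
  have "\<And>i. i \<in> K \<Longrightarrow> 0 < r i" using assms(1) by (auto simp: r_def)
  from this small obtain C where C: "countable C" "C \<subseteq> K"
     "pairwise (\<lambda>i j. disjnt (cball (a i) (r i)) (cball (a j) (r j))) C"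
     "negligible (S - (\<Union>i \<in> C. cball (a i) (r i)))"
    by (rule Vitali_covering_theorem_cballs[of K r S a])
  have "pairwise (\<lambda>i j. {fst i..snd i} \<inter> {fst j..snd j} = {}) C"
    using C(3) unfolding cb disjnt_def .
  moreover have "negligible (S - (\<Union>(s, t)\<in>C. {s..t}))"
    using C(4) unfolding cb case_prod_unfold .
  ultimately show ?thesis by (rule that[OF C(1,2)])
qed

lemma superadditive_on_disjoint_measure:
  assumes C: "countable C" "pairwise (\<lambda>i j. {fst i..snd i} \<inter> {fst j..snd j} = {}) C"
    and C_in: "\<And>s t. (s, t) \<in> C \<Longrightarrow> p \<le> s \<and> s < t \<and> t \<le> q"
    and e: "superadditive_on p q e" "p \<le> q"
    and T: "\<And>s t. (s, t) \<in> C \<Longrightarrow> T (s, t) \<in> lmeasurable \<and> measure lebesgue (T (s, t)) \<le> c * e s t"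
    and "0 \<le> c"
  shows "(\<Union>i\<in>C. T i) \<in> lmeasurable" "measure lebesgue (\<Union>i\<in>C. T i) \<le> c * e p q"
proof -
  have "measure lebesgue (\<Union>i\<in>F. T i) \<le> c * e p q" if F: "F \<subseteq> C" "finite F" for F
  proof -
    have "measure lebesgue (\<Union>i\<in>F. T i) \<le> (\<Sum>i\<in>F. measure lebesgue (T i))"
      using F T by (intro measure_UNION_le) (auto simp: fmeasurableD)
    also have "\<dots> \<le> (\<Sum>(s, t)\<in>F. c * e s t)"
      using F T by (intro sum_mono) auto
    also have "\<dots> = c * (\<Sum>(s, t)\<in>F. e s t)"
      by (simp add: sum_distrib_left case_prod_beta)
    also have "\<dots> \<le> c * e p q"
      using F C_in C(2)
      by (intro mult_left_mono superadditive_on_disjoint_sum e \<open>0 \<le> c\<close>) (auto intro: pairwise_subset)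
    finally show ?thesis .
  qed
  moreover have "T i \<in> lmeasurable" if "i \<in> C" for i
    using T[of "fst i" "snd i"] that by simp
  ultimately show "(\<Union>i\<in>C. T i) \<in> lmeasurable" "measure lebesgue (\<Union>i\<in>C. T i) \<le> c * e p q"
    using fmeasurable_UN_bound[OF C(1), of T lebesgue] measure_UN_bound[OF C(1), of T lebesgue] by blast+
qed

text \<open>
  This is the weak-type estimate on which all statements about almost every point of a line rest:
  disjoint intervals with \<open>\<eta> * (t - s) \<le> e s t\<close> have total length at most \<open>e p q / \<eta>\<close>, and by
  Vitali's theorem such intervals cover almost all of \<open>S\<close>. They form, together with a null set, the
  measurable set \<open>T\<close>.
\<close>

lemma superadditive_on_maximal:
  assumes e: "superadditive_on p q e" "p \<le> q" and "\<eta> > 0"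
    and S: "\<And>x d. x \<in> S \<Longrightarrow> 0 < d \<Longrightarrow>
        \<exists>s t. p \<le> s \<and> s < t \<and> t \<le> q \<and> x \<in> {s..t} \<and> t - s < d \<and> \<eta> * (t - s) \<le> e s t"
  obtains T where "S \<subseteq> T" "T \<in> lmeasurable" "measure lebesgue T \<le> e p q / \<eta>"
proof -
  define K where "K = {(s, t). p \<le> s \<and> s < t \<and> t \<le> q \<and> \<eta> * (t - s) \<le> e s t}"
  obtain C where C: "countable C" "C \<subseteq> K"
    "pairwise (\<lambda>i j. {fst i..snd i} \<inter> {fst j..snd j} = {}) C"
    "negligible (S - (\<Union>(s, t)\<in>C. {s..t}))"
    by (rule vitali_covering_intervals[of K S]) (use S in \<open>auto simp: K_def, fast\<close>)
  let ?U = "\<Union>i\<in>C. {fst i..snd i}"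
  have "?U \<in> lmeasurable \<and> measure lebesgue ?U \<le> (1 / \<eta>) * e p q"
    using superadditive_on_disjoint_measure[OF C(1,3) _ e, of "\<lambda>i. {fst i..snd i}" "1 / \<eta>"] C(2) \<open>\<eta> > 0\<close>
    by (force simp: K_def field_simps)
  then have U: "?U \<in> lmeasurable" "measure lebesgue ?U \<le> e p q / \<eta>" by auto
  have N: "S - ?U \<in> null_sets lebesgue"
    using C(4) by (simp add: negligible_iff_null_sets case_prod_beta)
  have "?U \<union> (S - ?U) \<in> lmeasurable"
    by (rule fmeasurable.Un[OF U(1) fmeasurableI_null_sets[OF N]])
  moreover have "measure lebesgue (?U \<union> (S - ?U)) \<le> e p q / \<eta>"
    using measure_Un_null_set[OF fmeasurableD[OF U(1)] N] U(2) by simp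
  ultimately show ?thesis by (intro that[of "?U \<union> (S - ?U)"]) auto
qed

text \<open>
  The infimum \<open>M\<close> of the measures of measurable sets containing \<open>S\<close> satisfies \<open>M \<le> c * M\<close> with
  \<open>c < 1\<close>.
\<close>

lemma negligible_if_outer_measure_shrinks:
  fixes S :: "'a::euclidean_space set"
  assumes "S \<subseteq> B" "B \<in> lmeasurable" and c: "c < 1"
    and shrink: "\<And>T \<epsilon>. S \<subseteq> T \<Longrightarrow> T \<in> lmeasurable \<Longrightarrow> \<epsilon> > 0 \<Longrightarrow>
       \<exists>T'. S \<subseteq> T' \<and> T' \<in> lmeasurable \<and> measure lebesgue T' \<le> c * (measure lebesgue T + \<epsilon>)"
    and "0 < c"
  shows "negligible S"
proof -
  define \<T> where "\<T> = {T. S \<subseteq> T \<and> T \<in> lmeasurable}"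
  define M where "M = Inf (measure lebesgue ` \<T>)"
  have bdd: "bdd_below (measure lebesgue ` \<T>)"
    by (rule bdd_belowI[of _ 0]) auto
  have ne: "measure lebesgue ` \<T> \<noteq> {}" using assms(1,2) by (auto simp: \<T>_def)
  have M: "M \<le> measure lebesgue T" if "T \<in> \<T>" for T
    unfolding M_def using that by (intro cInf_lower bdd) auto
  have "M / c \<le> M + \<epsilon>" if "\<epsilon> > 0" for \<epsilon>
  proof -
    have "M / c - \<epsilon> \<le> m" if m: "m \<in> measure lebesgue ` \<T>" for m
    proof -
      obtain T where T: "T \<in> \<T>" "m = measure lebesgue T" using m by auto
      then obtain T' where T': "T' \<in> \<T>" "measure lebesgue T' \<le> c * (m + \<epsilon>)"
        using shrink[of T \<epsilon>] \<open>\<epsilon> > 0\<close> by (auto simp: \<T>_def)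
      then have "M \<le> c * (m + \<epsilon>)" using M by fastforce
      then show ?thesis using \<open>0 < c\<close> by (simp add: field_simps)
    qed
    then have "M / c - \<epsilon> \<le> M" unfolding M_def by (rule cInf_greatest[OF ne])
    then show ?thesis by simp
  qed
  then have "M / c \<le> M" by (rule field_le_epsilon)
  then have "M * (1 - c) \<le> 0" using \<open>0 < c\<close> by (simp add: field_simps)
  then have M0: "M \<le> 0" using c by (simp add: mult_le_0_iff)
  have "\<exists>T. S \<subseteq> T \<and> T \<in> lmeasurable \<and> measure lebesgue T \<le> \<epsilon>" if "\<epsilon> > 0" for \<epsilon>
  proof -
    have "\<exists>m\<in>measure lebesgue ` \<T>. m < \<epsilon>"
      using cInf_lessD[OF ne, of \<epsilon>] M0 that unfolding M_def by simp
    then show ?thesis by (auto simp: \<T>_def intro: less_imp_le)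
  qed
  then show ?thesis by (simp add: negligible_outer_le)
qed

text \<open>
  A monotone function has, at almost every point, no gap between its lower and upper right
  derivatives. Intervals with slope at most \<open>a\<close> cover the exceptional set efficiently, and inside
  them the intervals with slope at least \<open>b\<close> cover almost all of it again; comparison of the
  increments of \<open>F\<close> shows that the second family is shorter by the factor \<open>a / b\<close>.
\<close>

lemma monotone_derivative_gap_negligible:
  fixes F :: "real \<Rightarrow> real"
  assumes mono: "mono_on {p..q} F" and "p \<le> q" and ab: "0 < a" "a < b"
  shows "negligible {x. p < x \<and> x < q \<and>
           (\<forall>d>0. \<exists>t. 0 < t \<and> t < d \<and> x + t \<le> q \<and> F (x + t) - F x \<le> a * t) \<and>
           (\<forall>d>0. \<exists>t. 0 < t \<and> t < d \<and> x + t \<le> q \<and> b * t \<le> F (x + t) - F x)}" (is "negligible ?S")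
proof -
  let ?\<mu> = "measure lebesgue"
  let ?e = "\<lambda>s t. F t - F s"
  have sup: "superadditive_on s t ?e" if "p \<le> s" "t \<le> q" for s t
    using mono that unfolding superadditive_on_def mono_on_def by auto
  \<comment> \<open>One step shrinks the measure of a set containing \<open>?S\<close> by the factor \<open>a / b\<close>, up to \<open>\<epsilon>\<close>.\<close>
  have shrink: "\<exists>T'. ?S \<subseteq> T' \<and> T' \<in> lmeasurable \<and> ?\<mu> T' \<le> (a / b) * (?\<mu> T + \<epsilon>)"
    if T: "?S \<subseteq> T" "T \<in> lmeasurable" and "\<epsilon> > 0" for T \<epsilon>
  proof -
    obtain U where U0: "open U" "T \<subseteq> U" "U - T \<in> lmeasurable" "emeasure lebesgue (U - T) < ennreal \<epsilon>"
      using sets_lebesgue_outer_open[of T \<epsilon>] T \<open>\<epsilon> > 0\<close> by (blast intro: fmeasurableD)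
    have U: "open U" "T \<subseteq> U" "U \<in> lmeasurable" "?\<mu> (U - T) < \<epsilon>"
      using U0 fmeasurable.Un[OF T(2) U0(3)] \<open>\<epsilon> > 0\<close>
      by (auto simp: Un_absorb1 emeasure_eq_measure2 ennreal_less_iff)
    have muU: "?\<mu> U \<le> ?\<mu> T + \<epsilon>"
      using measure_Un_le[of T lebesgue "U - T"] T U by (simp add: Un_absorb1 fmeasurableD)
    define K where "K = {(s, t). p \<le> s \<and> s < t \<and> t \<le> q \<and> {s..t} \<subseteq> U \<and> F t - F s \<le> a * (t - s)}"
    have K: "\<exists>s t. (s, t) \<in> K \<and> x \<in> {s..t} \<and> t - s < d" if x: "x \<in> ?S" and "0 < d" for x d
    proof -
      obtain r where r: "r > 0" "cball x r \<subseteq> U"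
        using U T x open_contains_cball by blast
      then obtain t where "0 < t" "t < min r d" "x + t \<le> q" "F (x + t) - F x \<le> a * t"
        using x \<open>0 < d\<close> by (auto dest!: spec[of _ "min r d"])
      moreover from this have "{x..x + t} \<subseteq> U" using r by (auto simp: subset_eq dist_real_def)
      ultimately show ?thesis using x by (intro exI[of _ x] exI[of _ "x + t"]) (auto simp: K_def)
    qed
    obtain C where C: "countable C" "C \<subseteq> K"
      "pairwise (\<lambda>i j. {fst i..snd i} \<inter> {fst j..snd j} = {}) C"
      "negligible (?S - (\<Union>(s, t)\<in>C. {s..t}))"
      by (rule vitali_covering_intervals[of K ?S]) (use K in \<open>auto simp: K_def\<close>)
    have "\<exists>T'. ?S \<inter> {s<..<t} \<subseteq> T' \<and> T' \<in> lmeasurable \<and> ?\<mu> T' \<le> (a / b) * ?\<mu> {s..t}"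
      if st: "(s, t) \<in> C" for s t
    proof -
      have K': "p \<le> s" "s < t" "t \<le> q" "F t - F s \<le> a * (t - s)" using st C by (auto simp: K_def)
      have "\<exists>s' t'. s \<le> s' \<and> s' < t' \<and> t' \<le> t \<and> x \<in> {s'..t'} \<and> t' - s' < d \<and> b * (t' - s') \<le> ?e s' t'"
        if x: "x \<in> ?S \<inter> {s<..<t}" and "0 < d" for x d
      proof -
        obtain r where "0 < r" "r < min d (t - x)" "x + r \<le> q" "b * r \<le> F (x + r) - F x"
          using x \<open>0 < d\<close> by (auto dest!: spec[of _ "min d (t - x)"])
        then show ?thesis using x by (intro exI[of _ x] exI[of _ "x + r"]) auto
      qed
      note near = this
      obtain T' where T': "?S \<inter> {s<..<t} \<subseteq> T'" "T' \<in> lmeasurable" "?\<mu> T' \<le> ?e s t / b"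
        by (rule superadditive_on_maximal[OF sup[of s t], of b "?S \<inter> {s<..<t}"])
           (use K' ab near in \<open>assumption | simp\<close>)+
      have "?e s t / b \<le> (a / b) * (t - s)"
        using divide_right_mono[OF K'(4), of b] ab by simp
      then show ?thesis using T' K' by (intro exI[of _ T']) auto
    qed
    from this[of "fst i" "snd i" for i]
    have "\<forall>i\<in>C. \<exists>T'. ?S \<inter> {fst i<..<snd i} \<subseteq> T' \<and> T' \<in> lmeasurable \<and> ?\<mu> T' \<le> (a / b) * ?\<mu> {fst i..snd i}"
      unfolding prod.collapse by (rule ballI)
    then obtain T' where T': "\<forall>i\<in>C. ?S \<inter> {fst i<..<snd i} \<subseteq> T' i \<and> T' i \<in> lmeasurable
        \<and> ?\<mu> (T' i) \<le> (a / b) * ?\<mu> {fst i..snd i}"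
      by (rule bchoice[THEN exE])
    have fin: "?\<mu> (\<Union>i\<in>G. T' i) \<le> (a / b) * ?\<mu> U" if G: "G \<subseteq> C" "finite G" for G
    proof -
      have "?\<mu> (\<Union>i\<in>G. T' i) \<le> (\<Sum>i\<in>G. ?\<mu> (T' i))"
        using G T' by (intro measure_UNION_le) (auto simp: fmeasurableD)
      also have "\<dots> \<le> (\<Sum>i\<in>G. (a / b) * ?\<mu> {fst i..snd i})"
        using G T' by (intro sum_mono) blast
      also have "\<dots> = (a / b) * (\<Sum>i\<in>G. ?\<mu> {fst i..snd i})"
        by (simp add: sum_distrib_left)
      also have "(\<Sum>i\<in>G. ?\<mu> {fst i..snd i}) = ?\<mu> (\<Union>i\<in>G. {fst i..snd i})"
        using G pairwise_subset[OF C(3) G(1)]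
        by (intro measure_UNION'[symmetric]) (auto simp: disjnt_def pairwise_def)
      also have "(a / b) * \<dots> \<le> (a / b) * ?\<mu> U"
        using G C(2) U ab
        by (intro mult_left_mono measure_mono_fmeasurable) (auto simp: K_def fmeasurableD, force)
      finally show ?thesis .
    qed
    have TU: "(\<Union>i\<in>C. T' i) \<in> lmeasurable" "?\<mu> (\<Union>i\<in>C. T' i) \<le> (a / b) * ?\<mu> U"
      using fmeasurable_UN_bound[OF C(1), of T' lebesgue] measure_UN_bound[OF C(1), of T' lebesgue] T' fin
      by blast+
    define N where "N = (?S - (\<Union>(s, t)\<in>C. {s..t})) \<union> (fst ` C \<union> snd ` C)"
    have N: "N \<in> null_sets lebesgue"
    proof -
      have "fst ` C \<union> snd ` C \<in> null_sets lborel"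
        using C(1) by (intro countable_imp_null_set_lborel) auto
      then have "negligible (fst ` C \<union> snd ` C)"
        by (simp add: negligible_iff_null_sets null_sets_completionI)
      then show ?thesis
        unfolding N_def negligible_iff_null_sets[symmetric] using C(4) by (rule negligible_Un[rotated])
    qed
    have "?S \<subseteq> (\<Union>i\<in>C. T' i) \<union> N"
    proof
      fix x assume x: "x \<in> ?S"
      show "x \<in> (\<Union>i\<in>C. T' i) \<union> N"
      proof (cases "x \<in> N")
        case False
        then obtain i where i: "i \<in> C" "x \<in> {fst i..snd i}" using x by (auto simp: N_def)
        then have "x \<noteq> fst i" "x \<noteq> snd i" using False by (auto simp: N_def)
        then have "x \<in> ?S \<inter> {fst i<..<snd i}" using i x by auto
        then show ?thesis using T' i by blast
      qed auto
    qed
    moreover have "?\<mu> ((\<Union>i\<in>C. T' i) \<union> N) = ?\<mu> (\<Union>i\<in>C. T' i)"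
      using N TU by (intro measure_Un_null_set) (auto simp: fmeasurableD)
    moreover have "(\<Union>i\<in>C. T' i) \<union> N \<in> lmeasurable"
      by (rule fmeasurable.Un[OF TU(1) fmeasurableI_null_sets[OF N]])
    moreover have "(a / b) * ?\<mu> U \<le> (a / b) * (?\<mu> T + \<epsilon>)"
      using muU ab by (intro mult_left_mono) auto
    ultimately show ?thesis
      using TU by (intro exI[of _ "(\<Union>i\<in>C. T' i) \<union> N"]) auto
  qed
  show ?thesis
  proof (rule negligible_if_outer_measure_shrinks[of ?S "cbox p q" "a / b"])
    show "?S \<subseteq> cbox p q" by auto
  qed (use shrink ab in auto)
qed

section \<open>Arc length of Lipschitz curves\<close>

lemma strict_partition_mono:
  fixes t :: "nat \<Rightarrow> real"
  assumes "\<forall>i<N. t i < t (Suc i)" "i \<le> j" "j \<le> N"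
  shows "t i \<le> t j"
  using assms(2,3)
proof (induction j rule: dec_induct)
  case (step n)
  then have "t n < t (Suc n)" using assms(1) by simp
  then show ?case using step by simp
qed simp

lemma sum_dist_le_curve_length:
  assumes "t 0 = a" "t N = b" "\<forall>i<N. t i < t (Suc i)"
  shows "(\<Sum>i<N. ennreal (dist (\<gamma> (t i)) (\<gamma> (t (Suc i))))) \<le> curve_length a b \<gamma>"
  unfolding curve_length_def
  by (rule SUP_upper2[of "(N, t)"]) (use assms in auto)

lemma partition_exists:
  fixes a b :: real
  assumes "a \<le> b"
  obtains N :: nat and t :: "nat \<Rightarrow> real" where "t 0 = a" "t N = b" "\<forall>i<N. t i < t (Suc i)"
proof (cases "a = b")
  case True
  then show ?thesis by (intro that[of "\<lambda>_. a" 0]) auto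
next
  case False
  then show ?thesis using assms by (intro that[of "\<lambda>i. if i = 0 then a else b" 1]) auto
qed

lemma dist_le_curve_length:
  assumes "a \<le> b"
  shows "ennreal (dist (\<gamma> a) (\<gamma> b)) \<le> curve_length a b \<gamma>"
proof (cases "a = b")
  case False
  then show ?thesis
    using sum_dist_le_curve_length[of "\<lambda>i. if i = 0 then a else b" a 1 b \<gamma>] assms by simp
qed simp

lemma sum_lessThan_add:
  fixes g :: "nat \<Rightarrow> 'a::comm_monoid_add"
  shows "(\<Sum>i<N + M. g i) = (\<Sum>i<N. g i) + (\<Sum>i<M. g (N + i))"
  by (induction M) (auto simp: add.assoc)

text \<open>
  Partitions of two adjacent intervals can be concatenated. Hence the increments of
  \<open>curve_length p t \<gamma>\<close>, as a function of \<open>t\<close>, dominate the distances between points of the curve.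
\<close>

lemma curve_length_superadditive:
  assumes "a \<le> b" "b \<le> c"
  shows "curve_length a b \<gamma> + curve_length b c \<gamma> \<le> curve_length a c \<gamma>"
proof -
  define P where "P = (\<lambda>a b. {(N :: nat, t :: nat \<Rightarrow> real). t 0 = a \<and> t N = b \<and> (\<forall>i<N. t i < t (Suc i))})"
  define S where "S = (\<lambda>Nt :: nat \<times> (nat \<Rightarrow> real).
    \<Sum>i<fst Nt. ennreal (dist (\<gamma> (snd Nt i)) (\<gamma> (snd Nt (Suc i)))))"
  have cl: "curve_length a b \<gamma> = (SUP p\<in>P a b. S p)" for a b
    unfolding curve_length_def P_def S_def by (simp add: case_prod_beta)
  have ne: "P a b \<noteq> {}" if ab: "a \<le> b" for a b
  proof -
    obtain N t where "t 0 = a" "t N = b" "\<forall>i<N. t i < t (Suc i)"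
      by (rule partition_exists[OF ab])
    then have "(N, t) \<in> P a b" by (simp add: P_def)
    then show ?thesis by blast
  qed
  have "S x + S y \<le> curve_length a c \<gamma>" if xy: "x \<in> P a b" "y \<in> P b c" for x y
  proof -
    obtain N t M u where x: "x = (N, t)" and y: "y = (M, u)" by (cases x, cases y)
    define w where "w = (\<lambda>i. if i \<le> N then t i else u (i - N))"
    have w1: "w i = t i" if "i \<le> N" for i using that by (simp add: w_def)
    have w2: "w (N + i) = u i" for i using xy by (cases "i = 0") (auto simp: w_def P_def x y)
    have w3: "w (Suc (N + i)) = u (Suc i)" for i using w2[of "Suc i"] by simp
    have "w i < w (Suc i)" if "i < N + M" for i
    proof (cases "i < N")
      case True
      then show ?thesis using xy by (simp add: w1 P_def x)
    next
      case False
      then obtain j where "i = N + j" using le_Suc_ex by (metis not_less)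
      then show ?thesis using xy that by (simp add: w2 w3 P_def y)
    qed
    then have "(\<Sum>i<N + M. ennreal (dist (\<gamma> (w i)) (\<gamma> (w (Suc i))))) \<le> curve_length a c \<gamma>"
      using xy w1[of 0] w2[of M] by (intro sum_dist_le_curve_length) (auto simp: P_def x y)
    also have "(\<Sum>i<N + M. ennreal (dist (\<gamma> (w i)) (\<gamma> (w (Suc i))))) = S x + S y"
      by (simp add: sum_lessThan_add S_def x y w1 w2 w3)
    finally show ?thesis .
  qed
  then have "(SUP x\<in>P a b. SUP y\<in>P b c. S x + S y) \<le> curve_length a c \<gamma>"
    by (intro SUP_least)
  also have "(SUP x\<in>P a b. SUP y\<in>P b c. S x + S y) = curve_length a b \<gamma> + curve_length b c \<gamma>"
    unfolding cl ennreal_SUP_add_right[OF ne[OF assms(2)], symmetric] ennreal_SUP_add_left[OF ne[OF assms(1)]] ..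
  finally show ?thesis .
qed

lemma curve_length_le_lipschitz:
  fixes \<gamma> :: "real \<Rightarrow> 'a::metric_space"
  assumes "L-lipschitz_on {a..b} \<gamma>"
  shows "curve_length a b \<gamma> \<le> ennreal (L * (b - a))"
  unfolding curve_length_def
proof (rule SUP_least, clarify)
  fix N :: nat and t :: "nat \<Rightarrow> real"
  assume b: "b = t N" and t: "\<forall>i<N. t i < t (Suc i)" and a: "a = t 0"
  have "dist (\<gamma> (t i)) (\<gamma> (t (Suc i))) \<le> L * (t (Suc i) - t i)" if i: "i < N" for i
  proof -
    have "t i < t (Suc i)" using t i by simp
    moreover have "t i \<in> {a..b}" "t (Suc i) \<in> {a..b}"
      using strict_partition_mono[OF t, of 0] strict_partition_mono[OF t, of _ N] i
      by (auto simp: a b)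
    ultimately show ?thesis
      using lipschitz_onD[OF assms, of "t i" "t (Suc i)"] by (simp add: dist_real_def)
  qed
  then have "(\<Sum>i<N. dist (\<gamma> (t i)) (\<gamma> (t (Suc i)))) \<le> (\<Sum>i<N. L * (t (Suc i) - t i))"
    by (intro sum_mono) auto
  also have "\<dots> = L * (t N - t 0)"
    by (simp add: sum_lessThan_telescope flip: sum_distrib_left)
  finally show "(\<Sum>i<N. ennreal (dist (\<gamma> (t i)) (\<gamma> (t (Suc i))))) \<le> ennreal (L * (t N - t 0))"
    by (simp add: sum_ennreal ennreal_leI)
qed

definition arc_length :: "real \<Rightarrow> (real \<Rightarrow> 'a::metric_space) \<Rightarrow> real \<Rightarrow> real" where
  "arc_length p \<gamma> t = enn2real (curve_length p t \<gamma>)"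

lemma curve_length_eq_arc_length:
  assumes "L-lipschitz_on {p..q} \<gamma>" "p \<le> t" "t \<le> q"
  shows "curve_length p t \<gamma> = ennreal (arc_length p \<gamma> t)"
proof -
  have "curve_length p t \<gamma> \<le> ennreal (L * (t - p))"
    by (rule curve_length_le_lipschitz[OF lipschitz_on_subset[OF assms(1)]]) (use assms in auto)
  then have "curve_length p t \<gamma> < top" by (rule le_less_trans) simp
  then show ?thesis by (simp add: arc_length_def)
qed

lemma dist_le_arc_length_diff:
  assumes "L-lipschitz_on {p..q} \<gamma>" "p \<le> s" "s \<le> t" "t \<le> q"
  shows "dist (\<gamma> s) (\<gamma> t) \<le> arc_length p \<gamma> t - arc_length p \<gamma> s"
proof -
  have "curve_length p s \<gamma> + ennreal (dist (\<gamma> s) (\<gamma> t)) \<le> curve_length p t \<gamma>"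
    using dist_le_curve_length[of s t \<gamma>] curve_length_superadditive[of p s t \<gamma>] assms
    by (meson add_left_mono order_trans)
  moreover have "0 \<le> arc_length p \<gamma> s" "0 \<le> arc_length p \<gamma> t" by (auto simp: arc_length_def)
  ultimately show ?thesis
    using curve_length_eq_arc_length[OF assms(1), of s] curve_length_eq_arc_length[OF assms(1), of t] assms
    by (simp flip: ennreal_plus)
qed

lemma arc_length_approx:
  assumes "L-lipschitz_on {p..q} \<gamma>" "p \<le> q" "\<kappa> > 0"
  obtains N t where "t 0 = p" "t N = q" "\<forall>i<N. t i < t (Suc i)"
    "arc_length p \<gamma> q - \<kappa> \<le> (\<Sum>i<N. dist (\<gamma> (t i)) (\<gamma> (t (Suc i))))"
proof (cases "arc_length p \<gamma> q - \<kappa> < 0")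
  case True
  obtain N t where t: "t 0 = p" "t N = q" "\<forall>i<N. t i < t (Suc i)"
    by (rule partition_exists[OF assms(2)])
  have "0 \<le> (\<Sum>i<N. dist (\<gamma> (t i)) (\<gamma> (t (Suc i))))" by (intro sum_nonneg) auto
  then show ?thesis using True by (intro that[OF t]) linarith
next
  case False
  then have "ennreal (arc_length p \<gamma> q - \<kappa>) < curve_length p q \<gamma>"
    using curve_length_eq_arc_length[OF assms(1), of q] assms by (simp add: ennreal_less_iff)
  then obtain N t where t: "t 0 = p" "t N = q" "\<forall>i<N. t i < t (Suc i)"
    and le: "ennreal (arc_length p \<gamma> q - \<kappa>) < (\<Sum>i<N. ennreal (dist (\<gamma> (t i)) (\<gamma> (t (Suc i)))))"
    unfolding curve_length_def less_SUP_iff by auto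
  have "ennreal (arc_length p \<gamma> q - \<kappa>) < ennreal (\<Sum>i<N. dist (\<gamma> (t i)) (\<gamma> (t (Suc i))))"
    using le by (simp add: sum_ennreal)
  then have "arc_length p \<gamma> q - \<kappa> < (\<Sum>i<N. dist (\<gamma> (t i)) (\<gamma> (t (Suc i))))"
    using False by (simp add: ennreal_less_iff)
  then show ?thesis by (intro that[OF t]) linarith
qed

text \<open>
  The excess \<open>e s t\<close> of arc length over distance is superadditive by the triangle inequality. Choose
  a partition for which the excesses of its intervals add up to at most \<open>\<eta> * \<kappa>\<close>. Inside an interval
  of the partition, the points where the excess is at least \<open>\<eta> * t\<close> at arbitrarily small scales \<open>t\<close>
  form a set of measure at most \<open>1 / \<eta>\<close> times the excess of that interval, so altogether they have
  measure at most \<open>\<kappa>\<close>.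
\<close>

lemma arc_length_excess_negligible:
  fixes \<gamma> :: "real \<Rightarrow> 'a::metric_space"
  assumes lip: "L-lipschitz_on {p..q} \<gamma>" and "p \<le> q" and "\<eta> > 0"
  shows "negligible {x. p < x \<and> x < q \<and> (\<forall>d>0. \<exists>t. 0 < t \<and> t < d \<and> x + t \<le> q \<and>
           \<eta> * t \<le> arc_length p \<gamma> (x + t) - arc_length p \<gamma> x - dist (\<gamma> x) (\<gamma> (x + t)))}"
    (is "negligible ?S")
  unfolding negligible_outer_le
proof (intro allI impI)
  fix \<kappa> :: real assume "\<kappa> > 0"
  let ?e = "\<lambda>s t. arc_length p \<gamma> t - arc_length p \<gamma> s - dist (\<gamma> s) (\<gamma> t)"
  have e: "superadditive_on p q ?e"
    unfolding superadditive_on_def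
  proof (intro conjI allI impI)
    fix s t assume "p \<le> s \<and> s \<le> t \<and> t \<le> q"
    then show "0 \<le> ?e s t" using dist_le_arc_length_diff[OF lip, of s t] by simp
  next
    fix s t u
    show "?e s t + ?e t u \<le> ?e s u" using dist_triangle[of "\<gamma> s" "\<gamma> u" "\<gamma> t"] by simp
  qed
  obtain N t where t: "t 0 = p" "t N = q" "\<forall>i<N. t i < t (Suc i)"
    and approx: "arc_length p \<gamma> q - \<eta> * \<kappa> \<le> (\<Sum>i<N. dist (\<gamma> (t i)) (\<gamma> (t (Suc i))))"
    using arc_length_approx[OF lip \<open>p \<le> q\<close> mult_pos_pos[OF \<open>\<eta> > 0\<close> \<open>\<kappa> > 0\<close>]] by metis
  have "\<exists>T. ?S \<inter> {t i<..<t (Suc i)} \<subseteq> T \<and> T \<in> lmeasurable \<and>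
      measure lebesgue T \<le> ?e (t i) (t (Suc i)) / \<eta>" if i: "i < N" for i
  proof -
    have ti: "p \<le> t i" "t i < t (Suc i)" "t (Suc i) \<le> q"
      using strict_partition_mono[OF t(3), of 0 i] strict_partition_mono[OF t(3), of "Suc i" N] i t by auto
    have near: "\<exists>s u. t i \<le> s \<and> s < u \<and> u \<le> t (Suc i) \<and> x \<in> {s..u} \<and> u - s < d \<and> \<eta> * (u - s) \<le> ?e s u"
      if x: "x \<in> ?S \<inter> {t i<..<t (Suc i)}" and "0 < d" for x d
    proof -
      obtain r where "0 < r" "r < min d (t (Suc i) - x)" "\<eta> * r \<le> ?e x (x + r)"
        using x \<open>0 < d\<close> by (auto dest!: spec[of _ "min d (t (Suc i) - x)"])
      then show ?thesis using x by (intro exI[of _ x] exI[of _ "x + r"]) auto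
    qed
    obtain T where "?S \<inter> {t i<..<t (Suc i)} \<subseteq> T" "T \<in> lmeasurable"
      "measure lebesgue T \<le> ?e (t i) (t (Suc i)) / \<eta>"
      by (rule superadditive_on_maximal[OF superadditive_on_subinterval[OF e ti(1,3)] _ \<open>\<eta> > 0\<close>,
            of "?S \<inter> {t i<..<t (Suc i)}"])
         (use near ti in \<open>assumption | simp\<close>)+
    then show ?thesis by blast
  qed
  then have "\<forall>i\<in>{..<N}. \<exists>T. ?S \<inter> {t i<..<t (Suc i)} \<subseteq> T \<and> T \<in> lmeasurable \<and>
      measure lebesgue T \<le> ?e (t i) (t (Suc i)) / \<eta>" by simp
  then obtain T where T: "\<forall>i\<in>{..<N}. ?S \<inter> {t i<..<t (Suc i)} \<subseteq> T i \<and> T i \<in> lmeasurable \<and>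
      measure lebesgue (T i) \<le> ?e (t i) (t (Suc i)) / \<eta>" by (rule bchoice[THEN exE])
  define N' where "N' = t ` {..N}"
  have N': "N' \<in> null_sets lebesgue"
    unfolding N'_def using negligible_finite[of "t ` {..N}"] by (simp add: negligible_iff_null_sets)
  have TU: "(\<Union>i<N. T i) \<in> lmeasurable" using T by (intro fmeasurable.finite_UN) auto
  have "measure lebesgue (\<Union>i<N. T i) \<le> (\<Sum>i<N. measure lebesgue (T i))"
    using T by (intro measure_UNION_le) (auto simp: fmeasurableD)
  also have "\<dots> \<le> (\<Sum>i<N. ?e (t i) (t (Suc i)) / \<eta>)"
    using T by (intro sum_mono) blast
  also have "\<dots> = (\<Sum>i<N. ?e (t i) (t (Suc i))) / \<eta>" by (simp add: sum_divide_distrib)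
  also have "(\<Sum>i<N. ?e (t i) (t (Suc i))) = arc_length p \<gamma> q - arc_length p \<gamma> p
      - (\<Sum>i<N. dist (\<gamma> (t i)) (\<gamma> (t (Suc i))))"
    using sum_lessThan_telescope[of "\<lambda>i. arc_length p \<gamma> (t i)" N] t by (simp add: sum_subtractf)
  also have "\<dots> \<le> \<eta> * \<kappa>"
    using approx by (simp add: arc_length_def)
      (smt (verit) enn2real_nonneg)
  finally have "measure lebesgue (\<Union>i<N. T i) \<le> \<kappa>"
    using \<open>\<eta> > 0\<close> by (simp add: divide_right_mono)
  moreover have "measure lebesgue ((\<Union>i<N. T i) \<union> N') = measure lebesgue (\<Union>i<N. T i)"
    by (rule measure_Un_null_set[OF fmeasurableD[OF TU] N'])
  moreover have "(\<Union>i<N. T i) \<union> N' \<in> lmeasurable"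
    by (rule fmeasurable.Un[OF TU fmeasurableI_null_sets[OF N']])
  moreover have "?S \<subseteq> (\<Union>i<N. T i) \<union> N'"
  proof
    fix x assume x: "x \<in> ?S"
    show "x \<in> (\<Union>i<N. T i) \<union> N'"
    proof (cases "x \<in> N'")
      case False
      \<comment> \<open>The interval of the partition that contains \<open>x\<close> ends at the first partition point beyond
          \<open>x\<close>.\<close>
      define j where "j = (LEAST j. x < t j)"
      have xq: "x < t N" "\<not> x < t 0" using x t by auto
      then have j: "x < t j" "j \<le> N" unfolding j_def by (auto intro: LeastI Least_le)
      then obtain i where i: "j = Suc i" using xq by (cases j) auto
      then have "\<not> x < t i" unfolding j_def by (metis lessI not_less_Least)
      moreover have "x \<noteq> t i" using False j i by (auto simp: N'_def)
      ultimately have "x \<in> ?S \<inter> {t i<..<t (Suc i)}" using x j i by auto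
      moreover have "i \<in> {..<N}" using j i by simp
      ultimately show ?thesis using T by blast
    qed simp
  qed
  ultimately show "\<exists>T. ?S \<subseteq> T \<and> T \<in> lmeasurable \<and> measure lebesgue T \<le> \<kappa>"
    by (intro exI[of _ "(\<Union>i<N. T i) \<union> N'"]) simp
qed

lemma eventually_small_if_not:
  fixes x q :: real
  assumes "\<not> (\<forall>d>0. \<exists>t. 0 < t \<and> t < d \<and> x + t \<le> q \<and> P t)"
  shows "\<exists>d>0. \<forall>t. 0 < t \<longrightarrow> t < d \<longrightarrow> x + t \<le> q \<longrightarrow> \<not> P t"
  using assms by blast

text \<open>
  Distance and arc length differ by \<open>o(t)\<close> almost everywhere, so the gap passes to the monotone
  function given by arc length.
\<close>

lemma metric_derivative_gap_negligible:
  fixes \<gamma> :: "real \<Rightarrow> 'a::metric_space"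
  assumes lip: "L-lipschitz_on {p..q} \<gamma>" and "p \<le> q" and ab: "0 < a" "a < b"
  shows "negligible {x. p < x \<and> x < q \<and>
           (\<forall>d>0. \<exists>t. 0 < t \<and> t < d \<and> x + t \<le> q \<and> dist (\<gamma> x) (\<gamma> (x + t)) \<le> a * t) \<and>
           (\<forall>d>0. \<exists>t. 0 < t \<and> t < d \<and> x + t \<le> q \<and> b * t \<le> dist (\<gamma> x) (\<gamma> (x + t)))}"
proof (rule negligible_subset)
  \<comment> \<open>Half of the gap absorbs the excess of arc length over distance, the other half remains.\<close>
  define \<eta> where "\<eta> = (b - a) / 2"
  have \<eta>: "\<eta> > 0" "a + \<eta> < b" "0 < a + \<eta>" using ab by (auto simp: \<eta>_def field_simps)
  let ?l = "arc_length p \<gamma>"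
  have "mono_on {p..q} ?l"
  proof (rule mono_onI)
    fix s t assume "s \<in> {p..q}" "t \<in> {p..q}" "s \<le> t"
    then show "?l s \<le> ?l t"
      using order_trans[OF zero_le_dist dist_le_arc_length_diff[OF lip, of s t]] by auto
  qed
  note gap = monotone_derivative_gap_negligible[OF this \<open>p \<le> q\<close> \<eta>(3,2)]
  show "negligible ({x. p < x \<and> x < q \<and>
           (\<forall>d>0. \<exists>t. 0 < t \<and> t < d \<and> x + t \<le> q \<and> ?l (x + t) - ?l x \<le> (a + \<eta>) * t) \<and>
           (\<forall>d>0. \<exists>t. 0 < t \<and> t < d \<and> x + t \<le> q \<and> b * t \<le> ?l (x + t) - ?l x)} \<union>
         {x. p < x \<and> x < q \<and> (\<forall>d>0. \<exists>t. 0 < t \<and> t < d \<and> x + t \<le> q \<and>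
           \<eta> * t \<le> ?l (x + t) - ?l x - dist (\<gamma> x) (\<gamma> (x + t)))})" (is "negligible (?G \<union> ?E)")
    by (rule negligible_Un[OF gap arc_length_excess_negligible[OF lip \<open>p \<le> q\<close> \<eta>(1)]])
  show "{x. p < x \<and> x < q \<and>
           (\<forall>d>0. \<exists>t. 0 < t \<and> t < d \<and> x + t \<le> q \<and> dist (\<gamma> x) (\<gamma> (x + t)) \<le> a * t) \<and>
           (\<forall>d>0. \<exists>t. 0 < t \<and> t < d \<and> x + t \<le> q \<and> b * t \<le> dist (\<gamma> x) (\<gamma> (x + t)))} \<subseteq> ?G \<union> ?E"
  proof (rule subsetI, rule ccontr)
    fix x
    assume x: "x \<in> {x. p < x \<and> x < q \<and>
           (\<forall>d>0. \<exists>t. 0 < t \<and> t < d \<and> x + t \<le> q \<and> dist (\<gamma> x) (\<gamma> (x + t)) \<le> a * t) \<and>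
           (\<forall>d>0. \<exists>t. 0 < t \<and> t < d \<and> x + t \<le> q \<and> b * t \<le> dist (\<gamma> x) (\<gamma> (x + t)))}"
      and n: "x \<notin> ?G \<union> ?E"
    have "\<exists>d0>0. \<forall>t. 0 < t \<longrightarrow> t < d0 \<longrightarrow> x + t \<le> q \<longrightarrow>
        ?l (x + t) - ?l x - dist (\<gamma> x) (\<gamma> (x + t)) < \<eta> * t"
    proof -
      have "\<not> (\<forall>d>0. \<exists>t. 0 < t \<and> t < d \<and> x + t \<le> q \<and> \<eta> * t \<le> ?l (x + t) - ?l x - dist (\<gamma> x) (\<gamma> (x + t)))"
        using n x by simp
      from eventually_small_if_not[OF this] show ?thesis unfolding not_le .
    qed
    then obtain d0 where d0: "d0 > 0" "\<And>t. 0 < t \<Longrightarrow> t < d0 \<Longrightarrow> x + t \<le> q \<Longrightarrow>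
        ?l (x + t) - ?l x - dist (\<gamma> x) (\<gamma> (x + t)) < \<eta> * t" by blast
    have "\<exists>t. 0 < t \<and> t < d \<and> x + t \<le> q \<and> ?l (x + t) - ?l x \<le> (a + \<eta>) * t" if "d > 0" for d
    proof -
      obtain t where "0 < t" "t < min d d0" "x + t \<le> q" "dist (\<gamma> x) (\<gamma> (x + t)) \<le> a * t"
        using x d0(1) \<open>d > 0\<close> by (auto dest!: spec[of _ "min d d0"])
      then show ?thesis using d0(2)[of t] by (intro exI[of _ t]) (simp add: distrib_right)
    qed
    moreover have "\<exists>t. 0 < t \<and> t < d \<and> x + t \<le> q \<and> b * t \<le> ?l (x + t) - ?l x" if "d > 0" for d
    proof -
      obtain t where "0 < t" "t < d" "x + t \<le> q" "b * t \<le> dist (\<gamma> x) (\<gamma> (x + t))"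
        using x \<open>d > 0\<close> by auto
      then show ?thesis using dist_le_arc_length_diff[OF lip, of x "x + t"] x
        by (intro exI[of _ t]) auto
    qed
    ultimately have "x \<in> ?G" using x by auto
    then show False using n by auto
  qed
qed

text \<open>
  Both distances agree up to \<open>o(t)\<close> with the increment of the common arc length.
\<close>

lemma metric_derivatives_agree_negligible:
  fixes \<gamma>1 :: "real \<Rightarrow> 'a::metric_space" and \<gamma>2 :: "real \<Rightarrow> 'b::metric_space"
  assumes lip: "L-lipschitz_on {p..q} \<gamma>1" "M-lipschitz_on {p..q} \<gamma>2" and "p \<le> q" and "\<eta> > 0"
    and eq: "\<And>t. p \<le> t \<Longrightarrow> t \<le> q \<Longrightarrow> curve_length p t \<gamma>1 = curve_length p t \<gamma>2"
  shows "negligible {x. p < x \<and> x < q \<and> (\<forall>d>0. \<exists>t. 0 < t \<and> t < d \<and> x + t \<le> q \<and>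
           \<eta> * t \<le> \<bar>dist (\<gamma>1 x) (\<gamma>1 (x + t)) - dist (\<gamma>2 x) (\<gamma>2 (x + t))\<bar>)}" (is "negligible ?S")
proof (rule negligible_subset)
  let ?E1 = "{x. p < x \<and> x < q \<and> (\<forall>d>0. \<exists>t. 0 < t \<and> t < d \<and> x + t \<le> q \<and>
     \<eta> * t \<le> arc_length p \<gamma>1 (x + t) - arc_length p \<gamma>1 x - dist (\<gamma>1 x) (\<gamma>1 (x + t)))}"
  let ?E2 = "{x. p < x \<and> x < q \<and> (\<forall>d>0. \<exists>t. 0 < t \<and> t < d \<and> x + t \<le> q \<and>
     \<eta> * t \<le> arc_length p \<gamma>2 (x + t) - arc_length p \<gamma>2 x - dist (\<gamma>2 x) (\<gamma>2 (x + t)))}"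
  show "negligible (?E1 \<union> ?E2)"
    by (rule negligible_Un; rule arc_length_excess_negligible; fact)
  have al: "arc_length p \<gamma>1 t = arc_length p \<gamma>2 t" if "p \<le> t" "t \<le> q" for t
    using eq[OF that] by (simp add: arc_length_def)
  show "?S \<subseteq> ?E1 \<union> ?E2"
  proof (rule subsetI, rule ccontr)
    fix x assume x: "x \<in> ?S" and n: "x \<notin> ?E1 \<union> ?E2"
    have "\<exists>d0>0. \<forall>t. 0 < t \<longrightarrow> t < d0 \<longrightarrow> x + t \<le> q \<longrightarrow>
        arc_length p \<gamma>1 (x + t) - arc_length p \<gamma>1 x - dist (\<gamma>1 x) (\<gamma>1 (x + t)) < \<eta> * t"
    proof -
      have "\<not> (\<forall>d>0. \<exists>t. 0 < t \<and> t < d \<and> x + t \<le> q \<and> \<eta> * t \<le> arc_length p \<gamma>1 (x + t) - arc_length p \<gamma>1 x - dist (\<gamma>1 x) (\<gamma>1 (x + t)))"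
        using n x by simp
      from eventually_small_if_not[OF this] show ?thesis unfolding not_le .
    qed
    then obtain d1 where d1: "d1 > 0" "\<And>t. 0 < t \<Longrightarrow> t < d1 \<Longrightarrow> x + t \<le> q \<Longrightarrow>
        arc_length p \<gamma>1 (x + t) - arc_length p \<gamma>1 x - dist (\<gamma>1 x) (\<gamma>1 (x + t)) < \<eta> * t" by blast
    have "\<exists>d0>0. \<forall>t. 0 < t \<longrightarrow> t < d0 \<longrightarrow> x + t \<le> q \<longrightarrow>
        arc_length p \<gamma>2 (x + t) - arc_length p \<gamma>2 x - dist (\<gamma>2 x) (\<gamma>2 (x + t)) < \<eta> * t"
    proof -
      have "\<not> (\<forall>d>0. \<exists>t. 0 < t \<and> t < d \<and> x + t \<le> q \<and> \<eta> * t \<le> arc_length p \<gamma>2 (x + t) - arc_length p \<gamma>2 x - dist (\<gamma>2 x) (\<gamma>2 (x + t)))"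
        using n x by simp
      from eventually_small_if_not[OF this] show ?thesis unfolding not_le .
    qed
    then obtain d2 where d2: "d2 > 0" "\<And>t. 0 < t \<Longrightarrow> t < d2 \<Longrightarrow> x + t \<le> q \<Longrightarrow>
        arc_length p \<gamma>2 (x + t) - arc_length p \<gamma>2 x - dist (\<gamma>2 x) (\<gamma>2 (x + t)) < \<eta> * t" by blast
    obtain t where t: "0 < t" "t < min d1 d2" "x + t \<le> q"
        "\<eta> * t \<le> \<bar>dist (\<gamma>1 x) (\<gamma>1 (x + t)) - dist (\<gamma>2 x) (\<gamma>2 (x + t))\<bar>"
      using x d1(1) d2(1) by (auto dest!: spec[of _ "min d1 d2"])
    have "p \<le> x" using x by simp
    then show False
      using t d1(2)[of t] d2(2)[of t] al[of x] al[of "x + t"] dist_le_arc_length_diff[OF lip(1), of x "x + t"]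
        dist_le_arc_length_diff[OF lip(2), of x "x + t"] by (simp add: abs_le_iff)
  qed
qed

section \<open>Metric derivatives in a direction\<close>

text \<open>
  All translates of \<open>N\<close> by \<open>- s *\<^sub>R v\<close> with \<open>0 \<le> s \<le> 1\<close> have the same measure. Averaging over \<open>s\<close>
  and exchanging the integrals gives the measures of the line sections.
\<close>

lemma null_sets_if_lines_negligible:
  fixes N :: "'a::euclidean_space set" and v :: 'a
  assumes N: "N \<in> sets borel" and lines: "\<And>x. negligible {s :: real. x + s *\<^sub>R v \<in> N}"
  shows "N \<in> null_sets lborel"
proof -
  define F where "F = (\<lambda>(x :: 'a) (s :: real). indicator {0..1} s * indicator N (x + s *\<^sub>R v) :: ennreal)"
  have F: "case_prod F \<in> borel_measurable (lborel \<Otimes>\<^sub>M lborel)"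
    unfolding F_def using N by measurable
  have "(\<integral>\<^sup>+x. F x s \<partial>lborel) = emeasure lborel N * indicator {0..1} s" for s
  proof -
    have "(\<integral>\<^sup>+x. F x s \<partial>lborel) = (\<integral>\<^sup>+x. indicator N (s *\<^sub>R v + x) \<partial>lborel) * indicator {0..1} s"
      unfolding F_def using N by (subst nn_integral_cmult) (auto simp: add.commute mult.commute)
    also have "(\<integral>\<^sup>+x. indicator N (s *\<^sub>R v + x) \<partial>lborel)
        = (\<integral>\<^sup>+x. indicator N x \<partial>distr lborel borel ((+) (s *\<^sub>R v)))"
      using N by (subst nn_integral_distr) auto
    also have "\<dots> = emeasure lborel N" unfolding lborel_distr_plus using N by simp
    finally show ?thesis .
  qed
  then have "(\<integral>\<^sup>+s. \<integral>\<^sup>+x. F x s \<partial>lborel \<partial>lborel) = emeasure lborel N"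
    by (simp add: nn_integral_cmult)
  moreover have "(\<integral>\<^sup>+s. \<integral>\<^sup>+x. F x s \<partial>lborel \<partial>lborel) = (\<integral>\<^sup>+x. \<integral>\<^sup>+s. F x s \<partial>lborel \<partial>lborel)"
    by (rule lborel_pair.Fubini'[OF F])
  moreover have "(\<integral>\<^sup>+s. F x s \<partial>lborel) = 0" for x
  proof -
    have "{s. x + s *\<^sub>R v \<in> N} \<in> sets borel" using N by measurable
    then have "{s. x + s *\<^sub>R v \<in> N} \<in> null_sets lborel"
      using lines[of x] by (auto simp: negligible_iff_null_sets null_sets_completion_iff)
    then have "AE s in lborel. s \<notin> {s. x + s *\<^sub>R v \<in> N}" by (rule AE_not_in)
    then have "AE s in lborel. F x s = 0" by eventually_elim (auto simp: F_def)
    then show ?thesis using nn_integral_cong_AE[of "F x" "\<lambda>_. 0" lborel] by simp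
  qed
  ultimately have "emeasure lborel N = 0" by simp
  then show ?thesis using N by auto
qed

text \<open>
  The points from which \<open>\<phi>\<close> grows at a rate above \<open>c\<close> in the direction \<open>v\<close>, at arbitrarily small
  scales. For \<open>\<phi>\<close> a distance this says that the upper metric derivative is large, for \<open>\<phi>\<close> the
  negative of a distance that the lower one is small.
\<close>

definition steep :: "'a::euclidean_space set \<Rightarrow> ('a \<Rightarrow> 'a \<Rightarrow> real) \<Rightarrow> 'a \<Rightarrow> real \<Rightarrow> 'a set" where
  "steep B \<phi> v c = {x \<in> B. \<forall>d>0. \<exists>t. 0 < t \<and> t < d \<and> x + t *\<^sub>R v \<in> B \<and> c * t < \<phi> x (x + t *\<^sub>R v)}"

text \<open>
  The strict inequality makes the condition at a single step length \<open>t\<close> open, so the set is a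
  countable intersection of open sets.
\<close>

lemma steep_borel:
  assumes "open B" and cont: "continuous_on (B \<times> B) (\<lambda>(x, z). \<phi> x z)"
  shows "steep B \<phi> v c \<in> sets borel"
proof -
  define U where "U = (\<lambda>t. {x \<in> B \<inter> (\<lambda>x. x + t *\<^sub>R v) -` B. c * t < \<phi> x (x + t *\<^sub>R v)})"
  have "open (U t)" for t
  proof -
    have "open ((\<lambda>x. x + t *\<^sub>R v) -` B)"
      using \<open>open B\<close> by (intro open_vimage continuous_intros)
    then have o: "open (B \<inter> (\<lambda>x. x + t *\<^sub>R v) -` B)" using \<open>open B\<close> by auto
    have "continuous_on (B \<inter> (\<lambda>x. x + t *\<^sub>R v) -` B) (\<lambda>x. case (x, x + t *\<^sub>R v) of (x, z) \<Rightarrow> \<phi> x z)"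
      by (rule continuous_on_compose2[OF cont]) (auto intro!: continuous_intros)
    then have "continuous_on (B \<inter> (\<lambda>x. x + t *\<^sub>R v) -` B) (\<lambda>x. \<phi> x (x + t *\<^sub>R v))" by simp
    then have "open ((B \<inter> (\<lambda>x. x + t *\<^sub>R v) -` B) \<inter> (\<lambda>x. \<phi> x (x + t *\<^sub>R v)) -` {c * t<..})"
      using o by (rule continuous_open_preimage) auto
    moreover have "(B \<inter> (\<lambda>x. x + t *\<^sub>R v) -` B) \<inter> (\<lambda>x. \<phi> x (x + t *\<^sub>R v)) -` {c * t<..} = U t"
      by (auto simp: U_def)
    ultimately show ?thesis by simp
  qed
  then have "(\<Union>t\<in>{0<..<1 / real (Suc k)}. U t) \<in> sets borel" for k
    by (intro borel_open open_UN) auto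
  then have "(\<Inter>k::nat. \<Union>t\<in>{0<..<1 / real (Suc k)}. U t) \<in> sets borel"
    by (intro sets.countable_INT) auto
  moreover have "steep B \<phi> v c = (\<Inter>k::nat. \<Union>t\<in>{0<..<1 / real (Suc k)}. U t)"
  proof (intro equalityI subsetI)
    fix x assume x: "x \<in> steep B \<phi> v c"
    have "x \<in> (\<Union>t\<in>{0<..<1 / real (Suc k)}. U t)" for k
    proof -
      have "0 < 1 / real (Suc k)" by simp
      then obtain t where "0 < t" "t < 1 / real (Suc k)" "x + t *\<^sub>R v \<in> B" "c * t < \<phi> x (x + t *\<^sub>R v)"
        using x unfolding steep_def by blast
      then show ?thesis using x by (intro UN_I[of t]) (auto simp: U_def steep_def)
    qed
    then show "x \<in> (\<Inter>k::nat. \<Union>t\<in>{0<..<1 / real (Suc k)}. U t)" by blast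
  next
    fix x assume x: "x \<in> (\<Inter>k::nat. \<Union>t\<in>{0<..<1 / real (Suc k)}. U t)"
    have "\<exists>t. 0 < t \<and> t < d \<and> x + t *\<^sub>R v \<in> B \<and> c * t < \<phi> x (x + t *\<^sub>R v)" if d: "d > 0" for d
    proof -
      obtain k where k: "1 / real (Suc k) < d" by (rule nat_approx_posE[OF d])
      have "x \<in> (\<Union>t\<in>{0<..<1 / real (Suc k)}. U t)" using x by blast
      then obtain t where "0 < t" "t < 1 / real (Suc k)" "x \<in> U t" by auto
      then show ?thesis using k by (intro exI[of _ t]) (auto simp: U_def)
    qed
    moreover have "x \<in> B" using x by (auto simp: U_def)
    ultimately show "x \<in> steep B \<phi> v c" by (auto simp: steep_def)
  qed
  ultimately show ?thesis by simp
qed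

text \<open>
  Reduces sections by lines, which meet an open set in an open set of parameters, to curves on
  compact intervals.
\<close>

lemma negligible_if_negligible_on_intervals:
  fixes N J :: "real set"
  assumes "open J" "N \<subseteq> J"
    and "\<And>p q. p < q \<Longrightarrow> {p..q} \<subseteq> J \<Longrightarrow> negligible (N \<inter> {p<..<q})"
  shows "negligible N"
  unfolding locally_negligible_alt[of N]
proof
  fix s assume s: "s \<in> N"
  then obtain e where e: "e > 0" "cball s e \<subseteq> J" using assms(1,2) open_contains_cball by blast
  then have "negligible (N \<inter> {s - e<..<s + e})"
    by (intro assms(3)) (auto simp: cball_eq_atLeastAtMost)
  moreover have "openin (top_of_set N) (N \<inter> {s - e<..<s + e})" by auto
  ultimately show "\<exists>U. openin (top_of_set N) U \<and> s \<in> U \<and> negligible U"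
    using s e(1) by (intro exI[of _ "N \<inter> {s - e<..<s + e}"]) auto
qed

lemma lipschitz_on_line:
  assumes "L-lipschitz_on B f" "\<And>s. s \<in> S \<Longrightarrow> x + s *\<^sub>R v \<in> B"
  shows "(L * norm v)-lipschitz_on S (\<lambda>s. f (x + s *\<^sub>R v))"
proof (rule lipschitz_onI)
  fix s t assume "s \<in> S" "t \<in> S"
  then have "dist (f (x + s *\<^sub>R v)) (f (x + t *\<^sub>R v)) \<le> L * dist (x + s *\<^sub>R v) (x + t *\<^sub>R v)"
    using assms by (intro lipschitz_onD) auto
  also have "dist (x + s *\<^sub>R v) (x + t *\<^sub>R v) = norm v * dist s t"
    by (simp add: dist_norm dist_real_def flip: scaleR_left_diff_distrib)
  finally show "dist (f (x + s *\<^sub>R v)) (f (x + t *\<^sub>R v)) \<le> L * norm v * dist s t" by (simp add: mult.assoc)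
next
  show "0 \<le> L * norm v" using lipschitz_on_nonneg[OF assms(1)] by simp
qed

lemma continuous_on_dist_lipschitz:
  assumes "L-lipschitz_on B f"
  shows "continuous_on (B \<times> B) (\<lambda>(x, z). dist (f x) (f z))"
proof -
  have "continuous_on B f" by (rule lipschitz_on_continuous_on[OF assms])
  then show ?thesis
    unfolding case_prod_beta
    by (intro continuous_on_dist; (rule continuous_on_compose2[of B f]; (auto intro!: continuous_intros)))
qed

lemma negligible_line_section:
  fixes x v :: "'v::real_normed_vector"
  assumes "open B" and NB: "N \<subseteq> B"
    and "\<And>p q. p < q \<Longrightarrow> (\<And>s. s \<in> {p..q} \<Longrightarrow> x + s *\<^sub>R v \<in> B) \<Longrightarrow>
        negligible {s. x + s *\<^sub>R v \<in> N \<and> p < s \<and> s < q}"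
  shows "negligible {s. x + s *\<^sub>R v \<in> N}"
proof (rule negligible_if_negligible_on_intervals[of "(\<lambda>s. x + s *\<^sub>R v) -` B"])
  show "open ((\<lambda>s. x + s *\<^sub>R v) -` B)"
    by (rule open_vimage[OF \<open>open B\<close>]) (auto intro!: continuous_intros)
  show "{s. x + s *\<^sub>R v \<in> N} \<subseteq> (\<lambda>s. x + s *\<^sub>R v) -` B" using NB by auto
  fix p q :: real assume "p < q" "{p..q} \<subseteq> (\<lambda>s. x + s *\<^sub>R v) -` B"
  then have "negligible {s. x + s *\<^sub>R v \<in> N \<and> p < s \<and> s < q}" by (intro assms(3)) auto
  moreover have "{s. x + s *\<^sub>R v \<in> N} \<inter> {p<..<q} = {s. x + s *\<^sub>R v \<in> N \<and> p < s \<and> s < q}" by auto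
  ultimately show "negligible ({s. x + s *\<^sub>R v \<in> N} \<inter> {p<..<q})" by simp
qed

lemma steepD_line:
  assumes "x + s *\<^sub>R v \<in> steep B \<phi> v c" "s < q" "d > 0"
  obtains t where "0 < t" "t < d" "s + t \<le> q" "c * t < \<phi> (x + s *\<^sub>R v) (x + (s + t) *\<^sub>R v)"
proof -
  have "min d (q - s) > 0" using assms by simp
  then obtain t where "0 < t" "t < min d (q - s)" "c * t < \<phi> (x + s *\<^sub>R v) (x + s *\<^sub>R v + t *\<^sub>R v)"
    using assms(1) unfolding steep_def by blast
  then show ?thesis by (intro that[of t]) (auto simp: scaleR_add_left add.assoc)
qed

lemma directional_metric_derivative_gap_null:
  assumes "open B" and lip: "L-lipschitz_on B f" and ab: "0 < a" "a < b"
  shows "steep B (\<lambda>x z. - dist (f x) (f z)) v (- a) \<inter> steep B (\<lambda>x z. dist (f x) (f z)) v b \<in> null_sets lborel"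
    (is "?N \<in> _")
proof (rule null_sets_if_lines_negligible[where v = v])
  have "continuous_on (B \<times> B) (\<lambda>(x, z). - dist (f x) (f z))"
    using continuous_on_minus[OF continuous_on_dist_lipschitz[OF lip]] by (simp add: case_prod_beta)
  then show "?N \<in> sets borel"
    using continuous_on_dist_lipschitz[OF lip] \<open>open B\<close> by (intro sets.Int steep_borel)
  fix x
  show "negligible {s. x + s *\<^sub>R v \<in> ?N}"
  proof (rule negligible_line_section[OF \<open>open B\<close>])
    show "?N \<subseteq> B" by (auto simp: steep_def)
    fix p q :: real assume "p < q" and seg: "\<And>s. s \<in> {p..q} \<Longrightarrow> x + s *\<^sub>R v \<in> B"
    define \<gamma> where "\<gamma> = (\<lambda>s. f (x + s *\<^sub>R v))"
    have l: "(L * norm v)-lipschitz_on {p..q} \<gamma>"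
      unfolding \<gamma>_def by (rule lipschitz_on_line[OF lip seg])
    show "negligible {s. x + s *\<^sub>R v \<in> ?N \<and> p < s \<and> s < q}"
    proof (rule negligible_subset[OF metric_derivative_gap_negligible[OF l less_imp_le[OF \<open>p < q\<close>] ab]], safe)
      fix s d :: real assume "x + s *\<^sub>R v \<in> steep B (\<lambda>x z. - dist (f x) (f z)) v (- a)" "s < q" "d > 0"
      then obtain t where "0 < t" "t < d" "s + t \<le> q" "- a * t < - dist (\<gamma> s) (\<gamma> (s + t))"
        unfolding \<gamma>_def by (rule steepD_line)
      then show "\<exists>t>0. t < d \<and> s + t \<le> q \<and> dist (\<gamma> s) (\<gamma> (s + t)) \<le> a * t"
        by (intro exI[of _ t]) auto
    next
      fix s d :: real assume "x + s *\<^sub>R v \<in> steep B (\<lambda>x z. dist (f x) (f z)) v b" "s < q" "d > 0"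
      then obtain t where "0 < t" "t < d" "s + t \<le> q" "b * t < dist (\<gamma> s) (\<gamma> (s + t))"
        unfolding \<gamma>_def by (rule steepD_line)
      then show "\<exists>t>0. t < d \<and> s + t \<le> q \<and> b * t \<le> dist (\<gamma> s) (\<gamma> (s + t))"
        by (intro exI[of _ t]) auto
    qed
  qed
qed

text \<open>
  The form in which preservation of length enters the proof, with \<open>h = \<Phi> \<circ> f\<close>.
\<close>

definition same_segment_lengths :: "'v::real_normed_vector set \<Rightarrow> ('v \<Rightarrow> 'a::metric_space) \<Rightarrow> ('v \<Rightarrow> 'b::metric_space) \<Rightarrow> bool" where
  "same_segment_lengths B f h \<longleftrightarrow> (\<forall>x v p q. p \<le> q \<longrightarrow> (\<forall>s\<in>{p..q}. x + s *\<^sub>R v \<in> B) \<longrightarrow>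
     curve_length p q (\<lambda>s. f (x + s *\<^sub>R v)) = curve_length p q (\<lambda>s. h (x + s *\<^sub>R v)))"

lemma directional_metric_derivatives_agree_null:
  assumes "open B" and lip: "L-lipschitz_on B f" "M-lipschitz_on B h" and "\<eta> > 0"
    and same: "same_segment_lengths B f h"
  shows "steep B (\<lambda>x z. \<bar>dist (f x) (f z) - dist (h x) (h z)\<bar>) v \<eta> \<in> null_sets lborel"
    (is "?N \<in> _")
proof (rule null_sets_if_lines_negligible[where v = v])
  have "continuous_on (B \<times> B) (\<lambda>y. \<bar>(case y of (x, z) \<Rightarrow> dist (f x) (f z)) - (case y of (x, z) \<Rightarrow> dist (h x) (h z))\<bar>)"
    by (intro continuous_on_rabs continuous_on_diff continuous_on_dist_lipschitz[OF lip(1)] continuous_on_dist_lipschitz[OF lip(2)])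
  then show "?N \<in> sets borel"
    using \<open>open B\<close> by (intro steep_borel) (simp_all add: case_prod_beta)
  fix x
  show "negligible {s. x + s *\<^sub>R v \<in> ?N}"
  proof (rule negligible_line_section[OF \<open>open B\<close>])
    show "?N \<subseteq> B" by (auto simp: steep_def)
    fix p q :: real assume "p < q" and seg: "\<And>s. s \<in> {p..q} \<Longrightarrow> x + s *\<^sub>R v \<in> B"
    define \<gamma>1 where "\<gamma>1 = (\<lambda>s. f (x + s *\<^sub>R v))"
    define \<gamma>2 where "\<gamma>2 = (\<lambda>s. h (x + s *\<^sub>R v))"
    have l: "(L * norm v)-lipschitz_on {p..q} \<gamma>1" "(M * norm v)-lipschitz_on {p..q} \<gamma>2"
      unfolding \<gamma>1_def \<gamma>2_def by (rule lipschitz_on_line[OF lip(1) seg] lipschitz_on_line[OF lip(2) seg]; assumption)+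
    have "curve_length p t \<gamma>1 = curve_length p t \<gamma>2" if "p \<le> t" "t \<le> q" for t
      using same that seg unfolding same_segment_lengths_def \<gamma>1_def \<gamma>2_def by simp
    note null = metric_derivatives_agree_negligible[OF l less_imp_le[OF \<open>p < q\<close>] \<open>\<eta> > 0\<close> this]
    show "negligible {s. x + s *\<^sub>R v \<in> ?N \<and> p < s \<and> s < q}"
    proof (rule negligible_subset[OF null], assumption, assumption, safe)
      fix s d :: real assume "x + s *\<^sub>R v \<in> ?N" "s < q" "d > 0"
      then obtain t where "0 < t" "t < d" "s + t \<le> q"
          "\<eta> * t < \<bar>dist (\<gamma>1 s) (\<gamma>1 (s + t)) - dist (\<gamma>2 s) (\<gamma>2 (s + t))\<bar>"
        unfolding \<gamma>1_def \<gamma>2_def by (rule steepD_line)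
      then show "\<exists>t>0. t < d \<and> s + t \<le> q \<and> \<eta> * t \<le> \<bar>dist (\<gamma>1 s) (\<gamma>1 (s + t)) - dist (\<gamma>2 s) (\<gamma>2 (s + t))\<bar>"
        by (intro exI[of _ t]) auto
    qed
  qed
qed

lemma finite_direction_net:
  fixes \<rho> :: real
  assumes "\<rho> > 0"
  obtains T :: "'a::euclidean_space set" where "finite T" "T \<subseteq> sphere 0 1"
    "\<And>w. w \<in> sphere 0 1 \<Longrightarrow> \<exists>v\<in>T. dist v w < \<rho>"
proof -
  have "seq_compact (sphere 0 1 :: 'a set)" by (rule compact_imp_seq_compact) simp
  then have "\<exists>T. finite T \<and> T \<subseteq> sphere 0 1 \<and> sphere (0::'a) 1 \<subseteq> (\<Union>v\<in>T. ball v \<rho>)"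
    by (rule seq_compact_imp_totally_bounded[rule_format, OF _ assms])
  then obtain T where "finite T" "T \<subseteq> sphere 0 1" "sphere (0::'a) 1 \<subseteq> (\<Union>v\<in>T. ball v \<rho>)"
    by blast
  then show ?thesis by (intro that[of T]) (auto simp: subset_eq)
qed

lemma not_steepD:
  assumes "x \<notin> steep B \<phi> v c" "x \<in> B"
  shows "\<exists>d>0. \<forall>t. 0 < t \<longrightarrow> t < d \<longrightarrow> x + t *\<^sub>R v \<in> B \<longrightarrow> \<phi> x (x + t *\<^sub>R v) \<le> c * t"
proof -
  have "\<not> (\<forall>d>0. \<exists>t. 0 < t \<and> t < d \<and> x + t *\<^sub>R v \<in> B \<and> c * t < \<phi> x (x + t *\<^sub>R v))"
    using assms by (simp add: steep_def)
  then show ?thesis unfolding not_less[symmetric] by blast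
qed

text \<open>
  A growth bound in finitely many directions forming a \<open>\<rho>\<close>-net of the unit sphere extends to all
  directions, since changing the direction by \<open>\<rho>\<close> moves the endpoint \<open>z\<close> by at most \<open>\<rho> * dist x z\<close>.
\<close>

lemma radial_bound_from_directions:
  fixes \<phi> :: "'a::euclidean_space \<Rightarrow> 'a \<Rightarrow> real"
  assumes "open B" "x \<in> B" and "finite T" "T \<subseteq> sphere 0 1"
    and net: "\<And>w. w \<in> sphere 0 1 \<Longrightarrow> \<exists>v\<in>T. dist v w < \<rho>"
    and steep: "\<And>v. v \<in> T \<Longrightarrow> x \<notin> steep B \<phi> v c"
    and lip: "\<And>z z'. z \<in> B \<Longrightarrow> z' \<in> B \<Longrightarrow> \<phi> x z \<le> \<phi> x z' + K * dist z z'"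
    and diag: "\<phi> x x \<le> 0" and "K \<ge> 0"
  shows "\<exists>d>0. \<forall>z. dist x z < d \<longrightarrow> z \<in> B \<and> \<phi> x z \<le> (c + K * \<rho>) * dist x z"
proof -
  obtain r where r: "r > 0" "ball x r \<subseteq> B" using assms(1,2) open_contains_ball by blast
  have "\<forall>v\<in>T. \<exists>d>0. \<forall>t. 0 < t \<longrightarrow> t < d \<longrightarrow> x + t *\<^sub>R v \<in> B \<longrightarrow> \<phi> x (x + t *\<^sub>R v) \<le> c * t"
    using not_steepD[OF steep \<open>x \<in> B\<close>] by blast
  then obtain \<delta> where \<delta>: "\<forall>v\<in>T. \<delta> v > 0 \<and> (\<forall>t. 0 < t \<longrightarrow> t < \<delta> v \<longrightarrow> x + t *\<^sub>R v \<in> B \<longrightarrow> \<phi> x (x + t *\<^sub>R v) \<le> c * t)"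
    by (rule bchoice[THEN exE])
  define d where "d = Min (insert r (\<delta> ` T))"
  have d: "d > 0" "d \<le> r" "\<And>v. v \<in> T \<Longrightarrow> d \<le> \<delta> v"
    unfolding d_def using \<open>finite T\<close> r(1) \<delta> by auto
  show ?thesis
  proof (intro exI[of _ d] conjI d(1) allI impI)
    fix z assume z: "dist x z < d"
    then have zB: "z \<in> B" using d(2) r(2) by (auto simp: subset_eq)
    show "z \<in> B" by (rule zB)
    show "\<phi> x z \<le> (c + K * \<rho>) * dist x z"
    proof (cases "z = x")
      case False
      define t where "t = dist x z"
      have t: "t > 0" "t < d" using False z by (auto simp: t_def)
      define w where "w = (1 / t) *\<^sub>R (z - x)"
      have zw: "z = x + t *\<^sub>R w" using t(1) by (simp add: w_def)
      have "w \<in> sphere 0 1" using t(1) by (auto simp: w_def t_def dist_norm norm_minus_commute)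
      then obtain v where v: "v \<in> T" "dist v w < \<rho>" using net by blast
      have nv: "norm v = 1" using v(1) \<open>T \<subseteq> sphere 0 1\<close> by auto
      have z'B: "x + t *\<^sub>R v \<in> B"
        using t d(2) nv r(2) by (intro subsetD[OF r(2)]) (simp add: dist_norm)
      have "dist z (x + t *\<^sub>R v) = t * dist v w"
        using t(1) by (simp add: zw dist_norm norm_minus_commute flip: scaleR_diff_right)
      also have "\<dots> \<le> t * \<rho>" using v(2) t(1) by (intro mult_left_mono) auto
      finally have dz: "K * dist z (x + t *\<^sub>R v) \<le> K * (t * \<rho>)" by (rule mult_left_mono) fact
      have "\<phi> x z \<le> \<phi> x (x + t *\<^sub>R v) + K * dist z (x + t *\<^sub>R v)" by (rule lip[OF zB z'B])
      also have "\<phi> x (x + t *\<^sub>R v) \<le> c * t" using \<delta> v(1) t d(3)[OF v(1)] z'B by auto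
      finally show ?thesis using zB dz by (simp add: t_def algebra_simps)
    qed (use zB diag in auto)
  qed
qed

section \<open>Almost everywhere comparison of two maps\<close>

text \<open>
  The points at which the metric derivative of \<open>f\<close> degenerates. The direction \<open>v\<close> may depend on \<open>a\<close>;
  the exceptional directions are taken from a countable set \<open>D\<close> so that countable unions suffice
  later.
\<close>

definition flat_points :: "'v::real_normed_vector set \<Rightarrow> 'v set \<Rightarrow> ('v \<Rightarrow> 'a::metric_space) \<Rightarrow> 'v set" where
  "flat_points B D f = {x \<in> B. \<forall>a>0. \<exists>v\<in>D. \<exists>\<delta>>0. \<forall>t. 0 \<le> t \<and> t \<le> \<delta> \<longrightarrow>
     x + t *\<^sub>R v \<in> B \<and> dist (f x) (f (x + t *\<^sub>R v)) \<le> a * t}"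

lemma dist_image_lipschitz:
  assumes "L-lipschitz_on B f" "z \<in> B" "z' \<in> B"
  shows "\<bar>dist (f x) (f z) - dist (f x) (f z')\<bar> \<le> L * dist z z'"
proof -
  have "dist (f z) (f z') \<le> L * dist z z'" using assms by (intro lipschitz_onD) auto
  then show ?thesis
    using dist_triangle[of "f x" "f z" "f z'"] dist_triangle[of "f x" "f z'" "f z"] by (simp add: dist_commute)
qed

text \<open>
  Take finite \<open>1 / (m + 1)\<close>-nets of directions for all \<open>m\<close>, and let \<open>N\<close> collect, for every direction
  in a net, the points where the metric derivatives of \<open>f\<close> and \<open>h\<close> differ noticeably, or where those
  of \<open>f\<close> have a noticeable gap between lower and upper value. Outside \<open>N\<close>, either for some net the
  speed of \<open>f\<close> in all its directions is bounded below, which gives a lower bound in all directions,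
  or for every net some direction has a small lower, and hence a small upper, speed.
\<close>

lemma ae_metric_dichotomy:
  fixes f :: "'v::euclidean_space \<Rightarrow> 'a::metric_space" and h :: "'v \<Rightarrow> 'b::metric_space"
  assumes "open B" and lip: "L-lipschitz_on B f" "L-lipschitz_on B h"
    and same: "same_segment_lengths B f h"
  obtains N D where "N \<in> null_sets lborel" "countable D" "D \<subseteq> sphere 0 1"
    "\<And>x \<eta>. x \<in> B - N \<Longrightarrow> \<eta> > 0 \<Longrightarrow> \<exists>d>0. \<forall>z. dist x z < d \<longrightarrow>
       z \<in> B \<and> \<bar>dist (f x) (f z) - dist (h x) (h z)\<bar> \<le> \<eta> * dist x z"
    "\<And>x. x \<in> B - N \<Longrightarrow> x \<notin> flat_points B D f \<Longrightarrow>
       \<exists>c>0. \<exists>d>0. \<forall>z. dist x z < d \<longrightarrow> z \<in> B \<and> c * dist x z \<le> dist (f x) (f z)"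
proof -
  have L: "L \<ge> 0" using lip(1) by (rule lipschitz_on_nonneg)
  define \<rho> where "\<rho> = (\<lambda>m::nat. 1 / real (Suc m))"
  \<comment> \<open>Passing to an arbitrary direction costs \<open>L * \<rho> m\<close>, so a lower bound \<open>a m\<close> for the speed in the
      net leaves a positive bound.\<close>
  define a where "a = (\<lambda>m. 2 * (L + 1) * \<rho> m)"
  have \<rho>: "\<rho> m > 0" for m by (simp add: \<rho>_def)
  have a: "a m > 0" for m using L \<rho>[of m] by (simp add: a_def)
  have "\<exists>T::'v set. finite T \<and> T \<subseteq> sphere 0 1 \<and> (\<forall>w\<in>sphere 0 1. \<exists>v\<in>T. dist v w < \<rho> m)" for m
  proof -
    obtain T :: "'v set" where "finite T" "T \<subseteq> sphere 0 1" "\<And>w. w \<in> sphere 0 1 \<Longrightarrow> \<exists>v\<in>T. dist v w < \<rho> m"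
      using finite_direction_net[OF \<rho>[of m]] by metis
    then show ?thesis by blast
  qed
  then have "\<forall>m. \<exists>T::'v set. finite T \<and> T \<subseteq> sphere 0 1 \<and> (\<forall>w\<in>sphere 0 1. \<exists>v\<in>T. dist v w < \<rho> m)" ..
  then obtain T :: "nat \<Rightarrow> 'v set" where T: "\<forall>m. finite (T m) \<and> T m \<subseteq> sphere 0 1 \<and>
      (\<forall>w\<in>sphere 0 1. \<exists>v\<in>T m. dist v w < \<rho> m)"
    by (rule choice[THEN exE])
  have Tnet: "\<And>w. w \<in> sphere 0 1 \<Longrightarrow> \<exists>v\<in>T m. dist v w < \<rho> m" for m using T by blast
  have Tfin: "finite (T m)" and Tsub: "T m \<subseteq> sphere 0 1" for m using T by blast+
  let ?\<psi> = "\<lambda>x z. \<bar>dist (f x) (f z) - dist (h x) (h z)\<bar>"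
  let ?df = "\<lambda>x z. dist (f x) (f z)"
  let ?mf = "\<lambda>x z. - dist (f x) (f z)"
  define N where "N = (\<Union>m. \<Union>v\<in>T m. steep B ?\<psi> v (\<rho> m) \<union> (steep B ?mf v (- a m) \<inter> steep B ?df v (2 * a m)))"
  have N: "N \<in> null_sets lborel"
    unfolding N_def
  proof (rule null_sets_UN', simp, rule null_sets_UN')
    fix m
    show "countable (T m)" using Tfin by (rule countable_finite)
    fix v
    have "steep B ?\<psi> v (\<rho> m) \<in> null_sets lborel"
      by (rule directional_metric_derivatives_agree_null[OF \<open>open B\<close> lip \<rho> same])
    moreover have "steep B ?mf v (- a m) \<inter> steep B ?df v (2 * a m) \<in> null_sets lborel"
      using a[of m] by (intro directional_metric_derivative_gap_null[OF \<open>open B\<close> lip(1)]) auto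
    ultimately show "steep B ?\<psi> v (\<rho> m) \<union> (steep B ?mf v (- a m) \<inter> steep B ?df v (2 * a m)) \<in> null_sets lborel"
      by (rule null_sets.Un)
  qed
  have nN: "x \<notin> steep B ?\<psi> v (\<rho> m)" "x \<in> steep B ?mf v (- a m) \<Longrightarrow> x \<notin> steep B ?df v (2 * a m)"
    if "x \<in> B - N" "v \<in> T m" for x v m
    using that by (auto simp: N_def)
  show ?thesis
  proof (rule that[OF N])
    show "countable (\<Union>m. T m)" using Tfin by (intro countable_UN[OF countableI_type] countable_finite)
    show "(\<Union>m. T m) \<subseteq> sphere 0 1" using Tsub by blast
  next
    fix x and \<eta> :: real assume x: "x \<in> B - N" and "\<eta> > 0"
    then have "0 < \<eta> / (1 + 2 * L)" using L by simp
    then obtain m where "1 / real (Suc m) < \<eta> / (1 + 2 * L)" by (rule nat_approx_posE)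
    then have m: "\<rho> m + 2 * L * \<rho> m \<le> \<eta>" using L by (simp add: \<rho>_def field_simps)
    have lips: "?\<psi> x z \<le> ?\<psi> x z' + 2 * L * dist z z'" if "z \<in> B" "z' \<in> B" for z z'
      using dist_image_lipschitz[OF lip(1) that, of x] dist_image_lipschitz[OF lip(2) that, of x] by simp
    have xB: "x \<in> B" and diag: "?\<psi> x x \<le> 0" and K: "0 \<le> 2 * L" using x L by simp_all
    obtain d where d: "d > 0" "\<And>z. dist x z < d \<Longrightarrow> z \<in> B \<and> ?\<psi> x z \<le> (\<rho> m + 2 * L * \<rho> m) * dist x z"
      using radial_bound_from_directions[of B x "T m" "\<rho> m" ?\<psi> "\<rho> m" "2 * L",
          OF \<open>open B\<close> xB Tfin Tsub Tnet nN(1)[OF x] lips diag K] by blast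
    have "z \<in> B \<and> ?\<psi> x z \<le> \<eta> * dist x z" if z: "dist x z < d" for z
      using d(2)[OF z] mult_right_mono[OF m zero_le_dist[of x z]] by linarith
    then show "\<exists>d>0. \<forall>z. dist x z < d \<longrightarrow> z \<in> B \<and> ?\<psi> x z \<le> \<eta> * dist x z" using d(1) by blast
  next
    fix x assume x: "x \<in> B - N" and nf: "x \<notin> flat_points B (\<Union>m. T m) f"
    have "\<exists>m. \<forall>v\<in>T m. x \<notin> steep B ?mf v (- a m)"
    proof (rule ccontr)
      assume no: "\<not> (\<exists>m. \<forall>v\<in>T m. x \<notin> steep B ?mf v (- a m))"
      obtain r where r: "r > 0" "ball x r \<subseteq> B" using x \<open>open B\<close> open_contains_ball by blast
      have "\<exists>v\<in>\<Union>m. T m. \<exists>\<delta>>0. \<forall>t. 0 \<le> t \<and> t \<le> \<delta> \<longrightarrow> x + t *\<^sub>R v \<in> B \<and> ?df x (x + t *\<^sub>R v) \<le> b * t"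
        if b: "b > 0" for b
      proof -
        have "0 < b / (4 * (L + 1))" using L b by simp
        then obtain m where "1 / real (Suc m) < b / (4 * (L + 1))" by (rule nat_approx_posE)
        then have m: "2 * a m \<le> b" using L by (simp add: a_def \<rho>_def field_simps)
        obtain v where v: "v \<in> T m" "x \<in> steep B ?mf v (- a m)" using no by blast
        have "\<exists>d>0. \<forall>t. 0 < t \<longrightarrow> t < d \<longrightarrow> x + t *\<^sub>R v \<in> B \<longrightarrow> ?df x (x + t *\<^sub>R v) \<le> 2 * a m * t"
          using not_steepD[OF nN(2)[OF x v]] x by blast
        then obtain d where d: "d > 0"
          "\<And>t. 0 < t \<Longrightarrow> t < d \<Longrightarrow> x + t *\<^sub>R v \<in> B \<Longrightarrow> ?df x (x + t *\<^sub>R v) \<le> 2 * a m * t" by blast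
        have nv: "norm v = 1" using v(1) Tsub[of m] by auto
        have "x + t *\<^sub>R v \<in> B \<and> ?df x (x + t *\<^sub>R v) \<le> b * t" if t: "0 \<le> t" "t \<le> min d r / 2" for t
        proof -
          have tt: "t < d" "t < r" using t d(1) r(1) by auto
          have xB: "x + t *\<^sub>R v \<in> B"
            using tt(2) t(1) nv by (intro subsetD[OF r(2)]) (simp add: dist_norm)
          have "?df x (x + t *\<^sub>R v) \<le> b * t"
          proof (cases "t = 0")
            case False
            then have "?df x (x + t *\<^sub>R v) \<le> 2 * a m * t" using t tt xB by (intro d(2)) auto
            also have "\<dots> \<le> b * t" using m t(1) by (rule mult_right_mono)
            finally show ?thesis .
          qed simp
          then show ?thesis using xB by blast
        qed
        moreover have "min d r / 2 > 0" using d(1) r(1) by simp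
        moreover have "v \<in> (\<Union>m. T m)" using v(1) by blast
        ultimately show ?thesis by blast
      qed
      then have "x \<in> flat_points B (\<Union>m. T m) f" using x by (simp add: flat_points_def)
      then show False using nf by blast
    qed
    then obtain m where m: "\<And>v. v \<in> T m \<Longrightarrow> x \<notin> steep B ?mf v (- a m)" by blast
    have lips: "?mf x z \<le> ?mf x z' + L * dist z z'" if "z \<in> B" "z' \<in> B" for z z'
      using dist_image_lipschitz[OF lip(1) that, of x] by simp
    have xB: "x \<in> B" and diag: "?mf x x \<le> 0" using x by simp_all
    obtain d where d: "d > 0" "\<And>z. dist x z < d \<Longrightarrow> z \<in> B \<and> ?mf x z \<le> (- a m + L * \<rho> m) * dist x z"
      using radial_bound_from_directions[of B x "T m" "\<rho> m" ?mf "- a m" L,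
          OF \<open>open B\<close> xB Tfin Tsub Tnet m lips diag L] by blast
    define c where "c = (L + 2) * \<rho> m"
    have "c > 0" using L \<rho>[of m] by (simp add: c_def)
    moreover have "- a m + L * \<rho> m = - c" by (simp add: a_def c_def algebra_simps)
    then have "\<forall>z. dist x z < d \<longrightarrow> z \<in> B \<and> c * dist x z \<le> ?df x z" using d(2) by auto
    ultimately show "\<exists>c>0. \<exists>d>0. \<forall>z. dist x z < d \<longrightarrow> z \<in> B \<and> c * dist x z \<le> ?df x z"
      using d(1) by blast
  qed
qed

text \<open>
  Flatness depends only on distances up to \<open>o(\<bar>x - z\<bar>)\<close>, which are common to \<open>f\<close> and \<open>h\<close> almost
  everywhere.
\<close>

lemma flat_points_transfer:
  assumes x: "x \<in> flat_points B D f" and D: "D \<subseteq> sphere 0 1"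
    and close: "\<And>\<eta>. \<eta> > 0 \<Longrightarrow> \<exists>d>0. \<forall>z. dist x z < d \<longrightarrow>
       \<bar>dist (f x) (f z) - dist (h x) (h z)\<bar> \<le> \<eta> * dist x z"
  shows "x \<in> flat_points B D h"
  unfolding flat_points_def
proof (intro CollectI conjI allI impI)
  show "x \<in> B" using x by (simp add: flat_points_def)
  fix a :: real assume "a > 0"
  then have a2: "a / 2 > 0" by simp
  obtain v \<delta> where v: "v \<in> D" "\<delta> > 0" and fl: "\<And>t. 0 \<le> t \<Longrightarrow> t \<le> \<delta> \<Longrightarrow>
      x + t *\<^sub>R v \<in> B \<and> dist (f x) (f (x + t *\<^sub>R v)) \<le> a / 2 * t"
    using x a2 unfolding flat_points_def by blast
  obtain d where d: "d > 0" "\<And>z. dist x z < d \<Longrightarrow>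
       \<bar>dist (f x) (f z) - dist (h x) (h z)\<bar> \<le> a / 2 * dist x z"
    using close[OF a2] by blast
  have nv: "norm v = 1" using v(1) D by auto
  have "x + t *\<^sub>R v \<in> B \<and> dist (h x) (h (x + t *\<^sub>R v)) \<le> a * t" if t: "0 \<le> t" "t \<le> min \<delta> (d / 2)" for t
  proof -
    have dt: "dist x (x + t *\<^sub>R v) = t" using t(1) nv by (simp add: dist_norm)
    then have "\<bar>dist (f x) (f (x + t *\<^sub>R v)) - dist (h x) (h (x + t *\<^sub>R v))\<bar> \<le> a / 2 * t"
      using d(2)[of "x + t *\<^sub>R v"] t d(1) by simp
    then have "dist (h x) (h (x + t *\<^sub>R v)) \<le> dist (f x) (f (x + t *\<^sub>R v)) + a / 2 * t" by linarith
    moreover have "a / 2 * t + a / 2 * t = a * t" by (simp add: field_simps)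
    ultimately have "dist (h x) (h (x + t *\<^sub>R v)) \<le> a * t" using fl[of t] t by linarith
    then show ?thesis using fl[of t] t by simp
  qed
  moreover have "min \<delta> (d / 2) > 0" using d(1) v(2) by simp
  ultimately show "\<exists>v\<in>D. \<exists>\<delta>>0. \<forall>t. 0 \<le> t \<and> t \<le> \<delta> \<longrightarrow> x + t *\<^sub>R v \<in> B \<and> dist (h x) (h (x + t *\<^sub>R v)) \<le> a * t"
    using v(1) by blast
qed

section \<open>Upper bounds for the Hausdorff measure of an image\<close>

lemma hausdorff_pre_le_gauge:
  assumes "bounded E" "diameter E \<le> \<delta>" "\<delta> \<ge> 0"
  shows "hausdorff_pre n \<delta> E \<le> hausdorff_gauge n E"
proof -
  define A where "A = (\<lambda>i::nat. if i = 0 then E else {})"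
  have "hausdorff_pre n \<delta> E \<le> (\<Sum>i. hausdorff_gauge n (A i))"
    unfolding hausdorff_pre_def by (rule INF_lower) (use assms in \<open>auto simp: A_def\<close>)
  also have "(\<Sum>i. hausdorff_gauge n (A i)) = (\<Sum>i\<in>{0}. hausdorff_gauge n (A i))"
    by (rule suminf_finite) (auto simp: A_def hausdorff_gauge_def)
  finally show ?thesis by (simp add: A_def)
qed

text \<open>
  A bound for all finite partial sums suffices; this is the form in which volumes of non-overlapping
  cubes are available.
\<close>

lemma hausdorff_pre_countable_UN_le:
  fixes E :: "'k \<Rightarrow> 'a::metric_space set" and c :: "'k \<Rightarrow> ennreal"
  assumes "countable \<K>" and "\<delta> \<ge> 0"
    and sum: "\<And>\<F>. finite \<F> \<Longrightarrow> \<F> \<subseteq> \<K> \<Longrightarrow> sum c \<F> \<le> C"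
    and pre: "\<And>K. K \<in> \<K> \<Longrightarrow> hausdorff_pre n \<delta> (E K) \<le> c K"
  shows "hausdorff_pre n \<delta> (\<Union>K\<in>\<K>. E K) \<le> C"
proof -
  define \<iota> where "\<iota> = to_nat_on \<K>"
  have inj: "inj_on \<iota> \<K>" unfolding \<iota>_def using assms(1) by (rule inj_on_to_nat_on)
  define E' where "E' = (\<lambda>i. \<Union>K\<in>{K\<in>\<K>. \<iota> K = i}. E K)"
  have "(\<Union>K\<in>\<K>. E K) = (\<Union>i. E' i)" by (auto simp: E'_def)
  then have "hausdorff_pre n \<delta> (\<Union>K\<in>\<K>. E K) \<le> (\<Sum>i. hausdorff_pre n \<delta> (E' i))"
    using hausdorff_pre_subadditive[of n \<delta> E'] by simp
  also have "\<dots> \<le> C"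
  proof (rule suminf_le_const)
    fix N
    define \<F> where "\<F> = {K\<in>\<K>. \<iota> K < N}"
    have fin: "finite \<F>"
      by (rule finite_imageD[of \<iota>], rule finite_subset[of _ "{..<N}"])
         (auto simp: \<F>_def intro: inj_on_subset[OF inj])
    have E'1: "E' (\<iota> K) = E K" if "K \<in> \<K>" for K
      using that inj by (auto simp: E'_def inj_on_def)
    have E'0: "E' i = {}" if "i \<notin> \<iota> ` \<K>" for i
      using that by (auto simp: E'_def)
    have "(\<Sum>i<N. hausdorff_pre n \<delta> (E' i)) = (\<Sum>i\<in>\<iota> ` \<F>. hausdorff_pre n \<delta> (E' i))"
    proof (rule sum.mono_neutral_right)
      show "\<forall>i\<in>{..<N} - \<iota> ` \<F>. hausdorff_pre n \<delta> (E' i) = 0"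
      proof
        fix i assume "i \<in> {..<N} - \<iota> ` \<F>"
        then have "i \<notin> \<iota> ` \<K>" by (auto simp: \<F>_def)
        then show "hausdorff_pre n \<delta> (E' i) = 0" using E'0 hausdorff_pre_empty[OF assms(2)] by simp
      qed
    qed (auto simp: \<F>_def)
    also have "\<dots> = (\<Sum>K\<in>\<F>. hausdorff_pre n \<delta> (E' (\<iota> K)))"
      by (rule sum.reindex_cong[OF inj_on_subset[OF inj]]) (auto simp: \<F>_def)
    also have "\<dots> \<le> sum c \<F>"
      using pre E'1 by (intro sum_mono) (auto simp: \<F>_def)
    also have "\<dots> \<le> C" using fin by (intro sum) (auto simp: \<F>_def)
    finally show "(\<Sum>i<N. hausdorff_pre n \<delta> (E' i)) \<le> C" .
  qed simp
  finally show ?thesis .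
qed

lemma hausdorff_pre_finite_UN_le:
  assumes "finite I" and "\<delta> \<ge> 0" and "\<And>i. i \<in> I \<Longrightarrow> hausdorff_pre n \<delta> (E i) \<le> c"
  shows "hausdorff_pre n \<delta> (\<Union>i\<in>I. E i) \<le> of_nat (card I) * c"
proof (rule hausdorff_pre_countable_UN_le[where c = "\<lambda>_. c"])
  fix \<F> assume "finite \<F>" "\<F> \<subseteq> I"
  then have "card \<F> \<le> card I" using assms(1) by (intro card_mono)
  then show "(\<Sum>_\<in>\<F>. c) \<le> of_nat (card I) * c" by (simp add: mult_right_mono)
qed (use assms in \<open>auto intro: countable_finite\<close>)

lemma hausdorff_gauge_le:
  assumes "diameter E \<le> d" "bounded E" "0 \<le> d"
  shows "hausdorff_gauge n E \<le> ennreal (unit_ball_vol (real n) / 2 ^ n * d ^ n)"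
proof -
  have "diameter E ^ n \<le> d ^ n" using assms diameter_ge_0[OF assms(2)] by (intro power_mono)
  then have "unit_ball_vol (real n) / 2 ^ n * diameter E ^ n \<le> unit_ball_vol (real n) / 2 ^ n * d ^ n"
    by (intro mult_left_mono) auto
  then show ?thesis unfolding hausdorff_gauge_def by (simp add: ennreal_leI del: times_divide_eq_left)
qed

definition cube :: "real ^ 'n \<Rightarrow> real \<Rightarrow> (real ^ 'n) set" where
  "cube u s = {x. \<forall>i. u $ i \<le> x $ i \<and> x $ i \<le> u $ i + s}"

lemma cube_eq_cbox: "cube u s = cbox u (u + (\<chi> i. s))"
  by (auto simp: cube_def mem_box_cart)

lemma measure_cube:
  fixes u :: "real ^ 'n"
  assumes "0 \<le> s"
  shows "measure lebesgue (cube u s) = s ^ CARD('n)"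
  using content_cbox_cart[of u "u + (\<chi> i. s)"] assms unfolding cube_eq_cbox
  by (simp add: interval_ne_empty_cart)

lemma dist_cart_le:
  fixes x y :: "real ^ 'n"
  assumes "\<And>i. \<bar>x $ i - y $ i\<bar> \<le> b"
  shows "dist x y \<le> real CARD('n) * b"
proof -
  have "dist x y \<le> (\<Sum>i\<in>UNIV. \<bar>(x - y) $ i\<bar>)" unfolding dist_norm by (rule norm_le_l1_cart)
  also have "\<dots> \<le> (\<Sum>i\<in>(UNIV :: 'n set). b)" using assms by (intro sum_mono) simp
  finally show ?thesis by simp
qed

lemma cube_dist_le:
  fixes x y :: "real ^ 'n"
  assumes "x \<in> cube u s" "y \<in> cube u s"
  shows "dist x y \<le> real CARD('n) * s"
proof (rule dist_cart_le)
  fix i show "\<bar>x $ i - y $ i\<bar> \<le> s"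
    using assms by (simp add: cube_def abs_le_iff) (smt (verit))
qed

text \<open>
  Dyadic subcubes of a large cube, all of them small and inside \<open>U\<close>, without overlap.
\<close>

lemma cube_cover:
  fixes S U :: "(real ^ 'n) set"
  assumes "bounded S" "open U" "S \<subseteq> U" "r > 0"
  obtains \<K> where "countable \<K>" "S \<subseteq> (\<Union>(u, s)\<in>\<K>. cube u s)"
    "\<And>u s. (u, s) \<in> \<K> \<Longrightarrow> 0 < s \<and> s < r \<and> cube u s \<subseteq> U"
    "pairwise (\<lambda>k k'. interior (cube (fst k) (snd k)) \<inter> interior (cube (fst k') (snd k')) = {}) \<K>"
proof -
  obtain R where R: "R > 0" "\<And>x. x \<in> S \<Longrightarrow> norm x \<le> R" using assms(1) bounded_pos by metis
  define a b where "a = (\<chi> i. - R :: real ^ 'n)" and "b = (\<chi> i. R :: real ^ 'n)"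
  have Sab: "S \<subseteq> cbox a b"
  proof
    fix x assume "x \<in> S"
    then have "\<bar>x $ i\<bar> \<le> R" for i using R(2) component_le_norm_cart[of x i] by (meson order_trans)
    then show "x \<in> cbox a b" by (auto simp: mem_box_cart a_def b_def abs_le_iff) (smt (verit))
  qed
  have box: "box a b \<noteq> {}" using R(1) by (simp add: interval_ne_empty_cart a_def b_def)
  \<comment> \<open>A gauge must be defined everywhere; only its values on \<open>S\<close>, hence in \<open>U\<close>, matter.\<close>
  define g where "g = (\<lambda>x. if x \<in> U then ball x (r / 2) \<inter> U else ball x (r / 2))"
  have "gauge g" unfolding gauge_def g_def using assms(2,4) by auto
  obtain \<D> where D: "countable \<D>" 
    "\<And>K. K \<in> \<D> \<Longrightarrow> interior K \<noteq> {} \<and> (\<exists>c d. K = cbox c d)"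
    "pairwise (\<lambda>A B. interior A \<inter> interior B = {}) \<D>"
    "\<And>K. K \<in> \<D> \<Longrightarrow> \<exists>x \<in> S \<inter> K. K \<subseteq> g x"
    "\<And>u v. cbox u v \<in> \<D> \<Longrightarrow> \<exists>n. \<forall>i \<in> Basis. v \<bullet> i - u \<bullet> i = (b \<bullet> i - a \<bullet> i) / 2^n"
    "S \<subseteq> \<Union>\<D>"
    by (rule covering_lemma[OF Sab box \<open>gauge g\<close>]) blast
  have cubes: "\<exists>u s. K = cube u s \<and> 0 < s \<and> s < r \<and> cube u s \<subseteq> U" if K: "K \<in> \<D>" for K
  proof -
    obtain u v where uv: "K = cbox u v" using D(2)[OF K] by blast
    obtain n where n: "\<forall>i\<in>Basis. v \<bullet> i - u \<bullet> i = (b \<bullet> i - a \<bullet> i) / 2 ^ n" using D(5) K uv by blast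
    define s where "s = 2 * R / 2 ^ n"
    have s: "s > 0" using R(1) by (simp add: s_def)
    have "v $ i - u $ i = s" for i
    proof -
      have "axis i 1 \<in> (Basis :: (real ^ 'n) set)" by simp
      with n have "v \<bullet> axis i 1 - u \<bullet> axis i 1 = (b \<bullet> axis i 1 - a \<bullet> axis i 1) / 2 ^ n" by blast
      then show ?thesis by (simp add: inner_axis a_def b_def s_def)
    qed
    then have v: "v = u + (\<chi> i. s)" by (simp add: vec_eq_iff algebra_simps)
    have Kc: "K = cube u s" by (simp add: cube_eq_cbox uv v)
    obtain x where x: "x \<in> S" "K \<subseteq> g x" using D(4)[OF K] by blast
    then have "x \<in> U" using assms(3) by blast
    then have KU: "K \<subseteq> U" and Kb: "K \<subseteq> ball x (r / 2)" using x(2) by (simp_all add: g_def)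
    obtain i :: 'n where True by blast
    have "u \<in> K" "u + axis i s \<in> K" using s by (auto simp: Kc cube_def axis_def)
    then have "dist u (u + axis i s) < r"
      using subsetD[OF Kb, of u] subsetD[OF Kb, of "u + axis i s"] dist_triangle[of u "u + axis i s" x]
      by (simp add: dist_commute)
    then have "s < r" using s component_le_norm_cart[of "axis i s" i] by (simp add: dist_norm axis_def)
    then show ?thesis using Kc KU s by blast
  qed
  define \<K> where "\<K> = {(u, s). cube u s \<in> \<D> \<and> 0 < s \<and> s < r \<and> cube u s \<subseteq> U}"
  have cube_inj: "u = u' \<and> s = s'" if "cube u s = cube u' s'" "0 < s" "0 < s'"
    for u u' :: "real ^ 'n" and s s'
  proof -
    have "cbox u (u + (\<chi> i. s)) \<noteq> {}" using that(2) by (simp add: interval_ne_empty_cart)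
    then have "u = u' \<and> u + (\<chi> i. s) = u' + (\<chi> i. s')"
      using that(1) unfolding cube_eq_cbox eq_cbox by blast
    then have uu: "u = u'" and e: "u + (\<chi> i. s) = u' + (\<chi> i. s')" by blast+
    have "(u + (\<chi> i. s)) $ undefined = (u' + (\<chi> i. s')) $ undefined" unfolding e ..
    then show ?thesis using uu by simp
  qed
  have inj: "inj_on (\<lambda>(u, s). cube u s) \<K>"
    unfolding inj_on_def using cube_inj by (auto simp: \<K>_def)
  show ?thesis
  proof (rule that[of \<K>])
    have "(\<lambda>(u, s). cube u s) ` \<K> \<subseteq> \<D>" by (auto simp: \<K>_def)
    then have "countable ((\<lambda>(u, s). cube u s) ` \<K>)" using D(1) countable_subset by blast
    then show "countable \<K>" using inj by (rule countable_image_inj_on)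
    show "S \<subseteq> (\<Union>(u, s)\<in>\<K>. cube u s)"
    proof
      fix x assume "x \<in> S"
      then obtain K where K: "K \<in> \<D>" "x \<in> K" using D(6) by blast
      then obtain u s where "K = cube u s" "(u, s) \<in> \<K>" using cubes[OF K(1)] by (auto simp: \<K>_def)
      then show "x \<in> (\<Union>(u, s)\<in>\<K>. cube u s)" using K(2) by blast
    qed
    show "0 < s \<and> s < r \<and> cube u s \<subseteq> U" if "(u, s) \<in> \<K>" for u s using that by (simp add: \<K>_def)
    show "pairwise (\<lambda>k k'. interior (cube (fst k) (snd k)) \<inter> interior (cube (fst k') (snd k')) = {}) \<K>"
    proof (rule pairwiseI)
      fix k k' assume k: "k \<in> \<K>" "k' \<in> \<K>" and ne: "k \<noteq> k'"
      then have "cube (fst k) (snd k) \<noteq> cube (fst k') (snd k')"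
        using cube_inj[of "fst k" "snd k" "fst k'" "snd k'"] by (auto simp: \<K>_def prod_eq_iff)
      then show "interior (cube (fst k) (snd k)) \<inter> interior (cube (fst k') (snd k')) = {}"
        using k by (intro pairwiseD[OF D(3)]) (auto simp: \<K>_def)
    qed
  qed
qed

lemma sum_measure_cubes_le:
  fixes U :: "(real ^ 'n) set" and \<F> :: "((real ^ 'n) \<times> real) set"
  assumes "finite \<F>" and U: "U \<in> lmeasurable"
    and cubes: "\<And>u s. (u, s) \<in> \<F> \<Longrightarrow> 0 < s \<and> cube u s \<subseteq> U"
    and disj: "pairwise (\<lambda>k k'. interior (cube (fst k) (snd k)) \<inter> interior (cube (fst k') (snd k')) = {}) \<F>"
  shows "(\<Sum>(u, s)\<in>\<F>. s ^ CARD('n)) \<le> measure lebesgue U"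
proof -
  define Q where "Q = (\<lambda>k. cube (fst k) (snd k :: real) :: (real ^ 'n) set)"
  have Q: "Q k \<in> lmeasurable" for k by (simp add: Q_def cube_eq_cbox)
  have "(\<Sum>(u, s)\<in>\<F>. s ^ CARD('n)) = (\<Sum>k\<in>\<F>. measure lebesgue (Q k))"
    using cubes by (intro sum.cong) (auto simp: measure_cube less_imp_le Q_def)
  also have "\<dots> = measure lebesgue (\<Union>k\<in>\<F>. Q k)"
  proof (rule measure_negligible_finite_Union_image[symmetric, OF assms(1) Q])
    show "pairwise (\<lambda>x y. negligible (Q x \<inter> Q y)) \<F>"
    proof (rule pairwise_mono[OF disj])
      fix k k' :: "(real ^ 'n) \<times> real"
      assume "interior (cube (fst k) (snd k)) \<inter> interior (cube (fst k') (snd k')) = {}"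
      then show "negligible (Q k \<inter> Q k')"
        by (simp add: negligible_convex_interior convex_Int cube_eq_cbox Q_def)
    qed simp
  qed
  also have "\<dots> \<le> measure lebesgue U"
  proof (rule measure_mono_fmeasurable[OF _ _ U])
    show "(\<Union>k\<in>\<F>. Q k) \<subseteq> U" using cubes by (fastforce simp: Q_def)
    show "(\<Union>k\<in>\<F>. Q k) \<in> sets lebesgue" using assms(1) Q by (intro sets.finite_UN fmeasurableD)
  qed
  finally show ?thesis .
qed

text \<open>
  The hypothesis bounds the image of the part of \<open>S\<close> in a single small cube by a multiple of the
  volume of the cube. Cubes covering \<open>S\<close> inside an open set of nearly the same measure then bound
  the whole image. The factor \<open>M\<close> only serves to make the covering sets of the image small when the
  cubes are small.
\<close>

lemma hausdorff_outer_image_le: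
  fixes f :: "real ^ 'n \<Rightarrow> 'a::metric_space"
  assumes S: "bounded S" "S \<in> lmeasurable" and "r > 0" "C \<ge> 0" "M > 0"
    and small: "\<And>u s. 0 < s \<Longrightarrow> s < r \<Longrightarrow>
      hausdorff_pre n (M * s) (f ` (S \<inter> cube u s)) \<le> ennreal (C * s ^ CARD('n))"
  shows "hausdorff_outer n (f ` S) \<le> ennreal (C * measure lebesgue S)"
  unfolding hausdorff_outer_eq_SUP
proof (rule SUP_least)
  fix \<delta> :: real assume "\<delta> \<in> {0<..}"
  then have \<delta>: "\<delta> > 0" by simp
  show "hausdorff_pre n \<delta> (f ` S) \<le> ennreal (C * measure lebesgue S)"
  proof (rule ennreal_le_epsilon)
    fix \<epsilon> :: real assume "0 < \<epsilon>"
    \<comment> \<open>The denominator \<open>C + 1\<close> avoids a division by zero for \<open>C = 0\<close>.\<close>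
    define \<epsilon>' where "\<epsilon>' = \<epsilon> / (C + 1)"
    have \<epsilon>': "\<epsilon>' > 0" "C * \<epsilon>' \<le> \<epsilon>" using \<open>C \<ge> 0\<close> \<open>0 < \<epsilon>\<close> by (auto simp: \<epsilon>'_def field_simps)
    obtain U where U0: "open U" "S \<subseteq> U" "U - S \<in> lmeasurable" "emeasure lebesgue (U - S) < ennreal \<epsilon>'"
      using sets_lebesgue_outer_open[of S \<epsilon>'] S \<epsilon>'(1) by (blast intro: fmeasurableD)
    have U: "U \<in> lmeasurable" using fmeasurable.Un[OF S(2) U0(3)] U0(2) by (simp add: Un_absorb1)
    have "measure lebesgue U \<le> measure lebesgue S + measure lebesgue (U - S)"
      using measure_Un_le[of S lebesgue "U - S"] S(2) U0 by (simp add: Un_absorb1 fmeasurableD)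
    also have "measure lebesgue (U - S) \<le> \<epsilon>'"
      using U0(3,4) \<epsilon>'(1) by (simp add: emeasure_eq_measure2 ennreal_less_iff)
    finally have mU: "measure lebesgue U \<le> measure lebesgue S + \<epsilon>'" by simp
    define r' where "r' = min r (\<delta> / M)"
    have r': "r' > 0" "r' \<le> r" "\<And>s. s < r' \<Longrightarrow> M * s \<le> \<delta>"
      using \<open>r > 0\<close> \<delta> \<open>M > 0\<close> by (auto simp: r'_def field_simps)
    obtain \<K> where K: "countable \<K>" "S \<subseteq> (\<Union>(u, s)\<in>\<K>. cube u s)"
      "\<And>u s. (u, s) \<in> \<K> \<Longrightarrow> 0 < s \<and> s < r' \<and> cube u s \<subseteq> U"
      "pairwise (\<lambda>k k'. interior (cube (fst k) (snd k)) \<inter> interior (cube (fst k') (snd k')) = {}) \<K>"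
      by (rule cube_cover[OF S(1) U0(1,2) r'(1)]) (rule that; assumption)
    have "f ` S \<subseteq> (\<Union>k\<in>\<K>. f ` (S \<inter> cube (fst k) (snd k)))"
    proof (rule image_subsetI)
      fix x assume x: "x \<in> S"
      then obtain k where "k \<in> \<K>" "x \<in> cube (fst k) (snd k)" using K(2) by (auto simp: case_prod_beta)
      then show "f x \<in> (\<Union>k\<in>\<K>. f ` (S \<inter> cube (fst k) (snd k)))" using x by blast
    qed
    then have "hausdorff_pre n \<delta> (f ` S) \<le> hausdorff_pre n \<delta> (\<Union>k\<in>\<K>. f ` (S \<inter> cube (fst k) (snd k)))"
      by (rule hausdorff_pre_mono)
    also have "\<dots> \<le> ennreal (C * measure lebesgue U)"
    proof (rule hausdorff_pre_countable_UN_le[OF K(1), where c = "\<lambda>k. ennreal (C * snd k ^ CARD('n))"])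
      show "0 \<le> \<delta>" using \<delta> by simp
      fix \<F> assume F: "finite \<F>" "\<F> \<subseteq> \<K>"
      have "(\<Sum>k\<in>\<F>. ennreal (C * snd k ^ CARD('n))) = ennreal (\<Sum>k\<in>\<F>. C * snd k ^ CARD('n))"
        using F K(3) \<open>C \<ge> 0\<close> by (intro sum_ennreal) (fastforce intro: mult_nonneg_nonneg)
      also have "(\<Sum>k\<in>\<F>. C * snd k ^ CARD('n)) = C * (\<Sum>(u, s)\<in>\<F>. s ^ CARD('n))"
        by (simp add: sum_distrib_left case_prod_beta)
      also have "\<dots> \<le> C * measure lebesgue U"
        using F K(3) \<open>C \<ge> 0\<close> pairwise_subset[OF K(4) F(2)]
        by (intro mult_left_mono sum_measure_cubes_le U) auto
      finally show "(\<Sum>k\<in>\<F>. ennreal (C * snd k ^ CARD('n))) \<le> ennreal (C * measure lebesgue U)"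
        by (simp add: ennreal_leI)
    next
      fix k assume "k \<in> \<K>"
      then have k: "0 < snd k" "snd k < r'" using K(3)[of "fst k" "snd k"] by auto
      have "hausdorff_pre n \<delta> (f ` (S \<inter> cube (fst k) (snd k))) \<le>
          hausdorff_pre n (M * snd k) (f ` (S \<inter> cube (fst k) (snd k)))"
        using r'(3)[OF k(2)] by (rule hausdorff_pre_antimono)
      also have "\<dots> \<le> ennreal (C * snd k ^ CARD('n))" using k r'(2) by (intro small) auto
      finally show "hausdorff_pre n \<delta> (f ` (S \<inter> cube (fst k) (snd k))) \<le> ennreal (C * snd k ^ CARD('n))" .
    qed
    also have "C * measure lebesgue U \<le> C * measure lebesgue S + \<epsilon>"
      using mult_left_mono[OF mU \<open>C \<ge> 0\<close>] \<epsilon>'(2) by (simp add: distrib_left)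
    then have "ennreal (C * measure lebesgue U) \<le> ennreal (C * measure lebesgue S) + ennreal \<epsilon>"
      using \<open>C \<ge> 0\<close> \<open>0 < \<epsilon>\<close> by (simp flip: ennreal_plus add: ennreal_leI)
    finally show "hausdorff_pre n \<delta> (f ` S) \<le> ennreal (C * measure lebesgue S) + ennreal \<epsilon>" .
  qed
qed

lemma hausdorff_pre_small_diameter_le:
  assumes "\<And>x y. x \<in> E \<Longrightarrow> y \<in> E \<Longrightarrow> dist x y \<le> d" "0 \<le> d" "d \<le> \<delta>"
  shows "hausdorff_pre n \<delta> E \<le> ennreal (unit_ball_vol (real n) / 2 ^ n * d ^ n)"
proof -
  have b: "bounded E"
    unfolding bounded_any_center[where a = "SOME x. x \<in> E"] using assms(1) someI[of "\<lambda>x. x \<in> E"] by blast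
  have dm: "diameter E \<le> d" using assms by (auto simp: diameter_def intro!: cSUP_least)
  have "hausdorff_pre n \<delta> E \<le> hausdorff_gauge n E"
    using b dm assms by (intro hausdorff_pre_le_gauge) auto
  also have "\<dots> \<le> ennreal (unit_ball_vol (real n) / 2 ^ n * d ^ n)"
    by (rule hausdorff_gauge_le[OF dm b assms(2)])
  finally show ?thesis .
qed

section \<open>Images of null sets and of flat points\<close>

text \<open>
  A Lipschitz map takes a cube of side \<open>s\<close> to a set of diameter \<open>O(s)\<close>.
\<close>

lemma hausdorff_outer_lipschitz_image_negligible:
  fixes f :: "real ^ 'n \<Rightarrow> 'a::metric_space"
  assumes lip: "L-lipschitz_on B f" and "S \<subseteq> B" "bounded S" "negligible S"
  shows "hausdorff_outer CARD('n) (f ` S) = 0"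
proof -
  define K where "K = (L + 1) * real CARD('n)"
  have L: "L \<ge> 0" using lip by (rule lipschitz_on_nonneg)
  have "0 < real CARD('n)" by simp
  then have K: "K > 0" using L unfolding K_def by (intro mult_pos_pos) auto
  have S: "S \<in> lmeasurable" "measure lebesgue S = 0"
    using assms(4) by (auto simp: negligible_iff_measure)
  have "hausdorff_outer CARD('n) (f ` S) \<le> ennreal (unit_ball_vol (real CARD('n)) / 2 ^ CARD('n) * K ^ CARD('n) * measure lebesgue S)"
  proof (rule hausdorff_outer_image_le[OF assms(3) S(1) zero_less_one _ K])
    fix u :: "real ^ 'n" and s :: real assume s: "0 < s"
    have "dist (f x) (f y) \<le> K * s" if xy: "x \<in> S \<inter> cube u s" "y \<in> S \<inter> cube u s" for x y
    proof -
      have "dist (f x) (f y) \<le> L * dist x y" using xy assms(2) by (intro lipschitz_onD[OF lip]) auto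
      also have "\<dots> \<le> (L + 1) * (real CARD('n) * s)"
        using cube_dist_le[of x u s y] xy L by (intro mult_mono) auto
      finally show ?thesis by (simp add: K_def mult.assoc)
    qed
    then have "hausdorff_pre CARD('n) (K * s) (f ` (S \<inter> cube u s)) \<le>
        ennreal (unit_ball_vol (real CARD('n)) / 2 ^ CARD('n) * (K * s) ^ CARD('n))"
      using K s by (intro hausdorff_pre_small_diameter_le) auto
    then show "hausdorff_pre CARD('n) (K * s) (f ` (S \<inter> cube u s)) \<le>
        ennreal (unit_ball_vol (real CARD('n)) / 2 ^ CARD('n) * K ^ CARD('n) * s ^ CARD('n))"
      by (simp add: power_mult_distrib mult.assoc)
  qed (use K in auto)
  then show ?thesis by (simp add: S(2))
qed

lemma unit_vector_large_component:
  fixes v :: "real ^ 'n"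
  assumes "norm v = 1"
  obtains i where "1 / real CARD('n) \<le> \<bar>v $ i\<bar>"
proof -
  have "\<exists>i. 1 / real CARD('n) \<le> \<bar>v $ i\<bar>"
  proof (rule ccontr)
    assume "\<nexists>i. 1 / real CARD('n) \<le> \<bar>v $ i\<bar>"
    then have "(\<Sum>i\<in>UNIV. \<bar>v $ i\<bar>) < (\<Sum>i\<in>(UNIV :: 'n set). 1 / real CARD('n))"
      by (intro sum_strict_mono) (auto simp: not_le)
    also have "\<dots> = 1" by simp
    finally show False using norm_le_l1_cart[of v] assms by simp
  qed
  then show ?thesis using that by blast
qed

text \<open>
  The projection along \<open>v\<close> to the coordinate hyperplane \<open>x $ i = 0\<close>.
\<close>

definition project_along :: "real ^ 'n \<Rightarrow> 'n \<Rightarrow> real ^ 'n \<Rightarrow> real ^ 'n" where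
  "project_along v i x = x - (x $ i / v $ i) *\<^sub>R v"

text \<open>
  Cuts the cube with corner \<open>u\<close> and side \<open>s\<close> into tubes parallel to \<open>v\<close>: the projection of the cube
  along \<open>v\<close> is divided into cubes of side \<open>s / m\<close>, numbered by integer vectors.
\<close>

definition tube_index :: "real ^ 'n \<Rightarrow> 'n \<Rightarrow> real ^ 'n \<Rightarrow> real \<Rightarrow> nat \<Rightarrow> real ^ 'n \<Rightarrow> 'n \<Rightarrow> int" where
  "tube_index v i u s m x j = \<lfloor>(project_along v i x $ j - project_along v i u $ j) * real m / s\<rfloor>"

text \<open>
  The coordinate \<open>i\<close> of the projection vanishes, which gives the exponent \<open>n - 1\<close> instead of \<open>n\<close>;
  the gain of one power of \<open>m\<close> is what makes images of flat points null. Since \<open>\<bar>v $ i\<bar> \<ge> 1 / n\<close>,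
  the other coordinates of the projection vary by at most \<open>(n + 1) * s\<close> from the value at \<open>u\<close>.
\<close>

lemma finite_tube_index:
  fixes v :: "real ^ 'n"
  assumes v: "norm v = 1" "1 / real CARD('n) \<le> \<bar>v $ i\<bar>" and "0 < s" "0 < m"
  shows "finite (tube_index v i u s m ` cube u s)"
    and "card (tube_index v i u s m ` cube u s) \<le> (2 * (CARD('n) + 1) * m + 1) ^ (CARD('n) - 1)"
proof -
  let ?n = "CARD('n)"
  define A where "A = {- (int (?n + 1) * int m) .. int (?n + 1) * int m}"
  define P where "P = PiE (UNIV :: 'n set) (\<lambda>j. if j = i then {0} else A)"
  have vi: "v $ i \<noteq> 0" using v(2) by auto
  have "tube_index v i u s m x \<in> P" if x: "x \<in> cube u s" for x
  proof -
    have "tube_index v i u s m x j \<in> (if j = i then {0} else A)" for j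
    proof (cases "j = i")
      case True
      then show ?thesis using vi by (simp add: tube_index_def project_along_def)
    next
      case False
      have "\<bar>v $ j\<bar> \<le> 1" using component_le_norm_cart[of v j] v(1) by simp
      have q: "\<bar>v $ j / v $ i\<bar> \<le> real ?n"
      proof -
        have "\<bar>v $ j\<bar> \<le> real ?n * \<bar>v $ i\<bar>"
        proof -
          have "1 \<le> real ?n * \<bar>v $ i\<bar>" using v(2) by (simp add: field_simps)
          then show ?thesis using \<open>\<bar>v $ j\<bar> \<le> 1\<close> by linarith
        qed
        then show ?thesis using vi by (simp add: abs_divide divide_le_eq)
      qed
      have xu: "\<bar>x $ j - u $ j\<bar> \<le> s" "\<bar>x $ i - u $ i\<bar> \<le> s" using x by (auto simp: cube_def abs_le_iff) (smt (verit))+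
      define w where "w = project_along v i x $ j - project_along v i u $ j"
      have "w = (x $ j - u $ j) - (x $ i - u $ i) * (v $ j / v $ i)"
        by (simp add: w_def project_along_def diff_divide_distrib left_diff_distrib)
      then have "\<bar>w\<bar> \<le> \<bar>x $ j - u $ j\<bar> + \<bar>x $ i - u $ i\<bar> * \<bar>v $ j / v $ i\<bar>"
        using abs_triangle_ineq4[of "x $ j - u $ j" "(x $ i - u $ i) * (v $ j / v $ i)"]
        by (simp only: abs_mult)
      also have "\<dots> \<le> s + s * real ?n"
        using xu q assms(3) by (intro add_mono mult_mono) auto
      finally have w: "\<bar>w\<bar> \<le> s * real (?n + 1)" by (simp add: algebra_simps)
      have "\<bar>w * real m / s\<bar> = \<bar>w\<bar> * real m / s" using assms(3) by (simp add: abs_mult abs_divide)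
      also have "\<dots> \<le> s * real (?n + 1) * real m / s"
        using w assms(3) by (intro divide_right_mono mult_right_mono) auto
      also have "\<dots> = real_of_int (int (?n + 1) * int m)" using assms(3) by simp
      finally have "\<bar>w * real m / s\<bar> \<le> real_of_int (int (?n + 1) * int m)" .
      then have "w * real m / s \<le> real_of_int (int (?n + 1) * int m)"
        "real_of_int (- (int (?n + 1) * int m)) \<le> w * real m / s" unfolding of_int_minus by linarith+
      then have "\<lfloor>w * real m / s\<rfloor> \<in> A" unfolding A_def by (simp add: le_floor_iff floor_le_iff)
      then show ?thesis using False by (simp add: tube_index_def w_def)
    qed
    then show ?thesis by (auto simp: P_def)
  qed
  then have sub: "tube_index v i u s m ` cube u s \<subseteq> P" by blast
  have finP: "finite P" unfolding P_def by (rule finite_PiE) (auto simp: A_def)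
  then show "finite (tube_index v i u s m ` cube u s)" using sub finite_subset by blast
  have cA: "card A = 2 * (?n + 1) * m + 1"
    unfolding A_def by (simp add: nat_add_distrib nat_mult_distrib algebra_simps)
  have "card (tube_index v i u s m ` cube u s) \<le> card P" using sub finP by (rule card_mono[rotated])
  also have "card P = (\<Prod>j\<in>UNIV. card (if j = i then {0} else A))"
    unfolding P_def by (rule card_PiE) simp
  also have "\<dots> = (\<Prod>j\<in>UNIV - {i}. card A)"
    by (subst prod.remove[of _ i]) (auto intro!: prod.cong)
  also have "\<dots> = (2 * (?n + 1) * m + 1) ^ (?n - 1)"
    by (simp add: cA card_Diff_singleton)
  finally show "card (tube_index v i u s m ` cube u s) \<le> (2 * (?n + 1) * m + 1) ^ (?n - 1)" .
qed

text \<open>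
  Equal indices mean that the projections along \<open>v\<close> differ by at most \<open>s / m\<close> in each coordinate,
  and points with the same projection differ by a multiple of \<open>v\<close>, which is read off from the
  coordinate \<open>i\<close>.
\<close>

lemma same_tube_diff:
  fixes v :: "real ^ 'n"
  assumes v: "norm v = 1" "1 / real CARD('n) \<le> \<bar>v $ i\<bar>" and "0 < s" "0 < m"
    and xy: "x \<in> cube u s" "y \<in> cube u s" "tube_index v i u s m x = tube_index v i u s m y"
  shows "\<bar>(y $ i - x $ i) / v $ i\<bar> \<le> real CARD('n) * s"
    and "dist y (x + ((y $ i - x $ i) / v $ i) *\<^sub>R v) \<le> real CARD('n) * (s / real m)"
proof -
  have vi: "v $ i \<noteq> 0" using v(2) by auto
  have "1 \<le> real CARD('n) * \<bar>v $ i\<bar>" using v(2) by (simp add: field_simps)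
  moreover have d: "\<bar>y $ i - x $ i\<bar> \<le> s" using xy by (auto simp: cube_def abs_le_iff) (smt (verit))+
  ultimately have "1 * \<bar>y $ i - x $ i\<bar> \<le> real CARD('n) * \<bar>v $ i\<bar> * s"
    using assms(3) by (intro mult_mono) auto
  then show "\<bar>(y $ i - x $ i) / v $ i\<bar> \<le> real CARD('n) * s"
    using vi by (simp add: abs_divide divide_le_eq mult.commute mult.left_commute)
  show "dist y (x + ((y $ i - x $ i) / v $ i) *\<^sub>R v) \<le> real CARD('n) * (s / real m)"
  proof (rule dist_cart_le)
    fix j
    define P where "P = (\<lambda>x. project_along v i x $ j)"
    have "\<lfloor>(P x - P u) * real m / s\<rfloor> = \<lfloor>(P y - P u) * real m / s\<rfloor>"
      using fun_cong[OF xy(3), of j] by (simp add: tube_index_def P_def)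
    then have "\<bar>(P y - P u) * real m / s - (P x - P u) * real m / s\<bar> < 1"
      by linarith
    also have "(P y - P u) * real m / s - (P x - P u) * real m / s = (P y - P x) * (real m / s)"
      by (simp add: diff_divide_distrib[symmetric] left_diff_distrib[symmetric])
    finally have "\<bar>P y - P x\<bar> * (real m / s) < 1" using assms(3) by (simp add: abs_mult)
    then have "\<bar>P y - P x\<bar> \<le> s / real m" using assms(3,4) by (simp add: field_simps)
    moreover have "y $ j - (x + ((y $ i - x $ i) / v $ i) *\<^sub>R v) $ j = P y - P x"
      by (simp add: P_def project_along_def field_simps diff_divide_distrib)
    ultimately show "\<bar>y $ j - (x + ((y $ i - x $ i) / v $ i) *\<^sub>R v) $ j\<bar> \<le> s / real m" by simp
  qed
qed

definition flat_at_scale :: "'v::real_normed_vector set \<Rightarrow> ('v \<Rightarrow> 'a::metric_space) \<Rightarrow> 'v \<Rightarrow> real \<Rightarrow> real \<Rightarrow> 'v set" where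
  "flat_at_scale B f v a \<delta> = {x \<in> B. \<forall>t. 0 \<le> t \<and> t \<le> \<delta> \<longrightarrow>
     x + t *\<^sub>R v \<in> B \<and> dist (f x) (f (x + t *\<^sub>R v)) \<le> a * t}"

text \<open>
  Go from \<open>x\<close> in the direction \<open>v\<close>, where \<open>f\<close> moves with speed at most \<open>a\<close>, to the level of \<open>y\<close>, and
  then across the tube, whose width is at most of the order of \<open>a * s\<close>. Flatness is only known in
  the forward direction, so one starts from the point that lies behind the other.
\<close>

lemma dist_in_flat_tube:
  fixes f :: "real ^ 'n \<Rightarrow> 'a::metric_space"
  assumes lip: "L-lipschitz_on B f" and v: "norm v = 1" "1 / real CARD('n) \<le> \<bar>v $ i\<bar>"
    and s: "0 < s" "real CARD('n) * s \<le> \<delta>" and m: "0 < m" "1 / real m \<le> a"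
    and x: "x \<in> flat_at_scale B f v a \<delta>" "x \<in> cube u s"
    and y: "y \<in> flat_at_scale B f v a \<delta>" "y \<in> cube u s"
    and same: "tube_index v i u s m x = tube_index v i u s m y"
  shows "dist (f x) (f y) \<le> (L + 1) * real CARD('n) * a * s"
proof -
  have L: "L \<ge> 0" using lip by (rule lipschitz_on_nonneg)
  have a: "0 \<le> a" using m by (meson divide_nonneg_nonneg of_nat_0_le_iff order_trans zero_le_one)
  have one: "dist (f x) (f y) \<le> (L + 1) * real CARD('n) * a * s"
    if x: "x \<in> flat_at_scale B f v a \<delta>" "x \<in> cube u s"
      and y: "y \<in> flat_at_scale B f v a \<delta>" "y \<in> cube u s"
      and same: "tube_index v i u s m x = tube_index v i u s m y"
      and pos: "0 \<le> (y $ i - x $ i) / v $ i" for x y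
  proof -
    define t where "t = (y $ i - x $ i) / v $ i"
    have "\<bar>t\<bar> \<le> real CARD('n) * s"
      unfolding t_def by (rule same_tube_diff(1)[OF v s(1) m(1) x(2) y(2) same])
    then have t: "0 \<le> t" "t \<le> real CARD('n) * s" using pos by (simp_all add: t_def[symmetric])
    have dt: "dist y (x + t *\<^sub>R v) \<le> real CARD('n) * (s / real m)"
      using same_tube_diff(2)[OF v s(1) m(1) x(2) y(2) same] by (simp add: t_def)
    have zB: "x + t *\<^sub>R v \<in> B" "dist (f x) (f (x + t *\<^sub>R v)) \<le> a * t"
      using x(1) t s(2) by (auto simp: flat_at_scale_def)
    have "dist (f x) (f y) \<le> dist (f x) (f (x + t *\<^sub>R v)) + dist (f y) (f (x + t *\<^sub>R v))"
      by (rule dist_triangle2)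
    also have "\<dots> \<le> a * t + L * dist y (x + t *\<^sub>R v)"
      using zB y(1) by (intro add_mono lipschitz_onD[OF lip]) (auto simp: flat_at_scale_def)
    also have "\<dots> \<le> a * (real CARD('n) * s) + L * (real CARD('n) * (s * a))"
    proof (intro add_mono mult_left_mono)
      have "s * (1 / real m) \<le> s * a" using m s(1) by (intro mult_left_mono) auto
      then have "real CARD('n) * (s / real m) \<le> real CARD('n) * (s * a)" by (intro mult_left_mono) auto
      then show "dist y (x + t *\<^sub>R v) \<le> real CARD('n) * (s * a)" using dt by linarith
    qed (use t a L in auto)
    also have "\<dots> = (L + 1) * real CARD('n) * a * s" by (simp add: algebra_simps)
    finally show ?thesis .
  qed
  show ?thesis
  proof (cases "0 \<le> (y $ i - x $ i) / v $ i")
    case True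
    then show ?thesis using one x y same by blast
  next
    case False
    then have "0 \<le> (x $ i - y $ i) / v $ i"
      by (metis linear minus_diff_eq minus_divide_left neg_0_le_iff_le)
    then have "dist (f y) (f x) \<le> (L + 1) * real CARD('n) * a * s" using one x y same by metis
    then show ?thesis by (simp add: dist_commute)
  qed
qed

text \<open>
  With \<open>m\<close> about \<open>1 / a\<close>, a cube of side \<open>s\<close> consists of \<open>O(a powr (1 - n))\<close> tubes whose flat parts
  have images of diameter \<open>O(a * s)\<close>, so the \<open>n\<close>-dimensional content of the image is \<open>O(a * s ^ n)\<close>.
\<close>

lemma hausdorff_outer_flat_at_scale_le:
  fixes f :: "real ^ 'n \<Rightarrow> 'a::metric_space"
  assumes lip: "L-lipschitz_on B f" and v: "norm v = 1" and a: "0 < a" "a \<le> 1" and "\<delta> > 0"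
    and S: "S \<subseteq> flat_at_scale B f v a \<delta>" "bounded S" "S \<in> lmeasurable"
  shows "hausdorff_outer CARD('n) (f ` S) \<le> ennreal (a *
      ((4 * real CARD('n) + 5) ^ (CARD('n) - 1) * (unit_ball_vol (real CARD('n)) / 2 ^ CARD('n) *
        ((L + 1) * real CARD('n)) ^ CARD('n))) * measure lebesgue S)"
proof -
  let ?n = "CARD('n)" and ?\<omega> = "unit_ball_vol (real CARD('n)) / 2 ^ CARD('n)"
  define M where "M = (L + 1) * real ?n"
  have L: "L \<ge> 0" using lip by (rule lipschitz_on_nonneg)
  have n: "0 < real ?n" "0 < ?n" by simp_all
  then have M: "M > 0" unfolding M_def using L by (intro mult_pos_pos) auto
  have \<omega>: "0 \<le> ?\<omega>" by simp
  obtain i where i: "1 / real ?n \<le> \<bar>v $ i\<bar>" using unit_vector_large_component[OF v] .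
  \<comment> \<open>The tubes get width \<open>s / m \<le> a * s\<close>, in proportion to the movement of \<open>f\<close> along them.\<close>
  define m where "m = nat \<lceil>1 / a\<rceil>"
  have m1: "1 / a \<le> real m" "real m \<le> 1 / a + 1" unfolding m_def using a by (auto simp: of_nat_ceiling)
  have "1 \<le> 1 / a" using a by simp
  then have "0 < real m" and m2: "real m \<le> 2 / a" using m1 by linarith+
  then have m0: "0 < m" by simp
  have ma: "1 / real m \<le> a" using m1(1) a m0 by (simp add: field_simps)
  define c where "c = (2 * (?n + 1) * m + 1) ^ (?n - 1)"
  have c: "real c * a ^ ?n \<le> a * (4 * real ?n + 5) ^ (?n - 1)"
  proof -
    have "real (2 * (?n + 1) * m + 1) \<le> (4 * real ?n + 5) / a"
    proof -
      have "real (2 * (?n + 1) * m + 1) = (2 * real ?n + 2) * real m + 1" by (simp add: algebra_simps)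
      also have "\<dots> \<le> (2 * real ?n + 2) * (2 / a) + 1 / a"
        using m2 \<open>1 \<le> 1 / a\<close> by (intro add_mono mult_left_mono) auto
      also have "\<dots> = (4 * real ?n + 5) / a" by (simp add: add_divide_distrib algebra_simps)
      finally show ?thesis .
    qed
    then have "real c \<le> ((4 * real ?n + 5) / a) ^ (?n - 1)"
      unfolding c_def of_nat_power by (intro power_mono) auto
    then have "real c * a ^ ?n \<le> ((4 * real ?n + 5) / a) ^ (?n - 1) * a ^ ?n"
      using a by (intro mult_right_mono) auto
    also have "\<dots> = ((4 * real ?n + 5) / a) ^ (?n - 1) * (a * a ^ (?n - 1))"
      using power_minus_mult[OF n(2), of a] by (simp add: mult.commute)
    also have "\<dots> = a * (4 * real ?n + 5) ^ (?n - 1)"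
      using a by (simp add: power_divide)
    finally show ?thesis .
  qed
  have "hausdorff_outer ?n (f ` S) \<le>
      ennreal (a * ((4 * real ?n + 5) ^ (?n - 1) * (?\<omega> * M ^ ?n)) * measure lebesgue S)"
  proof (rule hausdorff_outer_image_le[OF S(2,3) divide_pos_pos[OF \<open>\<delta> > 0\<close> n(1)] _ M])
    show "0 \<le> a * ((4 * real ?n + 5) ^ (?n - 1) * (?\<omega> * M ^ ?n))" using a M by auto
    fix u :: "real ^ 'n" and s :: real assume s: "0 < s" "s < \<delta> / real ?n"
    have s\<delta>: "real ?n * s \<le> \<delta>" using s n(1) by (simp add: field_simps)
    let ?\<iota> = "tube_index v i u s m"
    define I where "I = ?\<iota> ` cube u s"
    have I: "finite I" "card I \<le> c"
      unfolding I_def c_def using finite_tube_index[OF v i s(1) m0] by auto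
    have "f ` (S \<inter> cube u s) = (\<Union>k\<in>I. f ` {x \<in> S \<inter> cube u s. ?\<iota> x = k})"
      by (auto simp: I_def)
    then have "hausdorff_pre ?n (M * s) (f ` (S \<inter> cube u s)) \<le>
        hausdorff_pre ?n (M * s) (\<Union>k\<in>I. f ` {x \<in> S \<inter> cube u s. ?\<iota> x = k})" by simp
    also have "\<dots> \<le> of_nat (card I) * ennreal (?\<omega> * (M * a * s) ^ ?n)"
    proof (rule hausdorff_pre_finite_UN_le[OF I(1)])
      show "0 \<le> M * s" using M s by simp
      fix k assume "k \<in> I"
      show "hausdorff_pre ?n (M * s) (f ` {x \<in> S \<inter> cube u s. ?\<iota> x = k}) \<le> ennreal (?\<omega> * (M * a * s) ^ ?n)"
      proof (rule hausdorff_pre_small_diameter_le)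
        fix p q assume "p \<in> f ` {x \<in> S \<inter> cube u s. ?\<iota> x = k}" "q \<in> f ` {x \<in> S \<inter> cube u s. ?\<iota> x = k}"
        then obtain x y where xy: "p = f x" "q = f y" "x \<in> S" "y \<in> S" "x \<in> cube u s" "y \<in> cube u s" "?\<iota> x = ?\<iota> y"
          by auto
        then show "dist p q \<le> M * a * s"
          unfolding M_def xy(1,2) using S(1)
          by (intro dist_in_flat_tube[OF lip v i s(1) s\<delta> m0 ma]) auto
      next
        show "0 \<le> M * a * s" using M a s by simp
        have "M * a * s \<le> M * 1 * s" using M a s by (intro mult_right_mono mult_left_mono) auto
        then show "M * a * s \<le> M * s" by simp
      qed
    qed
    also have "\<dots> \<le> of_nat c * ennreal (?\<omega> * (M * a * s) ^ ?n)"
      using I(2) by (intro mult_right_mono) auto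
    also have "\<dots> = ennreal (real c * (?\<omega> * (M * a * s) ^ ?n))"
      using M a s by (subst ennreal_mult) (auto simp: ennreal_of_nat_eq_real_of_nat)
    also have "\<dots> \<le> ennreal (a * ((4 * real ?n + 5) ^ (?n - 1) * (?\<omega> * M ^ ?n)) * s ^ ?n)"
    proof (rule ennreal_leI)
      have "real c * (?\<omega> * (M * a * s) ^ ?n) = (real c * a ^ ?n) * (?\<omega> * M ^ ?n * s ^ ?n)"
        by (simp add: power_mult_distrib)
      also have "\<dots> \<le> (a * (4 * real ?n + 5) ^ (?n - 1)) * (?\<omega> * M ^ ?n * s ^ ?n)"
        using M s by (intro mult_right_mono c) auto
      finally show "real c * (?\<omega> * (M * a * s) ^ ?n) \<le> a * ((4 * real ?n + 5) ^ (?n - 1) * (?\<omega> * M ^ ?n)) * s ^ ?n"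
        by (simp add: mult.assoc)
    qed
    finally show "hausdorff_pre ?n (M * s) (f ` (S \<inter> cube u s)) \<le>
      ennreal (a * ((4 * real ?n + 5) ^ (?n - 1) * (?\<omega> * M ^ ?n)) * s ^ ?n)" .
  qed
  then show ?thesis by (simp add: M_def)
qed

lemma hausdorff_outer_mono: "E \<subseteq> F \<Longrightarrow> hausdorff_outer n E \<le> hausdorff_outer n F"
  unfolding hausdorff_outer_eq_SUP by (intro SUP_mono' hausdorff_pre_mono)

lemma hausdorff_outer_UN_le:
  fixes E :: "nat \<Rightarrow> 'a::metric_space set"
  shows "hausdorff_outer n (\<Union>i. E i) \<le> (\<Sum>i. hausdorff_outer n (E i))"
  unfolding hausdorff_outer_eq_SUP[of n "\<Union>i. E i"]
proof (rule SUP_least)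
  fix \<delta> :: real assume "\<delta> \<in> {0<..}"
  then have "(\<Sum>i. hausdorff_pre n \<delta> (E i)) \<le> (\<Sum>i. hausdorff_outer n (E i))"
    by (intro suminf_le) (auto simp: hausdorff_outer_eq_SUP intro: SUP_upper)
  then show "hausdorff_pre n \<delta> (\<Union>i. E i) \<le> (\<Sum>i. hausdorff_outer n (E i))"
    using hausdorff_pre_subadditive order_trans by blast
qed

lemma hausdorff_outer_empty [simp]: "hausdorff_outer n {} = 0"
  by (simp add: hausdorff_outer_eq_SUP hausdorff_pre_empty)

lemma hausdorff_outer_null_UN:
  assumes "countable I" "\<And>i. i \<in> I \<Longrightarrow> hausdorff_outer n (E i) = 0"
  shows "hausdorff_outer n (\<Union>i\<in>I. E i) = 0"
proof (cases "I = {}")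
  case False
  then have "(\<Union>i\<in>I. E i) = (\<Union>k. E (from_nat_into I k))"
    using range_from_nat_into[OF False assms(1)] by (metis image_image)
  also have "hausdorff_outer n \<dots> \<le> (\<Sum>k. hausdorff_outer n (E (from_nat_into I k)))"
    by (rule hausdorff_outer_UN_le)
  also have "\<dots> = 0" using assms(2) from_nat_into[OF False] by simp
  finally show ?thesis by simp
qed simp

lemma hausdorff_outer_null_Un:
  assumes "hausdorff_outer n E = 0" "hausdorff_outer n F = 0"
  shows "hausdorff_outer n (E \<union> F) = 0"
  using hausdorff_outer_null_UN[of "{E, F}" n id] assms by auto

lemma open_Collect_less_on:
  fixes p q :: "'v::topological_space \<Rightarrow> real"
  assumes "open B" "continuous_on B p" "continuous_on B q"
  shows "open {x \<in> B. p x < q x}"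
proof -
  have "open (B \<inter> (\<lambda>x. q x - p x) -` {0<..})"
    by (intro continuous_open_preimage assms continuous_on_diff) auto
  moreover have "B \<inter> (\<lambda>x. q x - p x) -` {0<..} = {x \<in> B. p x < q x}" by auto
  ultimately show ?thesis by simp
qed

text \<open>
  Convexity of \<open>B\<close> reduces the condition on the segment to its endpoint, after which the failure of
  the estimate at a single \<open>t\<close> is an open condition.
\<close>

lemma flat_at_scale_borel:
  fixes f :: "'v::euclidean_space \<Rightarrow> 'a::metric_space"
  assumes "open B" "convex B" and cont: "continuous_on B f"
  shows "flat_at_scale B f v a \<delta> \<in> sets borel"
proof (cases "\<delta> \<ge> 0")
  case True
  define B' where "B' = B \<inter> (\<lambda>x. x + \<delta> *\<^sub>R v) -` B"
  have oB': "open B'"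
    unfolding B'_def by (intro open_Int open_vimage \<open>open B\<close>) (auto intro!: continuous_intros)
  have seg: "x + t *\<^sub>R v \<in> B" if "x \<in> B'" "0 \<le> t" "t \<le> \<delta>" for x t
  proof (cases "\<delta> = 0")
    case False
    have "(1 - t / \<delta>) *\<^sub>R x + (t / \<delta>) *\<^sub>R (x + \<delta> *\<^sub>R v) \<in> B"
      using that True False by (intro convexD[OF \<open>convex B\<close>]) (auto simp: B'_def)
    moreover have "(1 - t / \<delta>) *\<^sub>R x + (t / \<delta>) *\<^sub>R (x + \<delta> *\<^sub>R v) = x + t *\<^sub>R v"
      using False by (simp add: algebra_simps)
    ultimately show ?thesis by simp
  qed (use that in \<open>auto simp: B'_def\<close>)
  define U where "U = (\<Union>t\<in>{0..\<delta>}. {x \<in> B'. a * t < dist (f x) (f (x + t *\<^sub>R v))})"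
  have "open {x \<in> B'. a * t < dist (f x) (f (x + t *\<^sub>R v))}" if t: "t \<in> {0..\<delta>}" for t
  proof (rule open_Collect_less_on[OF oB'])
    have "continuous_on B' f" by (rule continuous_on_subset[OF cont]) (auto simp: B'_def)
    moreover have "continuous_on B' (\<lambda>x. f (x + t *\<^sub>R v))"
      by (rule continuous_on_compose2[OF cont]) (use seg t in \<open>auto intro!: continuous_intros\<close>)
    ultimately show "continuous_on B' (\<lambda>x. dist (f x) (f (x + t *\<^sub>R v)))" by (rule continuous_on_dist)
  qed simp
  then have "open U" unfolding U_def by (rule open_UN[OF ballI])
  moreover have "flat_at_scale B f v a \<delta> = B' - U"
  proof (intro equalityI subsetI)
    fix x assume x: "x \<in> flat_at_scale B f v a \<delta>"
    then have "x \<in> B'" using True by (auto simp: flat_at_scale_def B'_def)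
    moreover have "x \<notin> U" using x by (fastforce simp: flat_at_scale_def U_def)
    ultimately show "x \<in> B' - U" by simp
  next
    fix x assume x: "x \<in> B' - U"
    show "x \<in> flat_at_scale B f v a \<delta>"
      unfolding flat_at_scale_def
    proof (intro CollectI conjI allI impI)
      show "x \<in> B" using x by (auto simp: B'_def)
      fix t assume t: "0 \<le> t \<and> t \<le> \<delta>"
      then show "x + t *\<^sub>R v \<in> B" using seg x by blast
      have "x \<notin> {x \<in> B'. a * t < dist (f x) (f (x + t *\<^sub>R v))}" using x t by (auto simp: U_def)
      then show "dist (f x) (f (x + t *\<^sub>R v)) \<le> a * t" using x by auto
    qed
  qed
  ultimately show ?thesis using oB' by simp
next
  case False
  then have "flat_at_scale B f v a \<delta> = B" by (auto simp: flat_at_scale_def)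
  then show ?thesis using \<open>open B\<close> by simp
qed

lemma suminf_measure_disjoint_le:
  fixes A :: "nat \<Rightarrow> 'v::euclidean_space set"
  assumes "\<And>i. A i \<in> lmeasurable" "disjoint_family A" "(\<Union>i. A i) \<subseteq> B" "B \<in> lmeasurable"
  shows "(\<Sum>i. ennreal (measure lebesgue (A i))) \<le> ennreal (measure lebesgue B)"
proof -
  have "(\<Sum>i. ennreal (measure lebesgue (A i))) = (\<Sum>i. emeasure lebesgue (A i))"
    using assms(1) by (simp add: emeasure_eq_measure2)
  also have "\<dots> = emeasure lebesgue (\<Union>i. A i)"
    using assms(1,2) by (intro suminf_emeasure) (auto intro: fmeasurableD)
  also have "\<dots> \<le> emeasure lebesgue B"
    using assms(3,4) by (intro emeasure_mono) (auto intro: fmeasurableD)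
  finally show ?thesis using assms(4) by (simp add: emeasure_eq_measure2)
qed

text \<open>
  For fixed \<open>a\<close> the flat points are a countable union of sets flat at one scale in one direction.
  Made disjoint, these have total measure at most that of \<open>B\<close>, so the image has measure \<open>O(a)\<close>.
\<close>

lemma hausdorff_outer_flat_points_null:
  fixes f :: "real ^ 'n \<Rightarrow> 'a::metric_space"
  assumes B: "open B" "convex B" "bounded B" and lip: "L-lipschitz_on B f"
    and D: "countable D" "D \<subseteq> sphere 0 1"
  shows "hausdorff_outer CARD('n) (f ` flat_points B D f) = 0"
proof (cases "D = {}")
  case True
  then have "flat_points B D f = {}" by (auto simp: flat_points_def intro: exI[of _ 1])
  then show ?thesis by simp
next
  case False
  let ?n = "CARD('n)"
  define C where "C = (4 * real CARD('n) + 5) ^ (CARD('n) - 1) * (unit_ball_vol (real CARD('n)) / 2 ^ CARD('n) *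
        ((L + 1) * real CARD('n)) ^ CARD('n))"
  have L: "L \<ge> 0" using lip by (rule lipschitz_on_nonneg)
  then have C: "C \<ge> 0" by (simp add: C_def)
  have Bm: "B \<in> lmeasurable" using B by (intro bounded_set_imp_lmeasurable) auto
  have cont: "continuous_on B f" by (rule lipschitz_on_continuous_on[OF lip])
  have bound: "hausdorff_outer ?n (f ` flat_points B D f) \<le> ennreal (a * (C * measure lebesgue B))"
    if a: "0 < a" "a \<le> 1" for a
  proof -
    define I where "I = D \<times> (UNIV :: nat set)"
    have I: "countable I" "I \<noteq> {}" using D(1) False by (auto simp: I_def)
    define W where "W = (\<lambda>k. flat_at_scale B f (fst (from_nat_into I k)) a (1 / real (Suc (snd (from_nat_into I k)))))"
    have fn: "from_nat_into I k \<in> I" for k using from_nat_into[OF I(2)] .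
    have Wb: "W k \<in> sets borel" for k unfolding W_def by (rule flat_at_scale_borel[OF B(1,2) cont])
    have sub: "flat_points B D f \<subseteq> (\<Union>k. W k)"
    proof
      fix x assume x: "x \<in> flat_points B D f"
      then obtain v \<delta> where v: "v \<in> D" "\<delta> > 0" and fl: "\<And>t. 0 \<le> t \<Longrightarrow> t \<le> \<delta> \<Longrightarrow>
          x + t *\<^sub>R v \<in> B \<and> dist (f x) (f (x + t *\<^sub>R v)) \<le> a * t"
        using a(1) unfolding flat_points_def by blast
      obtain j where j: "1 / real (Suc j) < \<delta>" by (rule nat_approx_posE[OF v(2)])
      have "(v, j) \<in> I" using v by (simp add: I_def)
      then obtain k where k: "from_nat_into I k = (v, j)" using from_nat_into_surj[OF I(1)] by metis
      have "x \<in> B" using x by (simp add: flat_points_def)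
      then have "x \<in> W k" using fl j by (auto simp: W_def k flat_at_scale_def)
      then show "x \<in> (\<Union>k. W k)" by blast
    qed
    define V where "V = disjointed W"
    have V: "V k \<in> sets borel" "V k \<subseteq> W k" for k
      using sets.range_disjointed_sets[of W borel] Wb disjointed_subset[of W k] by (auto simp: V_def)
    have WB: "W k \<subseteq> B" for k by (auto simp: W_def flat_at_scale_def)
    have Vm: "V k \<in> lmeasurable" for k
      using V[of k] WB[of k] B(3) by (intro bounded_set_imp_lmeasurable) (auto intro: bounded_subset)
    have "flat_points B D f \<subseteq> (\<Union>k. V k)" unfolding V_def UN_disjointed_eq by (rule sub)
    then have "hausdorff_outer ?n (f ` flat_points B D f) \<le> hausdorff_outer ?n (\<Union>k. f ` V k)"
      by (intro hausdorff_outer_mono) blast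
    also have "\<dots> \<le> (\<Sum>k. hausdorff_outer ?n (f ` V k))" by (rule hausdorff_outer_UN_le)
    also have "\<dots> \<le> (\<Sum>k. ennreal (a * C) * ennreal (measure lebesgue (V k)))"
    proof (rule suminf_le)
      fix k
      have "fst (from_nat_into I k) \<in> D" using fn[of k] by (auto simp: I_def mem_Times_iff)
      then have nv: "norm (fst (from_nat_into I k)) = 1" using D(2) by auto
      have "hausdorff_outer ?n (f ` V k) \<le> ennreal (a * C * measure lebesgue (V k))"
        unfolding C_def
      proof (rule hausdorff_outer_flat_at_scale_le[OF lip nv a, of "1 / real (Suc (snd (from_nat_into I k)))"])
        show "V k \<subseteq> flat_at_scale B f (fst (from_nat_into I k)) a (1 / real (Suc (snd (from_nat_into I k))))"
          using V(2)[of k] unfolding W_def .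
        show "bounded (V k)" using V(2)[of k] WB[of k] B(3) by (meson bounded_subset order_trans)
      qed (simp_all add: Vm)
      then show "hausdorff_outer ?n (f ` V k) \<le> ennreal (a * C) * ennreal (measure lebesgue (V k))"
        using a C by (simp add: ennreal_mult)
    qed auto
    also have "\<dots> = ennreal (a * C) * (\<Sum>k. ennreal (measure lebesgue (V k)))" by simp
    also have "\<dots> \<le> ennreal (a * C) * ennreal (measure lebesgue B)"
    proof (intro mult_left_mono suminf_measure_disjoint_le Vm Bm)
      show "disjoint_family V" unfolding V_def by (rule disjoint_family_disjointed)
      show "(\<Union>i. V i) \<subseteq> B" using V(2) WB by blast
    qed simp
    also have "\<dots> = ennreal (a * (C * measure lebesgue B))"
      using a C by (simp add: ennreal_mult mult.assoc)
    finally show ?thesis .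
  qed
  define c where "c = C * measure lebesgue B"
  have c: "c \<ge> 0" using C by (simp add: c_def)
  have "hausdorff_outer ?n (f ` flat_points B D f) \<le> 0"
  proof (rule ennreal_le_epsilon)
    fix e :: real assume e: "0 < e"
    define a where "a = min 1 (e / (c + 1))"
    have a: "0 < a" "a \<le> 1" "a * c \<le> e"
    proof -
      show "0 < a" "a \<le> 1" using e c by (auto simp: a_def)
      have "a * c \<le> (e / (c + 1)) * c" using c by (intro mult_right_mono) (auto simp: a_def)
      also have "\<dots> \<le> e" using c e by (simp add: field_simps)
      finally show "a * c \<le> e" .
    qed
    have "hausdorff_outer ?n (f ` flat_points B D f) \<le> ennreal (a * c)"
      unfolding c_def by (rule bound[OF a(1,2)])
    also have "\<dots> \<le> ennreal e" using a(3) by (rule ennreal_leI)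
    finally show "hausdorff_outer ?n (f ` flat_points B D f) \<le> 0 + ennreal e" by simp
  qed
  then show ?thesis by simp
qed

section \<open>Decomposition into nearly isometric pieces\<close>

definition nearly_isometric_on :: "real \<Rightarrow> 'v set \<Rightarrow> ('v \<Rightarrow> 'a::metric_space) \<Rightarrow> ('v \<Rightarrow> 'b::metric_space) \<Rightarrow> bool" where
  "nearly_isometric_on \<epsilon> K f h \<longleftrightarrow>
     (\<forall>x\<in>K. \<forall>y\<in>K. \<bar>dist (f x) (f y) - dist (h x) (h y)\<bar> \<le> \<epsilon> * dist (f x) (f y))"

text \<open>
  The same \<open>c\<close> occurs in the lower bound and in the error, which makes the error at most
  \<open>\<epsilon> * dist (f x) (f z)\<close>.
\<close>

definition good_at_scale :: "real \<Rightarrow> 'v::metric_space set \<Rightarrow> ('v \<Rightarrow> 'a::metric_space) \<Rightarrow> ('v \<Rightarrow> 'b::metric_space) \<Rightarrow> real \<Rightarrow> real \<Rightarrow> 'v set" where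
  "good_at_scale \<epsilon> B f h c \<delta> = {x \<in> B. \<forall>z\<in>B. dist x z < \<delta> \<longrightarrow>
     c * dist x z \<le> dist (f x) (f z) \<and> \<bar>dist (f x) (f z) - dist (h x) (h z)\<bar> \<le> \<epsilon> * c * dist x z}"

text \<open>
  The conditions are closed in \<open>x\<close> because \<open>z\<close> ranges over all of \<open>B\<close> and \<open>dist x z < \<delta>\<close> is an open
  premise.
\<close>

lemma compact_good_at_scale:
  assumes "open B" and cont: "continuous_on B f" "continuous_on B h" and C: "compact C" "C \<subseteq> B"
  shows "compact (C \<inter> good_at_scale \<epsilon> B f h c \<delta>)"
proof -
  define U where "U = (\<lambda>z. {x \<in> B. dist x z < \<delta>} \<inter>
     ({x \<in> B. dist (f x) (f z) < c * dist x z} \<union>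
      {x \<in> B. \<epsilon> * c * dist x z < \<bar>dist (f x) (f z) - dist (h x) (h z)\<bar>}))"
  have "open (U z)" for z
    unfolding U_def
    by (intro open_Int open_Un open_Collect_less_on \<open>open B\<close> continuous_intros cont)
  then have "open (\<Union>z\<in>B. U z)" by auto
  moreover have "C \<inter> good_at_scale \<epsilon> B f h c \<delta> = C - (\<Union>z\<in>B. U z)"
    using C(2) unfolding good_at_scale_def U_def by (auto simp: not_less) 
  ultimately show ?thesis using C(1) by (simp add: compact_diff)
qed

lemma nearly_isometric_on_good_at_scale:
  assumes "K \<subseteq> good_at_scale \<epsilon> B f h c \<delta>" "\<And>x y. x \<in> K \<Longrightarrow> y \<in> K \<Longrightarrow> dist x y < \<delta>" "\<epsilon> \<ge> 0"
  shows "nearly_isometric_on \<epsilon> K f h"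
  unfolding nearly_isometric_on_def
proof (intro ballI)
  fix x y assume xy: "x \<in> K" "y \<in> K"
  then have "y \<in> B" using assms(1) by (auto simp: good_at_scale_def)
  then have "c * dist x y \<le> dist (f x) (f y)" "\<bar>dist (f x) (f y) - dist (h x) (h y)\<bar> \<le> \<epsilon> * c * dist x y"
    using assms(1,2) xy by (auto simp: good_at_scale_def)
  then show "\<bar>dist (f x) (f y) - dist (h x) (h y)\<bar> \<le> \<epsilon> * dist (f x) (f y)"
    using mult_left_mono[of "c * dist x y" "dist (f x) (f y)" \<epsilon>] \<open>\<epsilon> \<ge> 0\<close> by (simp add: mult.assoc)
qed

lemma good_at_scale_pieces:
  fixes f :: "'v::euclidean_space \<Rightarrow> 'a::metric_space" and h :: "'v \<Rightarrow> 'b::metric_space"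
  assumes "open B" and cont: "continuous_on B f" "continuous_on B h" and "\<delta> > 0" "\<epsilon> \<ge> 0"
  obtains \<K> where "countable \<K>" "\<And>K. K \<in> \<K> \<Longrightarrow> compact K \<and> K \<subseteq> B \<and> nearly_isometric_on \<epsilon> K f h"
    "good_at_scale \<epsilon> B f h c \<delta> \<subseteq> \<Union>\<K>"
proof -
  obtain C :: "nat \<Rightarrow> 'v set" where C: "\<And>m. compact (C m)" "\<And>m. C m \<subseteq> B" "(\<Union>m. C m) = B"
    using open_Union_compact_subsets[OF \<open>open B\<close>] by metis
  obtain Q :: "'v set" where Q: "countable Q" "\<And>X. open X \<Longrightarrow> X \<noteq> {} \<Longrightarrow> \<exists>q\<in>Q. q \<in> X"
    using countable_dense_setE by metis
  \<comment> \<open>Balls of radius \<open>\<delta> / 3\<close> have diameter below \<open>\<delta>\<close>.\<close>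
  define P where "P = (\<lambda>(m, q). (C m \<inter> good_at_scale \<epsilon> B f h c \<delta>) \<inter> cball q (\<delta> / 3))"
  show ?thesis
  proof (rule that[of "P ` (UNIV \<times> Q)"])
    show "countable (P ` (UNIV \<times> Q))" using Q(1) by simp
    fix K assume "K \<in> P ` (UNIV \<times> Q)"
    then obtain m q where K: "K = (C m \<inter> good_at_scale \<epsilon> B f h c \<delta>) \<inter> cball q (\<delta> / 3)"
      by (auto simp: P_def)
    have "compact K"
      unfolding K by (intro compact_Int compact_good_at_scale[OF \<open>open B\<close> cont C(1,2)]) simp
    moreover have "K \<subseteq> B" using K C(2) by blast
    moreover have "nearly_isometric_on \<epsilon> K f h"
    proof (rule nearly_isometric_on_good_at_scale[OF _ _ \<open>\<epsilon> \<ge> 0\<close>])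
      show "K \<subseteq> good_at_scale \<epsilon> B f h c \<delta>" using K by blast
      fix x y assume "x \<in> K" "y \<in> K"
      then have "dist q x \<le> \<delta> / 3" "dist q y \<le> \<delta> / 3" by (auto simp: K)
      then show "dist x y < \<delta>" using dist_triangle3[of x y q] \<open>\<delta> > 0\<close> by linarith
    qed
    ultimately show "compact K \<and> K \<subseteq> B \<and> nearly_isometric_on \<epsilon> K f h" by blast
  next
    show "good_at_scale \<epsilon> B f h c \<delta> \<subseteq> \<Union>(P ` (UNIV \<times> Q))"
    proof
      fix x assume x: "x \<in> good_at_scale \<epsilon> B f h c \<delta>"
      then have "x \<in> B" by (simp add: good_at_scale_def)
      then obtain m where m: "x \<in> C m" using C(3) by blast
      have "ball x (\<delta> / 3) \<noteq> {}" using \<open>\<delta> > 0\<close> by simp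
      then obtain q where q: "q \<in> Q" "q \<in> ball x (\<delta> / 3)" using Q(2)[OF open_ball] by blast
      then have "x \<in> P (m, q)" using x m by (simp add: P_def dist_commute)
      then show "x \<in> \<Union>(P ` (UNIV \<times> Q))" using q(1) by blast
    qed
  qed
qed

lemma hausdorff_outer_null_subset:
  assumes "hausdorff_outer n F = 0" "E \<subseteq> F"
  shows "hausdorff_outer n E = 0"
  using hausdorff_outer_mono[OF assms(2), of n] assms(1) by simp

lemma same_segment_lengths_comp:
  assumes "preserves_curve_length \<Phi>" and lip: "L-lipschitz_on B f"
  shows "same_segment_lengths B f (\<Phi> \<circ> f)"
  unfolding same_segment_lengths_def
proof (intro allI impI)
  fix x v and p q :: real assume pq: "p \<le> q" "\<forall>s\<in>{p..q}. x + s *\<^sub>R v \<in> B"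
  define \<gamma> where "\<gamma> = (\<lambda>s. f (x + s *\<^sub>R v))"
  have l: "(L * norm v)-lipschitz_on {p..q} \<gamma>"
    unfolding \<gamma>_def by (rule lipschitz_on_line[OF lip]) (use pq in blast)
  have "curve_length p q \<gamma> < \<infinity>"
    using le_less_trans[OF curve_length_le_lipschitz[OF l] ennreal_less_top] by (simp add: infinity_ennreal_def)
  then have "rectifiable_curve p q \<gamma>"
    using pq(1) lipschitz_on_continuous_on[OF l] by (simp add: rectifiable_curve_def)
  then have "curve_length p q (\<Phi> \<circ> \<gamma>) = curve_length p q \<gamma>"
    using assms(1) by (simp add: preserves_curve_length_def)
  then show "curve_length p q (\<lambda>s. f (x + s *\<^sub>R v)) = curve_length p q (\<lambda>s. (\<Phi> \<circ> f) (x + s *\<^sub>R v))"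
    by (simp add: \<gamma>_def comp_def)
qed

text \<open>
  The distance of two points of the image of \<open>h\<close> is at most the length of the image of the segment,
  which is the same for \<open>f\<close>. Together with the preceding lemma this gives continuity of \<open>\<Phi>\<close> along
  \<open>f\<close>.
\<close>

lemma lipschitz_on_if_same_segment_lengths:
  assumes same: "same_segment_lengths B f h" and lip: "L-lipschitz_on B f" and "convex B"
  shows "L-lipschitz_on B h"
proof (rule lipschitz_onI)
  show L: "0 \<le> L" using lip by (rule lipschitz_on_nonneg)
  fix x z assume xz: "x \<in> B" "z \<in> B"
  have seg: "x + s *\<^sub>R (z - x) \<in> B" if "s \<in> {0..1}" for s
  proof -
    have "(1 - s) *\<^sub>R x + s *\<^sub>R z \<in> B" using that xz by (intro convexD[OF \<open>convex B\<close>]) auto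
    then show ?thesis by (simp add: algebra_simps)
  qed
  have "ennreal (dist (h x) (h z)) \<le> curve_length 0 1 (\<lambda>s. h (x + s *\<^sub>R (z - x)))"
    using dist_le_curve_length[of 0 1 "\<lambda>s. h (x + s *\<^sub>R (z - x))"] by simp
  also have "\<dots> = curve_length 0 1 (\<lambda>s. f (x + s *\<^sub>R (z - x)))"
    using same seg unfolding same_segment_lengths_def by simp
  also have "\<dots> \<le> ennreal (L * norm (z - x) * (1 - 0))"
    by (rule curve_length_le_lipschitz[OF lipschitz_on_line[OF lip seg]])
  finally show "dist (h x) (h z) \<le> L * dist x z"
    using L by (simp add: ennreal_le_iff dist_norm norm_minus_commute)
qed

text \<open>
  Flatness is shared by \<open>f\<close> and \<open>h\<close> outside \<open>N\<close>, so the same remainder is small under both maps.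
\<close>

lemma ball_decomposition:
  fixes f :: "real ^ 'n \<Rightarrow> 'a::metric_space" and h :: "real ^ 'n \<Rightarrow> 'b::metric_space"
  assumes B: "open B" "convex B" "bounded B" and lip: "L-lipschitz_on B f" "L-lipschitz_on B h"
    and same: "same_segment_lengths B f h" and \<epsilon>: "\<epsilon> > 0"
  obtains \<K> where "countable \<K>" "\<And>K. K \<in> \<K> \<Longrightarrow> compact K \<and> K \<subseteq> B \<and> nearly_isometric_on \<epsilon> K f h"
    "hausdorff_outer CARD('n) (f ` (B - \<Union>\<K>)) = 0" "hausdorff_outer CARD('n) (h ` (B - \<Union>\<K>)) = 0"
proof -
  obtain N D where N: "N \<in> null_sets lborel" and D: "countable D" "D \<subseteq> sphere 0 1"
    and close: "\<And>x \<eta>. x \<in> B - N \<Longrightarrow> \<eta> > 0 \<Longrightarrow> \<exists>d>0. \<forall>z. dist x z < d \<longrightarrow>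
       z \<in> B \<and> \<bar>dist (f x) (f z) - dist (h x) (h z)\<bar> \<le> \<eta> * dist x z"
    and steep: "\<And>x. x \<in> B - N \<Longrightarrow> x \<notin> flat_points B D f \<Longrightarrow>
       \<exists>c>0. \<exists>d>0. \<forall>z. dist x z < d \<longrightarrow> z \<in> B \<and> c * dist x z \<le> dist (f x) (f z)"
    by (rule ae_metric_dichotomy[OF B(1) lip same]) (rule that; assumption)
  define G where "G = (\<lambda>(k :: nat, j :: nat). good_at_scale \<epsilon> B f h (1 / real (Suc k)) (1 / real (Suc j)))"
  have cont: "continuous_on B f" "continuous_on B h" using lip by (auto intro: lipschitz_on_continuous_on)
  have "\<exists>\<K>. countable \<K> \<and> (\<forall>K\<in>\<K>. compact K \<and> K \<subseteq> B \<and> nearly_isometric_on \<epsilon> K f h) \<and> G i \<subseteq> \<Union>\<K>" for i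
  proof -
    obtain k j where i: "i = (k, j)" by (cases i)
    have "0 < 1 / real (Suc j)" by simp
    then obtain \<K> where "countable \<K>" "\<And>K. K \<in> \<K> \<Longrightarrow> compact K \<and> K \<subseteq> B \<and> nearly_isometric_on \<epsilon> K f h"
      "good_at_scale \<epsilon> B f h (1 / real (Suc k)) (1 / real (Suc j)) \<subseteq> \<Union>\<K>"
      by (rule good_at_scale_pieces[OF B(1) cont _ less_imp_le[OF \<epsilon>]]) (rule that; assumption)
    then show ?thesis unfolding G_def i by (intro exI[of _ \<K>]) auto
  qed
  then have "\<forall>i. \<exists>\<K>. countable \<K> \<and> (\<forall>K\<in>\<K>. compact K \<and> K \<subseteq> B \<and> nearly_isometric_on \<epsilon> K f h) \<and> G i \<subseteq> \<Union>\<K>" ..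
  then obtain \<C> where \<C>: "\<forall>i. countable (\<C> i) \<and> (\<forall>K\<in>\<C> i. compact K \<and> K \<subseteq> B \<and> nearly_isometric_on \<epsilon> K f h) \<and> G i \<subseteq> \<Union>(\<C> i)"
    by (rule choice[THEN exE])
  have rest: "B - \<Union>(\<Union>i. \<C> i) \<subseteq> (B \<inter> N) \<union> (flat_points B D f - N)"
  proof
    fix x assume x: "x \<in> B - \<Union>(\<Union>i. \<C> i)"
    show "x \<in> (B \<inter> N) \<union> (flat_points B D f - N)"
    proof (rule ccontr)
      assume "x \<notin> (B \<inter> N) \<union> (flat_points B D f - N)"
      then have xBN: "x \<in> B - N" and nf: "x \<notin> flat_points B D f" using x by auto
      obtain c d1 where c: "c > 0" "d1 > 0" "\<And>z. dist x z < d1 \<Longrightarrow> c * dist x z \<le> dist (f x) (f z)"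
        using steep[OF xBN nf] by blast
      obtain k where k: "1 / real (Suc k) < c" by (rule nat_approx_posE[OF c(1)])
      have "0 < \<epsilon> * (1 / real (Suc k))" using \<epsilon> by simp
      then obtain d2 where d2: "d2 > 0" "\<And>z. dist x z < d2 \<Longrightarrow>
          \<bar>dist (f x) (f z) - dist (h x) (h z)\<bar> \<le> \<epsilon> * (1 / real (Suc k)) * dist x z"
        using close[OF xBN] by blast
      have "0 < min d1 d2" using c(2) d2(1) by simp
      then obtain j where j: "1 / real (Suc j) < min d1 d2" by (rule nat_approx_posE)
      have "x \<in> G (k, j)"
        unfolding G_def good_at_scale_def prod.case
      proof (intro CollectI conjI ballI impI)
        show "x \<in> B" using x by simp
        fix z assume z: "dist x z < 1 / real (Suc j)"
        have "1 / real (Suc k) * dist x z \<le> c * dist x z" using k by (intro mult_right_mono) auto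
        then show "1 / real (Suc k) * dist x z \<le> dist (f x) (f z)" using c(3)[of z] z j by linarith
        show "\<bar>dist (f x) (f z) - dist (h x) (h z)\<bar> \<le> \<epsilon> * (1 / real (Suc k)) * dist x z"
          using z j by (intro d2(2)) linarith
      qed
      then have "x \<in> \<Union>(\<C> (k, j))" using \<C> by blast
      then show False using x by blast
    qed
  qed
  have negN: "negligible (B \<inter> N)"
    using N by (auto simp: negligible_iff_null_sets intro: null_sets_completionI null_sets_completion_subset)
  have bN: "bounded (B \<inter> N)" using B(3) by (rule bounded_subset) auto
  have flath: "flat_points B D f - N \<subseteq> flat_points B D h"
  proof
    fix x assume x: "x \<in> flat_points B D f - N"
    then have xBN: "x \<in> B - N" by (simp add: flat_points_def)
    show "x \<in> flat_points B D h"
    proof (rule flat_points_transfer[OF _ D(2)])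
      show "x \<in> flat_points B D f" using x by simp
      show "\<exists>d>0. \<forall>z. dist x z < d \<longrightarrow> \<bar>dist (f x) (f z) - dist (h x) (h z)\<bar> \<le> \<eta> * dist x z" if "\<eta> > 0" for \<eta>
        using close[OF xBN that] by blast
    qed
  qed
  show ?thesis
  proof (rule that)
    show "countable (\<Union>i. \<C> i)" using \<C> by (intro countable_UN[OF countableI_type]) blast
    show "compact K \<and> K \<subseteq> B \<and> nearly_isometric_on \<epsilon> K f h" if "K \<in> (\<Union>i. \<C> i)" for K
      using that \<C> by blast
    have "hausdorff_outer CARD('n) (f ` (B \<inter> N) \<union> f ` flat_points B D f) = 0"
      by (intro hausdorff_outer_null_Un hausdorff_outer_flat_points_null[OF B lip(1) D]
          hausdorff_outer_lipschitz_image_negligible[OF lip(1) _ bN negN]) auto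
    moreover have "f ` (B - \<Union>(\<Union>i. \<C> i)) \<subseteq> f ` (B \<inter> N) \<union> f ` flat_points B D f" using rest by blast
    ultimately show "hausdorff_outer CARD('n) (f ` (B - \<Union>(\<Union>i. \<C> i))) = 0"
      by (rule hausdorff_outer_null_subset)
    have "hausdorff_outer CARD('n) (h ` (B \<inter> N) \<union> h ` flat_points B D h) = 0"
      by (intro hausdorff_outer_null_Un hausdorff_outer_flat_points_null[OF B lip(2) D]
          hausdorff_outer_lipschitz_image_negligible[OF lip(2) _ bN negN]) auto
    moreover have "h ` (B - \<Union>(\<Union>i. \<C> i)) \<subseteq> h ` (B \<inter> N) \<union> h ` flat_points B D h" using rest flath by blast
    ultimately show "hausdorff_outer CARD('n) (h ` (B - \<Union>(\<Union>i. \<C> i))) = 0"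
      by (rule hausdorff_outer_null_subset)
  qed
qed

lemma locally_lipschitz_on_continuous_on:
  fixes f :: "'v::metric_space \<Rightarrow> 'a::metric_space"
  assumes "locally_lipschitz_on S f"
  shows "continuous_on S f"
  unfolding continuous_on_eq_continuous_within
proof
  fix x assume x: "x \<in> S"
  then obtain r L where r: "r > 0" "L-lipschitz_on (ball x r \<inter> S) f"
    using assms unfolding locally_lipschitz_on_def by blast
  have "continuous (at x within S \<inter> ball x r) f"
    using lipschitz_on_continuous_on[OF r(2)] x r(1)
    by (auto simp: continuous_on_eq_continuous_within Int_commute)
  then show "continuous (at x within S) f"
    using at_within_nhd[of x "ball x r" S "S \<inter> ball x r"] r(1) by (simp add: Int_assoc)
qed

text \<open>
  By Lindelof's theorem countably many balls suffice. The pieces depend on \<open>\<epsilon>\<close>, and so does the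
  remainder with null images.
\<close>

lemma lipschitz_image_decomposition:
  fixes f :: "real ^ 'n \<Rightarrow> 'a::metric_space" and \<Phi> :: "'a \<Rightarrow> 'b::metric_space"
  assumes \<Phi>: "preserves_curve_length \<Phi>" and "open \<Omega>" and loc: "locally_lipschitz_on \<Omega> f" and \<epsilon>: "\<epsilon> > 0"
  obtains \<K> where "countable \<K>"
    "\<And>K. K \<in> \<K> \<Longrightarrow> compact K \<and> K \<subseteq> \<Omega> \<and> nearly_isometric_on \<epsilon> K f (\<Phi> \<circ> f)"
    "hausdorff_outer CARD('n) (f ` (\<Omega> - \<Union>\<K>)) = 0"
    "hausdorff_outer CARD('n) (\<Phi> ` f ` (\<Omega> - \<Union>\<K>)) = 0"
proof -
  define \<B> where "\<B> = {B. \<exists>x r L. B = ball x r \<and> ball x r \<subseteq> \<Omega> \<and> L-lipschitz_on (ball x r) f}"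
  have "\<Union>\<B> = \<Omega>"
  proof (intro equalityI subsetI)
    fix x assume x: "x \<in> \<Omega>"
    then obtain r L where r: "r > 0" "L-lipschitz_on (ball x r \<inter> \<Omega>) f"
      using loc unfolding locally_lipschitz_on_def by blast
    obtain r' where r': "r' > 0" "ball x r' \<subseteq> \<Omega>" using x \<open>open \<Omega>\<close> open_contains_ball by blast
    have "L-lipschitz_on (ball x (min r r')) f"
      by (rule lipschitz_on_subset[OF r(2)]) (use r'(2) in auto)
    moreover have "ball x (min r r') \<subseteq> \<Omega>" using r'(2) by auto
    ultimately have "ball x (min r r') \<in> \<B>" unfolding \<B>_def by blast
    moreover have "x \<in> ball x (min r r')" using r(1) r'(1) by simp
    ultimately show "x \<in> \<Union>\<B>" by blast
  qed (auto simp: \<B>_def)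
  moreover have "open B" if "B \<in> \<B>" for B using that by (auto simp: \<B>_def)
  ultimately obtain \<B>' where \<B>': "\<B>' \<subseteq> \<B>" "countable \<B>'" "\<Union>\<B>' = \<Omega>"
    using Lindelof[of \<B>] by metis
  have "\<exists>\<K>. countable \<K> \<and> (\<forall>K\<in>\<K>. compact K \<and> K \<subseteq> \<Omega> \<and> nearly_isometric_on \<epsilon> K f (\<Phi> \<circ> f)) \<and>
    hausdorff_outer CARD('n) (f ` (B - \<Union>\<K>)) = 0 \<and> hausdorff_outer CARD('n) ((\<Phi> \<circ> f) ` (B - \<Union>\<K>)) = 0"
    if B: "B \<in> \<B>'" for B
  proof -
    obtain x r L where B': "B = ball x r" "B \<subseteq> \<Omega>" and lip: "L-lipschitz_on B f"
      using B \<B>'(1) by (auto simp: \<B>_def)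
    have geo: "open B" "convex B" "bounded B" by (auto simp: B'(1))
    have same: "same_segment_lengths B f (\<Phi> \<circ> f)" by (rule same_segment_lengths_comp[OF \<Phi> lip])
    have liph: "L-lipschitz_on B (\<Phi> \<circ> f)" by (rule lipschitz_on_if_same_segment_lengths[OF same lip geo(2)])
    obtain \<K> where "countable \<K>" "\<And>K. K \<in> \<K> \<Longrightarrow> compact K \<and> K \<subseteq> B \<and> nearly_isometric_on \<epsilon> K f (\<Phi> \<circ> f)"
      "hausdorff_outer CARD('n) (f ` (B - \<Union>\<K>)) = 0" "hausdorff_outer CARD('n) ((\<Phi> \<circ> f) ` (B - \<Union>\<K>)) = 0"
      by (rule ball_decomposition[OF geo lip liph same \<epsilon>]) (rule that; assumption)
    then show ?thesis using B'(2) by (intro exI[of _ \<K>]) blast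
  qed
  then have "\<forall>B\<in>\<B>'. \<exists>\<K>. countable \<K> \<and> (\<forall>K\<in>\<K>. compact K \<and> K \<subseteq> \<Omega> \<and> nearly_isometric_on \<epsilon> K f (\<Phi> \<circ> f)) \<and>
    hausdorff_outer CARD('n) (f ` (B - \<Union>\<K>)) = 0 \<and> hausdorff_outer CARD('n) ((\<Phi> \<circ> f) ` (B - \<Union>\<K>)) = 0" ..
  then obtain \<C> where \<C>: "\<forall>B\<in>\<B>'. countable (\<C> B) \<and> (\<forall>K\<in>\<C> B. compact K \<and> K \<subseteq> \<Omega> \<and> nearly_isometric_on \<epsilon> K f (\<Phi> \<circ> f)) \<and>
    hausdorff_outer CARD('n) (f ` (B - \<Union>(\<C> B))) = 0 \<and> hausdorff_outer CARD('n) ((\<Phi> \<circ> f) ` (B - \<Union>(\<C> B))) = 0"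
    by (rule bchoice[THEN exE])
  define \<K> where "\<K> = (\<Union>B\<in>\<B>'. \<C> B)"
  have rest: "\<Omega> - \<Union>\<K> \<subseteq> (\<Union>B\<in>\<B>'. B - \<Union>(\<C> B))" using \<B>'(3) by (auto simp: \<K>_def)
  show ?thesis
  proof (rule that)
    show "countable \<K>" unfolding \<K>_def using \<C> by (intro countable_UN[OF \<B>'(2)]) blast
    show "compact K \<and> K \<subseteq> \<Omega> \<and> nearly_isometric_on \<epsilon> K f (\<Phi> \<circ> f)" if "K \<in> \<K>" for K
      using that \<C> by (auto simp: \<K>_def)
    have "hausdorff_outer CARD('n) (f ` (B - \<Union>(\<C> B))) = 0" if "B \<in> \<B>'" for B
      using bspec[OF \<C> that] by simp
    then have "hausdorff_outer CARD('n) (\<Union>B\<in>\<B>'. f ` (B - \<Union>(\<C> B))) = 0"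
      by (rule hausdorff_outer_null_UN[OF \<B>'(2)])
    moreover have "f ` (\<Omega> - \<Union>\<K>) \<subseteq> (\<Union>B\<in>\<B>'. f ` (B - \<Union>(\<C> B)))"
      unfolding image_UN[symmetric] by (rule image_mono[OF rest])
    ultimately show "hausdorff_outer CARD('n) (f ` (\<Omega> - \<Union>\<K>)) = 0"
      by (rule hausdorff_outer_null_subset)
    have "hausdorff_outer CARD('n) ((\<Phi> \<circ> f) ` (B - \<Union>(\<C> B))) = 0" if "B \<in> \<B>'" for B
      using bspec[OF \<C> that] by simp
    then have "hausdorff_outer CARD('n) (\<Union>B\<in>\<B>'. (\<Phi> \<circ> f) ` (B - \<Union>(\<C> B))) = 0"
      by (rule hausdorff_outer_null_UN[OF \<B>'(2)])
    moreover have "\<Phi> ` f ` (\<Omega> - \<Union>\<K>) \<subseteq> (\<Union>B\<in>\<B>'. (\<Phi> \<circ> f) ` (B - \<Union>(\<C> B)))"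
      unfolding image_comp image_UN[symmetric] by (rule image_mono[OF rest])
    ultimately show "hausdorff_outer CARD('n) (\<Phi> ` f ` (\<Omega> - \<Union>\<K>)) = 0"
      by (rule hausdorff_outer_null_subset)
  qed
qed

section \<open>Measurable sets and Lipschitz maps for the Hausdorff measure\<close>

lemma hausdorff_outer_Un_le: "hausdorff_outer n (E \<union> F) \<le> hausdorff_outer n E + hausdorff_outer n F"
proof -
  define A where "A = (\<lambda>i::nat. if i = 0 then E else if i = 1 then F else {})"
  have "E \<union> F \<subseteq> (\<Union>i. A i)"
  proof
    fix x assume "x \<in> E \<union> F"
    then have "x \<in> A 0 \<or> x \<in> A 1" by (auto simp: A_def)
    then show "x \<in> (\<Union>i. A i)" by blast
  qed
  then have "hausdorff_outer n (E \<union> F) \<le> hausdorff_outer n (\<Union>i. A i)" by (rule hausdorff_outer_mono)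
  also have "\<dots> \<le> (\<Sum>i. hausdorff_outer n (A i))" by (rule hausdorff_outer_UN_le)
  also have "\<dots> = (\<Sum>i\<in>{0, 1}. hausdorff_outer n (A i))"
    by (rule suminf_finite) (auto simp: A_def)
  also have "\<dots> = hausdorff_outer n E + hausdorff_outer n F" by (simp add: A_def)
  finally show ?thesis .
qed

text \<open>
  A covering set of diameter at most \<open>\<delta>\<close> cannot meet both sets.
\<close>

lemma hausdorff_pre_separated:
  assumes sep: "\<And>x y. x \<in> E \<Longrightarrow> y \<in> F \<Longrightarrow> \<delta> < dist x y"
  shows "hausdorff_pre n \<delta> E + hausdorff_pre n \<delta> F \<le> hausdorff_pre n \<delta> (E \<union> F)"
proof -
  have "hausdorff_pre n \<delta> E + hausdorff_pre n \<delta> F \<le> (\<Sum>i. hausdorff_gauge n (A i))"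
    if A: "E \<union> F \<subseteq> (\<Union>i. A i)" "\<forall>i. bounded (A i) \<and> diameter (A i) \<le> \<delta>" for A :: "nat \<Rightarrow> 'a set"
  proof -
    have \<delta>: "0 \<le> \<delta>" using A(2) diameter_ge_0 order_trans by blast
    \<comment> \<open>Each covering set is assigned to \<open>E\<close> if it meets \<open>E\<close>, and to \<open>F\<close> otherwise.\<close>
    define A1 where "A1 = (\<lambda>i. if A i \<inter> E \<noteq> {} then A i else {})"
    define A2 where "A2 = (\<lambda>i. if A i \<inter> E \<noteq> {} then {} else A i)"
    have "E \<subseteq> (\<Union>i. A1 i)"
    proof
      fix x assume x: "x \<in> E"
      then obtain i where "x \<in> A i" using A(1) by blast
      then have "x \<in> A1 i" using x by (auto simp: A1_def)
      then show "x \<in> (\<Union>i. A1 i)" by blast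
    qed
    moreover have "\<forall>i. bounded (A1 i) \<and> diameter (A1 i) \<le> \<delta>" using A(2) \<delta> by (simp add: A1_def)
    ultimately have 1: "hausdorff_pre n \<delta> E \<le> (\<Sum>i. hausdorff_gauge n (A1 i))"
      unfolding hausdorff_pre_def by (intro INF_lower) simp
    have "F \<subseteq> (\<Union>i. A2 i)"
    proof
      fix y assume y: "y \<in> F"
      then obtain i where i: "y \<in> A i" using A(1) by blast
      have "A i \<inter> E = {}"
      proof (rule ccontr)
        assume "A i \<inter> E \<noteq> {}"
        then obtain x where x: "x \<in> A i" "x \<in> E" by blast
        have "dist x y \<le> diameter (A i)" using A(2) i x by (intro diameter_bounded_bound) auto
        then show False using sep[OF x(2) y] A(2) by (meson not_le order_trans)
      qed
      then have "y \<in> A2 i" using i by (simp add: A2_def)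
      then show "y \<in> (\<Union>i. A2 i)" by blast
    qed
    moreover have "\<forall>i. bounded (A2 i) \<and> diameter (A2 i) \<le> \<delta>" using A(2) \<delta> by (simp add: A2_def)
    ultimately have 2: "hausdorff_pre n \<delta> F \<le> (\<Sum>i. hausdorff_gauge n (A2 i))"
      unfolding hausdorff_pre_def by (intro INF_lower) simp
    have "(\<Sum>i. hausdorff_gauge n (A1 i)) + (\<Sum>i. hausdorff_gauge n (A2 i))
        = (\<Sum>i. hausdorff_gauge n (A1 i) + hausdorff_gauge n (A2 i))" by (rule suminf_add) auto
    also have "\<dots> = (\<Sum>i. hausdorff_gauge n (A i))"
      by (intro suminf_cong) (simp add: A1_def A2_def hausdorff_gauge_def)
    finally show ?thesis using add_mono[OF 1 2] by simp
  qed
  then show ?thesis unfolding hausdorff_pre_def[of n \<delta> "E \<union> F"] by (intro INF_greatest) simp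
qed

lemma hausdorff_outer_separated:
  assumes "d > 0" and sep: "\<And>x y. x \<in> E \<Longrightarrow> y \<in> F \<Longrightarrow> d \<le> dist x y"
  shows "hausdorff_outer n E + hausdorff_outer n F \<le> hausdorff_outer n (E \<union> F)"
proof -
  have le: "hausdorff_pre n \<delta> E + hausdorff_pre n \<delta>' F \<le> hausdorff_outer n (E \<union> F)" if "\<delta> > 0" "\<delta>' > 0" for \<delta> \<delta>'
  proof -
    \<comment> \<open>Below the distance of the two sets, and below both given scales.\<close>
    define \<eta> where "\<eta> = min (min \<delta> \<delta>') (d / 2)"
    have \<eta>: "\<eta> > 0" "\<eta> \<le> \<delta>" "\<eta> \<le> \<delta>'" "\<eta> < d" using that \<open>d > 0\<close> by (auto simp: \<eta>_def)
    have "hausdorff_pre n \<delta> E + hausdorff_pre n \<delta>' F \<le> hausdorff_pre n \<eta> E + hausdorff_pre n \<eta> F"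
      using \<eta> by (intro add_mono hausdorff_pre_antimono)
    also have "\<dots> \<le> hausdorff_pre n \<eta> (E \<union> F)"
      by (rule hausdorff_pre_separated) (use sep \<eta>(4) in \<open>meson less_le_trans\<close>)
    also have "\<dots> \<le> hausdorff_outer n (E \<union> F)"
      unfolding hausdorff_outer_eq_SUP using \<eta>(1) by (intro SUP_upper) simp
    finally show ?thesis .
  qed
  have ne: "{0::real<..} \<noteq> {}" by (auto intro: exI[of _ 1])
  have "hausdorff_outer n E + hausdorff_outer n F
      = (SUP \<delta>\<in>{0<..}. SUP \<delta>'\<in>{0<..}. hausdorff_pre n \<delta> E + hausdorff_pre n \<delta>' F)"
    unfolding hausdorff_outer_eq_SUP ennreal_SUP_add_right[OF ne, symmetric] ennreal_SUP_add_left[OF ne] ..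
  also have "\<dots> \<le> hausdorff_outer n (E \<union> F)" using le by (intro SUP_least) auto
  finally show ?thesis .
qed

lemma hausdorff_outer_separated_sum:
  fixes R :: "nat \<Rightarrow> 'a::metric_space set"
  assumes sep: "\<And>m. \<exists>d>0. \<forall>j<m. \<forall>x\<in>R j. \<forall>y\<in>R m. d \<le> dist x y"
  shows "(\<Sum>j<m. hausdorff_outer n (R j)) \<le> hausdorff_outer n (\<Union>j<m. R j)"
proof (induction m)
  case (Suc m)
  obtain d where d: "d > 0" "\<forall>j<m. \<forall>x\<in>R j. \<forall>y\<in>R m. d \<le> dist x y" using sep by blast
  have "(\<Sum>j<Suc m. hausdorff_outer n (R j)) \<le> hausdorff_outer n (\<Union>j<m. R j) + hausdorff_outer n (R m)"
    using Suc.IH by (simp add: add_right_mono)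
  also have "\<dots> \<le> hausdorff_outer n ((\<Union>j<m. R j) \<union> R m)"
    by (rule hausdorff_outer_separated[OF d(1)]) (use d(2) in auto)
  also have "(\<Union>j<m. R j) \<union> R m = (\<Union>j<Suc m. R j)" by (simp add: lessThan_Suc Un_commute)
  finally show ?case .
qed simp

text \<open>
  Shells around \<open>C\<close> whose indices differ by at least \<open>2\<close> have positive distance, so their measures
  add up.
\<close>

lemma hausdorff_outer_shells_le:
  fixes C T :: "'a::metric_space set"
  assumes "C \<noteq> {}" and R: "\<And>j. R j \<subseteq> {x \<in> T. 1 / real (Suc (Suc j)) \<le> infdist x C \<and> infdist x C < 1 / real (Suc j)}"
    and \<phi>: "\<And>i j. i < j \<Longrightarrow> \<phi> i + 2 \<le> \<phi> j"
  shows "(\<Sum>j. hausdorff_outer n (R (\<phi> j :: nat))) \<le> hausdorff_outer n T"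
proof (rule suminf_le_const)
  fix m
  have "\<exists>d>0. \<forall>j<m. \<forall>x\<in>R (\<phi> j). \<forall>y\<in>R (\<phi> m). d \<le> dist x y" for m
  proof -
    define d where "d = 1 / real (\<phi> m) - 1 / real (Suc (\<phi> m))"
    show ?thesis
    proof (cases "m = 0")
      case False
      then have p: "\<phi> m \<ge> 2" using \<phi>[of 0 m] by simp
      then have "1 / real (Suc (\<phi> m)) < 1 / real (\<phi> m)" by (intro divide_strict_left_mono) auto
      then have "d > 0" by (simp add: d_def)
      moreover have "d \<le> dist x y" if j: "j < m" and x: "x \<in> R (\<phi> j)" and y: "y \<in> R (\<phi> m)" for j x y
      proof -
        have "real (Suc (Suc (\<phi> j))) \<le> real (\<phi> m)" using \<phi>[OF j] by simp
        then have "1 / real (\<phi> m) \<le> 1 / real (Suc (Suc (\<phi> j)))" by (intro divide_left_mono) auto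
        also have "\<dots> \<le> infdist x C" using R x by blast
        also have "infdist x C \<le> infdist y C + dist x y" by (rule infdist_triangle)
        also have "infdist y C < 1 / real (Suc (\<phi> m))" using R y by blast
        finally show ?thesis by (simp add: d_def)
      qed
      ultimately show ?thesis by blast
    qed (auto intro: exI[of _ 1])
  qed
  then have "(\<Sum>j<m. hausdorff_outer n (R (\<phi> j))) \<le> hausdorff_outer n (\<Union>j<m. R (\<phi> j))"
    by (rule hausdorff_outer_separated_sum)
  also have "\<dots> \<le> hausdorff_outer n T" using R by (intro hausdorff_outer_mono) blast
  finally show "(\<Sum>j<m. hausdorff_outer n (R (\<phi> j))) \<le> hausdorff_outer n T" .
qed simp

lemma suminf_even_odd_ennreal:
  fixes a :: "nat \<Rightarrow> ennreal"
  shows "(\<Sum>j. a j) \<le> (\<Sum>j. a (2 * j)) + (\<Sum>j. a (2 * j + 1))"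
proof (rule suminf_le_const)
  fix N
  have "(\<Sum>j<N. a j) \<le> (\<Sum>j<2 * N. a j)" by (intro sum_mono2) auto
  also have "(\<Sum>j<2 * N. a j) = (\<Sum>j<N. a (2 * j)) + (\<Sum>j<N. a (2 * j + 1))"
    by (induction N) (auto simp: add_ac)
  also have "\<dots> \<le> (\<Sum>j. a (2 * j)) + (\<Sum>j. a (2 * j + 1))"
    by (intro add_mono sum_le_suminf) auto
  finally show "(\<Sum>j<N. a j) \<le> (\<Sum>j. a (2 * j)) + (\<Sum>j. a (2 * j + 1))" .
qed simp

lemma ennreal_suminf_tail_small:
  fixes a :: "nat \<Rightarrow> ennreal"
  assumes "(\<Sum>j. a j) < top" "\<epsilon> > 0"
  obtains k where "(\<Sum>j. a (j + k)) \<le> ennreal \<epsilon>"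
proof -
  define b where "b = (\<lambda>j. enn2real (a j))"
  have ab: "a j = ennreal (b j)" for j
    using ennreal_suminf_lessD[OF assms(1), of j] by (simp add: b_def)
  have b0: "0 \<le> b j" for j by (simp add: b_def)
  have sb: "summable b"
    using assms(1) by (intro summable_suminf_not_top b0) (simp add: ab[symmetric])
  then have "(\<lambda>k. \<Sum>j. b (j + k)) \<longlonglongrightarrow> 0" by (rule suminf_exist_split2)
  then have "\<forall>\<^sub>F k in sequentially. (\<Sum>j. b (j + k)) < \<epsilon>" using assms(2) by (rule order_tendstoD)
  then obtain k where k: "(\<Sum>j. b (j + k)) < \<epsilon>" by (auto simp: eventually_sequentially)
  have "(\<Sum>j. a (j + k)) = ennreal (\<Sum>j. b (j + k))"
    unfolding ab using sb b0 by (intro suminf_ennreal2) (auto simp: summable_iff_shift)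
  then show ?thesis using k by (intro that[of k]) (simp add: ennreal_leI)
qed

text \<open>
  Caratheodory's criterion for metric outer measures. The part of \<open>T\<close> at distance at least
  \<open>1 / (k + 1)\<close> from \<open>C\<close> is separated from \<open>C\<close>; the rest of \<open>T - C\<close> consists of shells with index at
  least \<open>k\<close>, whose measures form the tail of a convergent series.
\<close>

lemma hausdorff_outer_closed_caratheodory:
  fixes C T :: "'a::metric_space set"
  assumes "closed C"
  shows "hausdorff_outer n (T \<inter> C) + hausdorff_outer n (T - C) \<le> hausdorff_outer n T"
proof (cases "C = {} \<or> hausdorff_outer n T = top")
  case False
  then have C: "C \<noteq> {}" and fin: "hausdorff_outer n T < top" by (auto simp: top.not_eq_extremum)
  define R where "R = (\<lambda>j. {x \<in> T. 1 / real (Suc (Suc j)) \<le> infdist x C \<and> infdist x C < 1 / real (Suc j)})"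
  have shells: "(\<Sum>j. hausdorff_outer n (R (\<phi> j))) \<le> hausdorff_outer n T"
    if "\<And>i j. i < j \<Longrightarrow> \<phi> i + 2 \<le> \<phi> j" for \<phi>
    by (rule hausdorff_outer_shells_le[OF C _ that]) (auto simp: R_def)
  have "(\<Sum>j. hausdorff_outer n (R j)) \<le> hausdorff_outer n T + hausdorff_outer n T"
    by (rule order_trans[OF suminf_even_odd_ennreal add_mono[OF shells shells]]) auto
  also have "\<dots> < top" using fin by simp
  finally have sum: "(\<Sum>j. hausdorff_outer n (R j)) < top" .
  show ?thesis
  proof (rule ennreal_le_epsilon)
    fix \<epsilon> :: real assume "0 < \<epsilon>"
    obtain k where k: "(\<Sum>j. hausdorff_outer n (R (j + k))) \<le> ennreal \<epsilon>"
      by (rule ennreal_suminf_tail_small[OF sum \<open>0 < \<epsilon>\<close>])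
    define T' where "T' = {x \<in> T. 1 / real (Suc k) \<le> infdist x C}"
    have "T - C \<subseteq> T' \<union> (\<Union>j. R (j + k))"
    proof
      fix x assume x: "x \<in> T - C"
      then have pos: "infdist x C > 0"
        using in_closed_iff_infdist_zero[OF \<open>closed C\<close> C, of x] infdist_nonneg[of x C] by auto
      show "x \<in> T' \<union> (\<Union>j. R (j + k))"
      proof (cases "1 / real (Suc k) \<le> infdist x C")
        case False
        define m where "m = (LEAST m. 1 / real (Suc m) \<le> infdist x C)"
        obtain m0 where m0: "1 / real (Suc m0) < infdist x C" by (rule nat_approx_posE[OF pos])
        have m: "1 / real (Suc m) \<le> infdist x C"
          unfolding m_def by (rule LeastI[of "\<lambda>m. 1 / real (Suc m) \<le> infdist x C", OF less_imp_le[OF m0]])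
        have km: "k < m"
        proof (rule ccontr)
          assume "\<not> k < m"
          then have "1 / real (Suc k) \<le> 1 / real (Suc m)" by (intro divide_left_mono) auto
          then show False using m False by linarith
        qed
        from less_imp_Suc_add[OF km] obtain j where j: "m = Suc (j + k)" by (auto simp: add.commute)
        have "j + k < m" by (simp add: j)
        then have "\<not> 1 / real (Suc (j + k)) \<le> infdist x C"
          unfolding m_def by (rule not_less_Least)
        then have "x \<in> R (j + k)"
          using x m unfolding R_def j by (simp only: not_le mem_Collect_eq Diff_iff)
        then show ?thesis by blast
      qed (use x in \<open>auto simp: T'_def\<close>)
    qed
    then have "hausdorff_outer n (T - C) \<le> hausdorff_outer n (T' \<union> (\<Union>j. R (j + k)))"
      by (rule hausdorff_outer_mono)
    also have "\<dots> \<le> hausdorff_outer n T' + hausdorff_outer n (\<Union>j. R (j + k))"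
      by (rule hausdorff_outer_Un_le)
    also have "hausdorff_outer n (\<Union>j. R (j + k)) \<le> (\<Sum>j. hausdorff_outer n (R (j + k)))"
      by (rule hausdorff_outer_UN_le)
    also have "\<dots> \<le> ennreal \<epsilon>" by (rule k)
    finally have "hausdorff_outer n (T - C) \<le> hausdorff_outer n T' + ennreal \<epsilon>"
      by (simp add: add_left_mono)
    then have "hausdorff_outer n (T \<inter> C) + hausdorff_outer n (T - C) \<le>
        (hausdorff_outer n (T \<inter> C) + hausdorff_outer n T') + ennreal \<epsilon>"
      by (metis add.assoc add_left_mono)
    also have "hausdorff_outer n (T \<inter> C) + hausdorff_outer n T' \<le> hausdorff_outer n ((T \<inter> C) \<union> T')"
    proof (rule hausdorff_outer_separated)
      show "0 < 1 / real (Suc k)" by simp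
      fix x y assume "x \<in> T \<inter> C" "y \<in> T'"
      then show "1 / real (Suc k) \<le> dist x y"
        using infdist_le[of x C y] by (simp add: T'_def dist_commute)
    qed
    also have "\<dots> \<le> hausdorff_outer n T" by (rule hausdorff_outer_mono) (auto simp: T'_def)
    finally show "hausdorff_outer n (T \<inter> C) + hausdorff_outer n (T - C) \<le> hausdorff_outer n T + ennreal \<epsilon>"
      by (simp add: add_right_mono)
  qed
qed auto

lemma in_sets_hausdorff_measureI:
  assumes "\<And>T. hausdorff_outer n (T \<inter> A) + hausdorff_outer n (T - A) \<le> hausdorff_outer n T"
  shows "A \<in> sets (hausdorff_measure n)"
  unfolding sets_hausdorff_measure lambda_system_def
proof (intro CollectI conjI ballI UNIV_I)
  fix T
  have "T \<inter> A \<union> (T - A) = T" by blast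
  then have "hausdorff_outer n T \<le> hausdorff_outer n (T \<inter> A) + hausdorff_outer n (T - A)"
    using hausdorff_outer_Un_le[of n "T \<inter> A" "T - A"] by simp
  then have "hausdorff_outer n (T \<inter> A) + hausdorff_outer n (T - A) = hausdorff_outer n T"
    using assms[of T] by (rule antisym[rotated])
  moreover have "A \<inter> T = T \<inter> A" "(UNIV - A) \<inter> T = T - A" by auto
  ultimately show "hausdorff_outer n (A \<inter> T) + hausdorff_outer n ((UNIV - A) \<inter> T) = hausdorff_outer n T"
    by metis
qed

lemma borel_in_sets_hausdorff_measure:
  assumes "A \<in> sets borel"
  shows "A \<in> sets (hausdorff_measure n)"
proof -
  have "Collect closed \<subseteq> sets (hausdorff_measure n)"
    by (auto intro!: in_sets_hausdorff_measureI hausdorff_outer_closed_caratheodory)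
  from sets.sigma_sets_subset[OF this]
  have "sigma_sets UNIV (Collect closed) \<subseteq> sets (hausdorff_measure n)" by simp
  moreover have "sets borel = sigma_sets UNIV (Collect closed)"
    by (simp add: borel_eq_closed)
  ultimately show ?thesis using assms by blast
qed

lemma hausdorff_null_sets:
  assumes "hausdorff_outer n A = 0"
  shows "A \<in> null_sets (hausdorff_measure n)"
proof -
  have "A \<in> sets (hausdorff_measure n)"
  proof (rule in_sets_hausdorff_measureI)
    fix T
    have "hausdorff_outer n (T \<inter> A) = 0" using assms by (rule hausdorff_outer_null_subset) auto
    moreover have "hausdorff_outer n (T - A) \<le> hausdorff_outer n T" by (rule hausdorff_outer_mono) auto
    ultimately show "hausdorff_outer n (T \<inter> A) + hausdorff_outer n (T - A) \<le> hausdorff_outer n T" by simp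
  qed
  then show ?thesis using assms by (simp add: null_sets_def emeasure_hausdorff_measure)
qed

text \<open>
  Coverings of \<open>A\<close> by sets of diameter at most \<open>\<delta> / c\<close> yield coverings of the image by sets of
  diameter at most \<open>\<delta>\<close>.
\<close>

lemma hausdorff_outer_lipschitz_le:
  fixes \<phi> :: "'a::metric_space \<Rightarrow> 'b::metric_space"
  assumes c: "c > 0" and lip: "\<And>x y. x \<in> A \<Longrightarrow> y \<in> A \<Longrightarrow> dist (\<phi> x) (\<phi> y) \<le> c * dist x y"
  shows "hausdorff_outer n (\<phi> ` A) \<le> ennreal (c ^ n) * hausdorff_outer n A"
  unfolding hausdorff_outer_eq_SUP[of n "\<phi> ` A"]
proof (rule SUP_least)
  fix \<delta> :: real assume "\<delta> \<in> {0<..}"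
  then have \<delta>: "\<delta> > 0" by simp
  have cn: "c ^ n > 0" using c by simp
  have key: "hausdorff_pre n \<delta> (\<phi> ` A) \<le> ennreal (c ^ n) * (\<Sum>i. hausdorff_gauge n (E i))"
    if E: "A \<subseteq> (\<Union>i. E i)" "\<forall>i. bounded (E i) \<and> diameter (E i) \<le> \<delta> / c" for E :: "nat \<Rightarrow> 'a set"
  proof -
    have d: "dist p q \<le> c * diameter (E i)" if "p \<in> \<phi> ` (E i \<inter> A)" "q \<in> \<phi> ` (E i \<inter> A)" for p q i
    proof -
      obtain x y where xy: "p = \<phi> x" "q = \<phi> y" "x \<in> E i" "x \<in> A" "y \<in> E i" "y \<in> A" using \<open>p \<in> _\<close> \<open>q \<in> _\<close> by blast
      have "dist x y \<le> diameter (E i)" using E(2) xy by (intro diameter_bounded_bound) auto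
      then have "c * dist x y \<le> c * diameter (E i)" using c by (intro mult_left_mono) auto
      then show ?thesis unfolding xy(1,2) using lip[OF xy(4,6)] by linarith
    qed
    have cd: "0 \<le> c * diameter (E i)" "c * diameter (E i) \<le> \<delta>" for i
    proof -
      show "0 \<le> c * diameter (E i)" using c E(2) by (intro mult_nonneg_nonneg diameter_ge_0) auto
      have "c * diameter (E i) \<le> c * (\<delta> / c)" using c E(2) by (intro mult_left_mono) auto
      then show "c * diameter (E i) \<le> \<delta>" using c by simp
    qed
    have piece: "hausdorff_pre n \<delta> (\<phi> ` (E i \<inter> A)) \<le> ennreal (c ^ n) * hausdorff_gauge n (E i)" for i
    proof (cases "E i = {}")
      case True
      then show ?thesis using \<delta> by (simp add: hausdorff_pre_empty less_imp_le)
    next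
      case False
      have "hausdorff_pre n \<delta> (\<phi> ` (E i \<inter> A)) \<le> ennreal (unit_ball_vol (real n) / 2 ^ n * (c * diameter (E i)) ^ n)"
        by (rule hausdorff_pre_small_diameter_le[OF d cd])
      also have "\<dots> = ennreal (c ^ n * (unit_ball_vol (real n) / 2 ^ n * diameter (E i) ^ n))"
        by (simp add: power_mult_distrib mult_ac)
      also have "\<dots> = ennreal (c ^ n) * hausdorff_gauge n (E i)"
        using c False E(2) by (subst ennreal_mult) (auto simp: hausdorff_gauge_def diameter_ge_0)
      finally show ?thesis .
    qed
    have "\<phi> ` A \<subseteq> (\<Union>i. \<phi> ` (E i \<inter> A))" using E(1) by blast
    then have "hausdorff_pre n \<delta> (\<phi> ` A) \<le> hausdorff_pre n \<delta> (\<Union>i. \<phi> ` (E i \<inter> A))" by (rule hausdorff_pre_mono)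
    also have "\<dots> \<le> (\<Sum>i. hausdorff_pre n \<delta> (\<phi> ` (E i \<inter> A)))" by (rule hausdorff_pre_subadditive)
    also have "\<dots> \<le> (\<Sum>i. ennreal (c ^ n) * hausdorff_gauge n (E i))" by (intro suminf_le piece) auto
    also have "\<dots> = ennreal (c ^ n) * (\<Sum>i. hausdorff_gauge n (E i))" by simp
    finally show ?thesis .
  qed
  have cancel: "ennreal (c ^ n) * (ennreal (inverse (c ^ n)) * x) = x" "ennreal (inverse (c ^ n)) * (ennreal (c ^ n) * x) = x" for x
  proof -
    have "ennreal (c ^ n) * ennreal (inverse (c ^ n)) = ennreal (c ^ n * inverse (c ^ n))"
      using cn by (intro ennreal_mult[symmetric]) auto
    also have "c ^ n * inverse (c ^ n) = 1" using c by (intro right_inverse) simp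
    finally have e: "ennreal (c ^ n) * ennreal (inverse (c ^ n)) = 1" by simp
    show "ennreal (c ^ n) * (ennreal (inverse (c ^ n)) * x) = x"
      unfolding mult.assoc[symmetric] e by simp
    show "ennreal (inverse (c ^ n)) * (ennreal (c ^ n) * x) = x"
      unfolding mult.assoc[symmetric] mult.commute[of "ennreal (inverse (c ^ n))"] e by simp
  qed
  have "ennreal (inverse (c ^ n)) * hausdorff_pre n \<delta> (\<phi> ` A) \<le> hausdorff_pre n (\<delta> / c) A"
    unfolding hausdorff_pre_def[of n "\<delta> / c"]
  proof (rule INF_greatest)
    fix E assume "E \<in> {E :: nat \<Rightarrow> 'a set. A \<subseteq> (\<Union>i. E i) \<and> (\<forall>i. bounded (E i) \<and> diameter (E i) \<le> \<delta> / c)}"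
    then have "hausdorff_pre n \<delta> (\<phi> ` A) \<le> ennreal (c ^ n) * (\<Sum>i. hausdorff_gauge n (E i))"
      by (intro key) auto
    then have "ennreal (inverse (c ^ n)) * hausdorff_pre n \<delta> (\<phi> ` A) \<le>
        ennreal (inverse (c ^ n)) * (ennreal (c ^ n) * (\<Sum>i. hausdorff_gauge n (E i)))"
      by (rule mult_left_mono) simp
    then show "ennreal (inverse (c ^ n)) * hausdorff_pre n \<delta> (\<phi> ` A) \<le> (\<Sum>i. hausdorff_gauge n (E i))"
      unfolding cancel .
  qed
  also have "\<dots> \<le> hausdorff_outer n A"
    unfolding hausdorff_outer_eq_SUP using \<delta> c by (intro SUP_upper) simp
  finally have "ennreal (c ^ n) * (ennreal (inverse (c ^ n)) * hausdorff_pre n \<delta> (\<phi> ` A)) \<le> ennreal (c ^ n) * hausdorff_outer n A"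
    by (rule mult_left_mono) simp
  then show "hausdorff_pre n \<delta> (\<phi> ` A) \<le> ennreal (c ^ n) * hausdorff_outer n A" unfolding cancel .
qed

section \<open>Comparison of the integrals\<close>

lemma borel_measurable_hausdorff_measure:
  assumes "G \<in> borel_measurable borel"
  shows "G \<in> borel_measurable (hausdorff_measure n)"
proof (rule measurableI)
  fix A :: "'b set" assume "A \<in> sets borel"
  then have "G -` A \<in> sets borel" using measurable_sets[OF assms, of A] by simp
  then show "G -` A \<inter> space (hausdorff_measure n) \<in> sets (hausdorff_measure n)"
    by (simp add: borel_in_sets_hausdorff_measure)
qed simp

text \<open>
  The measure space is complete: on \<open>N\<close> the preimages under \<open>F\<close> are subsets of a null set, hence
  measurable.
\<close>

lemma borel_measurable_hausdorff_measure_AE: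
  assumes G: "G \<in> borel_measurable (hausdorff_measure n)" and "hausdorff_outer n N = 0"
    and eq: "\<And>x. x \<notin> N \<Longrightarrow> F x = G x"
  shows "F \<in> borel_measurable (hausdorff_measure n)"
proof (rule measurableI)
  fix A :: "'b set" assume A: "A \<in> sets borel"
  have "F -` A = (G -` A - N) \<union> (F -` A \<inter> N)" using eq by auto
  moreover have "N \<in> sets (hausdorff_measure n)" using hausdorff_null_sets[OF assms(2)] by auto
  moreover have "F -` A \<inter> N \<in> sets (hausdorff_measure n)"
    using hausdorff_null_sets[OF hausdorff_outer_null_subset[OF assms(2)], of "F -` A \<inter> N"] by auto
  moreover have "G -` A \<in> sets (hausdorff_measure n)" using measurable_sets[OF G A] by simp
  ultimately have "F -` A \<in> sets (hausdorff_measure n)" by (metis sets.Diff sets.Un)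
  then show "F -` A \<inter> space (hausdorff_measure n) \<in> sets (hausdorff_measure n)" by simp
qed simp

lemma nn_integral_le_scaled:
  assumes sets: "sets M = sets N" and f: "f \<in> borel_measurable N"
    and le: "\<And>A. A \<in> sets M \<Longrightarrow> emeasure M A \<le> c * emeasure N A"
  shows "nn_integral M f \<le> c * nn_integral N f"
proof -
  have "emeasure M A \<le> emeasure (scale_measure c N) A" for A
    by (cases "A \<in> sets M") (auto simp: le emeasure_notin_sets)
  then have "M \<le> scale_measure c N"
    using sets sets_eq_imp_space_eq[OF sets] by (simp add: le_measure_iff le_fun_def space_scale_measure)
  then have "nn_integral M f \<le> nn_integral (scale_measure c N) f"
    using sets by (intro nn_integral_mono_measure) simp_all
  then show ?thesis using f by (simp add: nn_integral_scale_measure)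
qed

text \<open>
  The restriction of the Hausdorff measure to \<open>P\<close>, and the pullback to \<open>P\<close> of its restriction to
  \<open>\<Phi> ` P\<close> by the inverse of \<open>\<Phi>\<close>, are two Borel measures that bound each other up to the \<open>n\<close>-th
  powers of the Lipschitz constants of \<open>\<Phi>\<close> and of its inverse.
\<close>

lemma near_isometry_integral:
  fixes \<Phi> :: "'a::metric_space \<Rightarrow> 'b::metric_space" and G :: "'a \<Rightarrow> ennreal"
  assumes P: "compact P" and \<epsilon>: "0 < \<epsilon>" "\<epsilon> < 1" and G: "G \<in> borel_measurable borel"
    and near: "\<And>x y. x \<in> P \<Longrightarrow> y \<in> P \<Longrightarrow> \<bar>dist x y - dist (\<Phi> x) (\<Phi> y)\<bar> \<le> \<epsilon> * dist x y"
  defines "H \<equiv> \<lambda>y. G (inv_into P \<Phi> y) * indicator (\<Phi> ` P) y"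
  shows "inj_on \<Phi> P" and "H \<in> borel_measurable borel"
    and "(\<integral>\<^sup>+y. H y \<partial>hausdorff_measure n) \<le>
         ennreal ((1 + \<epsilon>) ^ n) * (\<integral>\<^sup>+x. G x * indicator P x \<partial>hausdorff_measure n)"
    and "(\<integral>\<^sup>+x. G x * indicator P x \<partial>hausdorff_measure n) \<le>
         ennreal ((1 / (1 - \<epsilon>)) ^ n) * (\<integral>\<^sup>+y. H y \<partial>hausdorff_measure n)"
proof -
  let ?\<mu> = "hausdorff_measure n :: 'a measure" and ?\<nu> = "hausdorff_measure n :: 'b measure"
  define \<psi> where "\<psi> = inv_into P \<Phi>"
  have up: "dist (\<Phi> x) (\<Phi> y) \<le> (1 + \<epsilon>) * dist x y" if "x \<in> P" "y \<in> P" for x y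
    using near[OF that] by (simp add: distrib_right abs_le_iff)
  have low: "dist x y \<le> 1 / (1 - \<epsilon>) * dist (\<Phi> x) (\<Phi> y)" if "x \<in> P" "y \<in> P" for x y
  proof -
    have "(1 - \<epsilon>) * dist x y \<le> dist (\<Phi> x) (\<Phi> y)"
      using near[OF that] by (simp add: left_diff_distrib abs_le_iff)
    then show ?thesis using \<epsilon> by (simp add: field_simps)
  qed
  show inj: "inj_on \<Phi> P" using low by (fastforce simp: inj_on_def)
  have \<psi>\<Phi>: "\<psi> (\<Phi> x) = x" if "x \<in> P" for x using inj that by (simp add: \<psi>_def)
  have \<Phi>\<psi>: "\<Phi> (\<psi> y) = y" "\<psi> y \<in> P" if "y \<in> \<Phi> ` P" for y
    using that by (auto simp: \<psi>\<Phi>)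
  have "(1 + \<epsilon>)-lipschitz_on P \<Phi>" using up \<epsilon> by (intro lipschitz_onI) auto
  then have "compact (\<Phi> ` P)" using P by (intro compact_continuous_image lipschitz_on_continuous_on)
  then have Q: "\<Phi> ` P \<in> sets borel" by (intro borel_closed compact_imp_closed)
  have PB: "P \<in> sets borel" using P by (intro borel_closed compact_imp_closed)
  have "(1 / (1 - \<epsilon>))-lipschitz_on (\<Phi> ` P) \<psi>"
  proof (rule lipschitz_onI)
    fix u v assume uv: "u \<in> \<Phi> ` P" "v \<in> \<Phi> ` P"
    show "dist (\<psi> u) (\<psi> v) \<le> 1 / (1 - \<epsilon>) * dist u v"
      using low[OF \<Phi>\<psi>(2)[OF uv(1)] \<Phi>\<psi>(2)[OF uv(2)]] \<Phi>\<psi>(1)[OF uv(1)] \<Phi>\<psi>(1)[OF uv(2)] by simp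
  qed (use \<epsilon> in auto)
  then have "continuous_on (\<Phi> ` P) \<psi>" by (rule lipschitz_on_continuous_on)
  then have \<psi>m: "\<psi> \<in> borel_measurable (restrict_space borel (\<Phi> ` P))"
    by (rule borel_measurable_continuous_on_restrict)
  have "(\<lambda>y. G (\<psi> y)) \<in> borel_measurable (restrict_space borel (\<Phi> ` P))"
    by (rule measurable_compose[OF \<psi>m G])
  then show "H \<in> borel_measurable borel"
    using Q by (simp add: H_def \<psi>_def borel_measurable_restrict_space_iff_ennreal)
  have Q\<nu>: "\<Phi> ` P \<inter> space ?\<nu> \<in> sets ?\<nu>" and P\<mu>: "P \<inter> space ?\<mu> \<in> sets ?\<mu>"
    using Q PB by (auto simp: borel_in_sets_hausdorff_measure)
  have \<psi>\<nu>: "\<psi> \<in> restrict_space ?\<nu> (\<Phi> ` P) \<rightarrow>\<^sub>M borel"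
  proof (rule measurableI)
    fix A :: "'a set" assume "A \<in> sets borel"
    then have "\<psi> -` A \<inter> space (restrict_space borel (\<Phi> ` P)) \<in> sets (restrict_space borel (\<Phi> ` P))"
      by (rule measurable_sets[OF \<psi>m])
    then have "\<psi> -` A \<inter> \<Phi> ` P \<in> sets borel"
      using Q by (simp add: space_restrict_space sets_restrict_space_iff)
    then show "\<psi> -` A \<inter> space (restrict_space ?\<nu> (\<Phi> ` P)) \<in> sets (restrict_space ?\<nu> (\<Phi> ` P))"
      using Q\<nu> by (simp add: space_restrict_space sets_restrict_space_iff borel_in_sets_hausdorff_measure)
  qed simp
  have id\<mu>: "(\<lambda>x. x) \<in> restrict_space ?\<mu> P \<rightarrow>\<^sub>M borel"
  proof (rule measurableI)
    fix A :: "'a set" assume "A \<in> sets borel"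
    then have "A \<inter> P \<in> sets ?\<mu>" using PB by (intro borel_in_sets_hausdorff_measure sets.Int)
    then show "(\<lambda>x. x) -` A \<inter> space (restrict_space ?\<mu> P) \<in> sets (restrict_space ?\<mu> P)"
      using P\<mu> by (simp add: space_restrict_space sets_restrict_space_iff)
  qed simp
  define M1 where "M1 = distr (restrict_space ?\<mu> P) borel (\<lambda>x. x)"
  define M2 where "M2 = distr (restrict_space ?\<nu> (\<Phi> ` P)) borel \<psi>"
  have M: "sets M1 = sets borel" "sets M2 = sets borel" by (simp_all add: M1_def M2_def)
  have e1: "emeasure M1 A = hausdorff_outer n (A \<inter> P)" if A: "A \<in> sets borel" for A
  proof -
    have AP: "A \<inter> P \<in> sets ?\<mu>" using A PB by (intro borel_in_sets_hausdorff_measure sets.Int)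
    have "emeasure M1 A = emeasure (restrict_space ?\<mu> P) (A \<inter> P)"
      unfolding M1_def using id\<mu> A by (simp add: emeasure_distr space_restrict_space)
    also have "\<dots> = emeasure ?\<mu> (A \<inter> P)" using P\<mu> by (intro emeasure_restrict_space) auto
    also have "\<dots> = hausdorff_outer n (A \<inter> P)" by (rule emeasure_hausdorff_measure[OF AP])
    finally show ?thesis .
  qed
  have e2: "emeasure M2 A = hausdorff_outer n (\<Phi> ` (A \<inter> P))" if A: "A \<in> sets borel" for A
  proof -
    have eq: "\<psi> -` A \<inter> \<Phi> ` P = \<Phi> ` (A \<inter> P)" using \<psi>\<Phi> by auto
    have "\<psi> -` A \<inter> space (restrict_space ?\<nu> (\<Phi> ` P)) \<in> sets (restrict_space ?\<nu> (\<Phi> ` P))"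
      by (rule measurable_sets[OF \<psi>\<nu> A])
    then have m: "\<Phi> ` (A \<inter> P) \<in> sets ?\<nu>"
      using Q\<nu> by (simp add: space_restrict_space sets_restrict_space_iff eq)
    have "emeasure M2 A = emeasure (restrict_space ?\<nu> (\<Phi> ` P)) (\<Phi> ` (A \<inter> P))"
      unfolding M2_def using \<psi>\<nu> A by (simp add: emeasure_distr space_restrict_space eq)
    also have "\<dots> = emeasure ?\<nu> (\<Phi> ` (A \<inter> P))" using Q\<nu> by (intro emeasure_restrict_space) auto
    also have "\<dots> = hausdorff_outer n (\<Phi> ` (A \<inter> P))" by (rule emeasure_hausdorff_measure[OF m])
    finally show ?thesis .
  qed
  have i1: "nn_integral M1 G = (\<integral>\<^sup>+x. G x * indicator P x \<partial>?\<mu>)"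
    unfolding M1_def using G id\<mu> P\<mu> by (simp add: nn_integral_distr nn_integral_restrict_space)
  have i2: "nn_integral M2 G = (\<integral>\<^sup>+y. H y \<partial>?\<nu>)"
    unfolding M2_def using G \<psi>\<nu> Q\<nu> by (simp add: nn_integral_distr nn_integral_restrict_space H_def \<psi>_def)
  have "nn_integral M2 G \<le> ennreal ((1 + \<epsilon>) ^ n) * nn_integral M1 G"
  proof (rule nn_integral_le_scaled)
    fix A assume "A \<in> sets M2"
    then have A: "A \<in> sets borel" by (simp add: M)
    show "emeasure M2 A \<le> ennreal ((1 + \<epsilon>) ^ n) * emeasure M1 A"
      unfolding e1[OF A] e2[OF A] using \<epsilon> by (intro hausdorff_outer_lipschitz_le up) auto
  qed (use G in \<open>simp_all add: M M1_def\<close>)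
  then show "(\<integral>\<^sup>+y. H y \<partial>?\<nu>) \<le> ennreal ((1 + \<epsilon>) ^ n) * (\<integral>\<^sup>+x. G x * indicator P x \<partial>?\<mu>)"
    unfolding i1 i2 .
  have "nn_integral M1 G \<le> ennreal ((1 / (1 - \<epsilon>)) ^ n) * nn_integral M2 G"
  proof (rule nn_integral_le_scaled)
    fix A assume "A \<in> sets M1"
    then have A: "A \<in> sets borel" by (simp add: M)
    have "A \<inter> P = \<psi> ` \<Phi> ` (A \<inter> P)" using \<psi>\<Phi> by (auto simp: image_image)
    also have "hausdorff_outer n \<dots> \<le> ennreal ((1 / (1 - \<epsilon>)) ^ n) * hausdorff_outer n (\<Phi> ` (A \<inter> P))"
    proof (rule hausdorff_outer_lipschitz_le)
      fix u v assume "u \<in> \<Phi> ` (A \<inter> P)" "v \<in> \<Phi> ` (A \<inter> P)"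
      then show "dist (\<psi> u) (\<psi> v) \<le> 1 / (1 - \<epsilon>) * dist u v" using low by (auto simp: \<psi>\<Phi>)
    qed (use \<epsilon> in simp)
    finally show "emeasure M1 A \<le> ennreal ((1 / (1 - \<epsilon>)) ^ n) * emeasure M2 A"
      unfolding e1[OF A] e2[OF A] .
  qed (use G in \<open>simp_all add: M M2_def\<close>)
  then show "(\<integral>\<^sup>+x. G x * indicator P x \<partial>?\<mu>) \<le> ennreal ((1 / (1 - \<epsilon>)) ^ n) * (\<integral>\<^sup>+y. H y \<partial>?\<nu>)"
    unfolding i1 i2 .
qed

lemma infsum_ennreal_eq_suminf:
  fixes a :: "nat \<Rightarrow> ennreal"
  shows "infsum a UNIV = (\<Sum>i. a i)"
proof -
  have "a summable_on UNIV" by (rule nonneg_summable_on_complete) simp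
  then have "a sums infsum a UNIV" by (intro has_sum_imp_sums has_sum_infsum)
  then show ?thesis by (simp add: sums_iff)
qed

text \<open>
  Each point of the fibre lies in exactly one of the disjointed sets, and each of these contains at
  most one point of the fibre, so the sum over the fibre can be indexed by \<open>i\<close>. The terms with
  \<open>y \<notin> \<Phi> ` P i\<close> are cut off, because the inverse has no meaning there.
\<close>

lemma fibre_sum_eq_suminf:
  fixes g :: "'a \<Rightarrow> ennreal" and P :: "nat \<Rightarrow> 'a set"
  assumes inj: "\<And>i. inj_on \<Phi> (P i)" and fib: "\<Phi> -` {y} \<inter> X = \<Phi> -` {y} \<inter> (\<Union>i. P i)"
  shows "infsum g (\<Phi> -` {y} \<inter> X) = (\<Sum>i. g (inv_into (P i) \<Phi> y) *
     indicator (disjointed P i) (inv_into (P i) \<Phi> y) * indicator (\<Phi> ` P i) y)"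
proof -
  define \<psi> where "\<psi> = (\<lambda>i. inv_into (P i) \<Phi> y)"
  define I where "I = {i. \<exists>x\<in>disjointed P i. \<Phi> x = y}"
  have sub: "disjointed P i \<subseteq> P i" for i by (rule disjointed_subset)
  have \<psi>: "\<psi> i = x" if "x \<in> P i" "\<Phi> x = y" for i x
    using inv_into_f_f[OF inj that(1)] that(2) by (simp add: \<psi>_def)
  have \<psi>I: "\<psi> i \<in> disjointed P i" "\<Phi> (\<psi> i) = y" if "i \<in> I" for i
    using that \<psi> sub by (auto simp: I_def)
  have bij: "bij_betw \<psi> I (\<Phi> -` {y} \<inter> X)"
    unfolding bij_betw_def
  proof (intro conjI)
    show "inj_on \<psi> I"
    proof (rule inj_onI, rule ccontr)
      fix i j assume ij: "i \<in> I" "j \<in> I" "\<psi> i = \<psi> j" "i \<noteq> j"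
      then have "disjointed P i \<inter> disjointed P j = {}"
        using disjoint_family_disjointed[of P] by (auto simp: disjoint_family_on_def)
      then show False using \<psi>I(1)[OF ij(1)] \<psi>I(1)[OF ij(2)] ij(3) by auto
    qed
    show "\<psi> ` I = \<Phi> -` {y} \<inter> X"
    proof (intro equalityI subsetI)
      fix x assume "x \<in> \<psi> ` I"
      then obtain i where i: "i \<in> I" "x = \<psi> i" by blast
      have "x \<in> P i" using \<psi>I(1)[OF i(1)] sub i(2) by blast
      then have "x \<in> \<Phi> -` {y} \<inter> (\<Union>i. P i)" using \<psi>I(2)[OF i(1)] i(2) by auto
      then show "x \<in> \<Phi> -` {y} \<inter> X" using fib by simp
    next
      fix x assume "x \<in> \<Phi> -` {y} \<inter> X"
      then have x: "\<Phi> x = y" "x \<in> (\<Union>i. disjointed P i)" using fib UN_disjointed_eq[of P] by auto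
      then obtain i where i: "x \<in> disjointed P i" by blast
      then have "i \<in> I" using x by (auto simp: I_def)
      moreover have "\<psi> i = x" using \<psi> sub i x(1) by blast
      ultimately show "x \<in> \<psi> ` I" by blast
    qed
  qed
  define t where "t = (\<lambda>i. g (\<psi> i) * indicator (disjointed P i) (\<psi> i) * indicator (\<Phi> ` P i) y :: ennreal)"
  have "infsum g (\<Phi> -` {y} \<inter> X) = infsum (\<lambda>i. g (\<psi> i)) I"
    by (rule infsum_reindex_bij_betw[OF bij, symmetric])
  also have "\<dots> = infsum t UNIV"
  proof (rule infsum_cong_neutral)
    fix i assume i: "i \<in> UNIV - I"
    show "t i = 0"
    proof (cases "y \<in> \<Phi> ` P i")
      case True
      then have "\<Phi> (\<psi> i) = y" using \<psi> by auto
      then have "\<psi> i \<notin> disjointed P i" using i by (auto simp: I_def)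
      then show ?thesis by (simp add: t_def)
    qed (simp add: t_def)
  next
    fix i assume "i \<in> I \<inter> UNIV"
    then have i: "i \<in> I" by simp
    have "y \<in> \<Phi> ` P i" using \<psi>I[OF i] sub by (metis image_eqI subsetD)
    then show "g (\<psi> i) = t i" using \<psi>I(1)[OF i] by (simp add: t_def)
  qed simp
  also have "\<dots> = (\<Sum>i. t i)" by (rule infsum_ennreal_eq_suminf)
  finally show ?thesis by (simp add: t_def \<psi>_def)
qed

lemma ennreal_le_if_le_mult:
  fixes I J :: ennreal
  assumes "\<And>c. c > 1 \<Longrightarrow> J \<le> ennreal c * I"
  shows "J \<le> I"
proof (cases I)
  case (real r)
  have "J \<le> ennreal (2 * r)" using assms[of 2] real by (simp add: ennreal_mult)
  then obtain s where s: "J = ennreal s" "0 \<le> s" by (cases J) (auto simp: top_unique)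
  have le: "s \<le> c * r" if "c > 1" for c
    using assms[OF that] that real s by (simp add: ennreal_mult[symmetric] ennreal_le_iff)
  have "s \<le> r"
  proof (rule field_le_epsilon)
    fix e :: real assume e: "0 < e"
    have "s \<le> (1 + e / (r + 1)) * r" using e real by (intro le) auto
    also have "\<dots> \<le> r + e" using e real by (simp add: field_simps)
    finally show "s \<le> r + e" .
  qed
  then show ?thesis using real s by (simp add: ennreal_leI)
qed simp

lemma near_isometry_constants:
  fixes c :: real
  assumes "c > 1"
  obtains \<epsilon> where "0 < \<epsilon>" "\<epsilon> < 1" "(1 + \<epsilon>) ^ n \<le> c" "(1 / (1 - \<epsilon>)) ^ n \<le> c"
proof -
  have "((\<lambda>\<epsilon>::real. (1 + \<epsilon>) ^ n) \<longlongrightarrow> (1 + 0) ^ n) (at_right 0)"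
    by (intro tendsto_intros)
  then have 1: "\<forall>\<^sub>F \<epsilon> in at_right 0. (1 + \<epsilon>) ^ n < c" using assms by (intro order_tendstoD(2)) auto
  have "((\<lambda>\<epsilon>::real. (1 / (1 - \<epsilon>)) ^ n) \<longlongrightarrow> (1 / (1 - 0)) ^ n) (at_right 0)"
    by (intro tendsto_intros) auto
  then have 2: "\<forall>\<^sub>F \<epsilon> in at_right 0. (1 / (1 - \<epsilon>)) ^ n < c" using assms by (intro order_tendstoD(2)) auto
  have 3: "\<forall>\<^sub>F \<epsilon>::real in at_right 0. 0 < \<epsilon> \<and> \<epsilon> < 1"
    unfolding eventually_at_right_field by (intro exI[of _ 1]) auto
  have "\<forall>\<^sub>F \<epsilon> in at_right 0. 0 < \<epsilon> \<and> \<epsilon> < 1 \<and> (1 + \<epsilon>) ^ n \<le> c \<and> (1 / (1 - \<epsilon>)) ^ n \<le> c"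
    using 1 2 3 by eventually_elim auto
  then obtain \<epsilon> where "0 < \<epsilon> \<and> \<epsilon> < 1 \<and> (1 + \<epsilon>) ^ n \<le> c \<and> (1 / (1 - \<epsilon>)) ^ n \<le> c"
    using eventually_happens'[OF trivial_limit_at_right_real] by blast
  then show ?thesis by (intro that[of \<epsilon>]) auto
qed

text \<open>
  Outside the null set \<open>N\<close>, respectively \<open>\<Phi> ` N\<close>, both integrands are sums over the disjoint Borel
  pieces \<open>E i\<close> of \<open>f ` \<Omega>\<close>, and the terms belonging to \<open>E i\<close> are compared on \<open>P i\<close>, on which \<open>\<Phi>\<close> is
  nearly isometric.
\<close>

lemma integral_comparison:
  fixes \<Phi> :: "'a::metric_space \<Rightarrow> 'b::metric_space" and f :: "real ^ 'n \<Rightarrow> 'a" and g :: "'a \<Rightarrow> ennreal"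
  assumes \<Phi>: "preserves_curve_length \<Phi>" and "open \<Omega>" and loc: "locally_lipschitz_on \<Omega> f"
    and g: "g \<in> borel_measurable (restrict_space borel (f ` \<Omega>))"
    and \<epsilon>: "0 < \<epsilon>" "\<epsilon> < 1"
  defines "F \<equiv> \<lambda>y. infsum g (\<Phi> -` {y} \<inter> f ` \<Omega>) * indicator (\<Phi> ` f ` \<Omega>) y"
    and "n \<equiv> CARD('n)"
  shows "F \<in> borel_measurable (hausdorff_measure n)"
    and "(\<integral>\<^sup>+y. F y \<partial>hausdorff_measure n) \<le>
         ennreal ((1 + \<epsilon>) ^ n) * (\<integral>\<^sup>+x\<in>f ` \<Omega>. g x \<partial>hausdorff_measure n)"
    and "(\<integral>\<^sup>+x\<in>f ` \<Omega>. g x \<partial>hausdorff_measure n) \<le>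
         ennreal ((1 / (1 - \<epsilon>)) ^ n) * (\<integral>\<^sup>+y. F y \<partial>hausdorff_measure n)"
proof -
  let ?\<mu> = "hausdorff_measure n :: 'a measure" and ?\<nu> = "hausdorff_measure n :: 'b measure"
  let ?X = "f ` \<Omega>"
  obtain \<K> where \<K>: "countable \<K>"
    "\<And>K. K \<in> \<K> \<Longrightarrow> compact K \<and> K \<subseteq> \<Omega> \<and> nearly_isometric_on \<epsilon> K f (\<Phi> \<circ> f)"
    "hausdorff_outer n (f ` (\<Omega> - \<Union>\<K>)) = 0" "hausdorff_outer n (\<Phi> ` f ` (\<Omega> - \<Union>\<K>)) = 0"
    by (rule lipschitz_image_decomposition[OF \<Phi> \<open>open \<Omega>\<close> loc \<epsilon>(1), folded n_def]) (rule that; assumption)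
  define N where "N = f ` (\<Omega> - \<Union>\<K>)"
  have N: "hausdorff_outer n N = 0" "hausdorff_outer n (\<Phi> ` N) = 0" using \<K>(3,4) by (simp_all add: N_def)
  \<comment> \<open>The empty set is inserted so that the enumeration exists even if there are no pieces.\<close>
  define K where "K = from_nat_into (insert {} \<K>)"
  have rK: "range K = insert {} \<K>" unfolding K_def using \<K>(1) by (intro range_from_nat_into) auto
  have K: "compact (K i) \<and> K i \<subseteq> \<Omega> \<and> nearly_isometric_on \<epsilon> (K i) f (\<Phi> \<circ> f)" for i
  proof -
    have "K i \<in> insert {} \<K>" using rK by blast
    then show ?thesis using \<K>(2) by (auto simp: nearly_isometric_on_def)
  qed
  have UK: "(\<Union>i. K i) = \<Union>\<K>" unfolding rK by simp
  define P where "P = (\<lambda>i. f ` K i)"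
  have P: "compact (P i)" "P i \<subseteq> ?X" for i
    using K[of i] locally_lipschitz_on_continuous_on[OF loc]
    by (auto simp: P_def intro: compact_continuous_image continuous_on_subset)
  have near: "\<bar>dist x y - dist (\<Phi> x) (\<Phi> y)\<bar> \<le> \<epsilon> * dist x y" if "x \<in> P i" "y \<in> P i" for i x y
    using K[of i] that by (auto simp: P_def nearly_isometric_on_def)
  have XP: "?X \<subseteq> (\<Union>i. P i) \<union> N"
  proof
    fix x assume "x \<in> ?X"
    then obtain w where w: "w \<in> \<Omega>" "x = f w" by blast
    show "x \<in> (\<Union>i. P i) \<union> N"
    proof (cases "w \<in> \<Union>\<K>")
      case True
      then obtain i where "w \<in> K i" using UK by blast
      then show ?thesis using w by (auto simp: P_def)
    qed (use w in \<open>auto simp: N_def\<close>)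
  qed
  define E where "E = disjointed P"
  have EP: "E i \<subseteq> P i" for i unfolding E_def by (rule disjointed_subset)
  have "P i \<in> sets borel" for i using P(1) by (intro borel_closed compact_imp_closed)
  then have E: "E i \<in> sets borel" for i
    using sets.range_disjointed_sets[of P borel] by (auto simp: E_def)
  define G where "G = (\<lambda>i x. g x * indicator (E i) x)"
  have G: "G i \<in> borel_measurable borel" for i
  proof -
    have "g \<in> borel_measurable (restrict_space borel (E i))"
      using EP P(2) by (intro measurable_restrict_mono[OF g]) blast
    then show ?thesis using E by (simp add: G_def borel_measurable_restrict_space_iff_ennreal)
  qed
  have GP: "G i x * indicator (P i) x = G i x" for i x
    using EP[of i] by (auto simp: G_def indicator_def)
  define H where "H = (\<lambda>i y. G i (inv_into (P i) \<Phi> y) * indicator (\<Phi> ` P i) y)"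
  have inj: "inj_on \<Phi> (P i)" for i by (rule near_isometry_integral(1)[OF P(1) \<epsilon> G near])
  have H: "H i \<in> borel_measurable borel" for i
    unfolding H_def by (rule near_isometry_integral(2)[OF P(1) \<epsilon> G near])
  have "(\<integral>\<^sup>+y. H i y \<partial>?\<nu>) \<le> ennreal ((1 + \<epsilon>) ^ n) * (\<integral>\<^sup>+x. G i x * indicator (P i) x \<partial>?\<mu>)" for i
    unfolding H_def by (rule near_isometry_integral(3)[OF P(1) \<epsilon> G near])
  then have HG: "(\<integral>\<^sup>+y. H i y \<partial>?\<nu>) \<le> ennreal ((1 + \<epsilon>) ^ n) * (\<integral>\<^sup>+x. G i x \<partial>?\<mu>)" for i
    unfolding GP .
  have "(\<integral>\<^sup>+x. G i x * indicator (P i) x \<partial>?\<mu>) \<le> ennreal ((1 / (1 - \<epsilon>)) ^ n) * (\<integral>\<^sup>+y. H i y \<partial>?\<nu>)" for i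
    unfolding H_def by (rule near_isometry_integral(4)[OF P(1) \<epsilon> G near])
  then have GH: "(\<integral>\<^sup>+x. G i x \<partial>?\<mu>) \<le> ennreal ((1 / (1 - \<epsilon>)) ^ n) * (\<integral>\<^sup>+y. H i y \<partial>?\<nu>)" for i
    unfolding GP .
  \<comment> \<open>Outside the image of \<open>N\<close> the whole fibre lies in the pieces.\<close>
  have Feq: "F y = (\<Sum>i. H i y)" if y: "y \<notin> \<Phi> ` N" for y
  proof -
    have fib: "\<Phi> -` {y} \<inter> ?X = \<Phi> -` {y} \<inter> (\<Union>i. P i)"
    proof (intro equalityI subsetI)
      fix x assume x: "x \<in> \<Phi> -` {y} \<inter> ?X"
      then have "x \<notin> N" using y by auto
      then show "x \<in> \<Phi> -` {y} \<inter> (\<Union>i. P i)" using x XP by blast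
    next
      fix x assume x: "x \<in> \<Phi> -` {y} \<inter> (\<Union>i. P i)"
      then obtain i where "x \<in> P i" by blast
      then have "x \<in> ?X" by (rule subsetD[OF P(2)])
      then show "x \<in> \<Phi> -` {y} \<inter> ?X" using x by blast
    qed
    have "infsum g (\<Phi> -` {y} \<inter> ?X) = (\<Sum>i. H i y)"
      using fibre_sum_eq_suminf[OF inj fib, of g] by (simp add: H_def G_def E_def)
    moreover have "infsum g (\<Phi> -` {y} \<inter> ?X) = 0" if "y \<notin> \<Phi> ` ?X"
    proof -
      have "\<Phi> -` {y} \<inter> ?X = {}" using that by auto
      then show ?thesis by simp
    qed
    ultimately show ?thesis by (auto simp: F_def indicator_def)
  qed
  have sH: "(\<lambda>y. \<Sum>i. H i y) \<in> borel_measurable ?\<nu>"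
    using borel_measurable_hausdorff_measure[OF H] by measurable
  show "F \<in> borel_measurable ?\<nu>"
    by (rule borel_measurable_hausdorff_measure_AE[OF sH N(2) Feq])
  have "AE y in ?\<nu>. y \<notin> \<Phi> ` N" by (rule AE_not_in[OF hausdorff_null_sets[OF N(2)]])
  then have "AE y in ?\<nu>. F y = (\<Sum>i. H i y)" by eventually_elim (rule Feq)
  then have "(\<integral>\<^sup>+y. F y \<partial>?\<nu>) = (\<integral>\<^sup>+y. (\<Sum>i. H i y) \<partial>?\<nu>)" by (rule nn_integral_cong_AE)
  also have "\<dots> = (\<Sum>i. \<integral>\<^sup>+y. H i y \<partial>?\<nu>)"
    by (rule nn_integral_suminf[OF borel_measurable_hausdorff_measure[OF H]])
  finally have IF: "(\<integral>\<^sup>+y. F y \<partial>?\<nu>) = (\<Sum>i. \<integral>\<^sup>+y. H i y \<partial>?\<nu>)" .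
  have Geq: "g x * indicator ?X x = (\<Sum>i. G i x)" if x: "x \<notin> N" for x
  proof (cases "x \<in> ?X")
    case True
    have "x \<in> (\<Union>i. E i)" unfolding E_def UN_disjointed_eq using True XP x by blast
    then obtain i where i: "x \<in> E i" by blast
    have "E i \<inter> E j = {}" if "j \<noteq> i" for j
      using that disjoint_family_disjointed[of P] by (auto simp: disjoint_family_on_def E_def)
    then have "G j x = 0" if "j \<notin> {i}" for j using that i by (auto simp: G_def indicator_def)
    then have "(\<Sum>i. G i x) = (\<Sum>j\<in>{i}. G j x)" by (intro suminf_finite) auto
    then show ?thesis using i True by (simp add: G_def)
  next
    case False
    then have "x \<notin> E i" for i using EP P(2) by blast
    then show ?thesis using False by (simp add: G_def)
  qed
  have "AE x in ?\<mu>. x \<notin> N" by (rule AE_not_in[OF hausdorff_null_sets[OF N(1)]])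
  then have "AE x in ?\<mu>. g x * indicator ?X x = (\<Sum>i. G i x)" by eventually_elim (rule Geq)
  then have "(\<integral>\<^sup>+x\<in>?X. g x \<partial>?\<mu>) = (\<integral>\<^sup>+x. (\<Sum>i. G i x) \<partial>?\<mu>)" by (rule nn_integral_cong_AE)
  also have "\<dots> = (\<Sum>i. \<integral>\<^sup>+x. G i x \<partial>?\<mu>)"
    by (rule nn_integral_suminf[OF borel_measurable_hausdorff_measure[OF G]])
  finally have IG: "(\<integral>\<^sup>+x\<in>?X. g x \<partial>?\<mu>) = (\<Sum>i. \<integral>\<^sup>+x. G i x \<partial>?\<mu>)" .
  show "(\<integral>\<^sup>+y. F y \<partial>?\<nu>) \<le> ennreal ((1 + \<epsilon>) ^ n) * (\<integral>\<^sup>+x\<in>?X. g x \<partial>?\<mu>)"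
    unfolding IF IG ennreal_suminf_cmult[symmetric] by (intro suminf_le HG) auto
  show "(\<integral>\<^sup>+x\<in>?X. g x \<partial>?\<mu>) \<le> ennreal ((1 / (1 - \<epsilon>)) ^ n) * (\<integral>\<^sup>+y. F y \<partial>?\<nu>)"
    unfolding IF IG ennreal_suminf_cmult[symmetric] by (intro suminf_le GH) auto
qed

theorem theorem1p6:
  fixes \<Phi> :: "'a::metric_space \<Rightarrow> 'b::metric_space"
    and f :: "real ^ 'n \<Rightarrow> 'a"
    and \<Omega> :: "(real ^ 'n) set"
    and g :: "'a \<Rightarrow> ennreal"
  assumes "preserves_curve_length \<Phi>"
    and "open \<Omega>"
    and "locally_lipschitz_on \<Omega> f"
    and "g \<in> borel_measurable (restrict_space borel (f ` \<Omega>))"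
  shows "(\<lambda>y. (\<Sum>\<^sub>\<infinity>x\<in>\<Phi> -` {y} \<inter> f ` \<Omega>. g x) * indicator (\<Phi> ` f ` \<Omega>) y)
           \<in> borel_measurable (hausdorff_measure CARD('n)) \<and>
         (\<integral>\<^sup>+x\<in>f ` \<Omega>. g x \<partial>hausdorff_measure CARD('n)) =
         (\<integral>\<^sup>+y\<in>\<Phi> ` f ` \<Omega>. (\<Sum>\<^sub>\<infinity>x\<in>\<Phi> -` {y} \<inter> f ` \<Omega>. g x) \<partial>hausdorff_measure CARD('n))"
proof (intro conjI antisym)
  show "(\<lambda>y. (\<Sum>\<^sub>\<infinity>x\<in>\<Phi> -` {y} \<inter> f ` \<Omega>. g x) * indicator (\<Phi> ` f ` \<Omega>) y)
           \<in> borel_measurable (hausdorff_measure CARD('n))"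
    by (rule integral_comparison(1)[OF assms, of "1 / 2"]) auto
  show "(\<integral>\<^sup>+x\<in>f ` \<Omega>. g x \<partial>hausdorff_measure CARD('n)) \<le>
         (\<integral>\<^sup>+y\<in>\<Phi> ` f ` \<Omega>. (\<Sum>\<^sub>\<infinity>x\<in>\<Phi> -` {y} \<inter> f ` \<Omega>. g x) \<partial>hausdorff_measure CARD('n))"
    (is "?I \<le> ?J")
  proof (rule ennreal_le_if_le_mult)
    fix c :: real assume "c > 1"
    then obtain \<epsilon> where \<epsilon>: "0 < \<epsilon>" "\<epsilon> < 1" "(1 / (1 - \<epsilon>)) ^ CARD('n) \<le> c"
      by (rule near_isometry_constants)
    have "?I \<le> ennreal ((1 / (1 - \<epsilon>)) ^ CARD('n)) * ?J"
      by (rule integral_comparison(3)[OF assms \<epsilon>(1,2)])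
    also have "\<dots> \<le> ennreal c * ?J" using \<epsilon>(3) by (intro mult_right_mono ennreal_leI) auto
    finally show "?I \<le> ennreal c * ?J" .
  qed
  show "?J \<le> ?I"
  proof (rule ennreal_le_if_le_mult)
    fix c :: real assume "c > 1"
    then obtain \<epsilon> where \<epsilon>: "0 < \<epsilon>" "\<epsilon> < 1" "(1 + \<epsilon>) ^ CARD('n) \<le> c"
      by (rule near_isometry_constants)
    have "?J \<le> ennreal ((1 + \<epsilon>) ^ CARD('n)) * ?I"
      by (rule integral_comparison(2)[OF assms \<epsilon>(1,2)])
    also have "\<dots> \<le> ennreal c * ?I" using \<epsilon>(3) by (intro mult_right_mono ennreal_leI) auto
    finally show "?J \<le> ennreal c * ?I" .
  qed
qed

end
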